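(* Fix a dimension $d\ge1$ and an interaction range $r\ge 1$ (positive integers). For each $n\ge1$ let $\Lambda=\Lambda_n\subset\mathbb{Z}^d$ with $|\Lambda_n|=n$, let $A=A_n=(A_{ij})_{i,j\in\Lambda_n}$ be a symmetric positive semidefinite real matrix with $A_{ij}=0$ whenever $d(i,j)>r$, let $h=h_n\in\mathbb{R}^{\Lambda_n}$, and let $\{X_i\}_{i\in\Lambda_n}$ follow the Ising model $P(X=x)\propto\exp(\frac12x^\top A_nx+h_n^\top x)$, $x\in\{-1,1\}^{\Lambda_n}$. Suppose that $\inf_{n\ge1}(1-\|A_n\|_{\mathrm{op}})>0$. Let $W_n=\frac1{\sqrt n}\sum_{i\in\Lambda_n}X_i$, $\mu_n:=\mathbb{E}(W_n)$, $\sigma_n^2:=\mathrm{Var}(W_n)$. Then, as $n\to\infty$, $$\mathcal{W}_2(\mathcal{L}(W_n),N(\mu_n,\sigma_n^2))\to0.$$ If, in addition, $\|h_n\|_\infty$ is bounded by a universal constant (uniformly in $n$), then $$\frac{W_n-\mu_n}{\sigma_n}\to N(0,1)\quad\text{in distribution.}$$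
   Context: $d(i,j):=\max_{1\le k\le d}|i_k-j_k|$ is the maximum coordinate-wise distance for $i,j\in\mathbb{Z}^d$. $\|\cdot\|_{\mathrm{op}}$ is the operator norm. $\mathcal{L}(W)$ is the law of $W$, $N(\mu,\sigma^2)$ the normal distribution, and $\mathcal{W}_2(\mu,\nu):=\inf(\mathbb{E}|X-Y|^2)^{1/2}$ over all couplings $(X,Y)$ of $X\sim\mu$, $Y\sim\nu$. *)

theory Defs
  imports "HOL-Probability.Probability"
begin

definition lattice_dist :: "int ^ 'd \<Rightarrow> int ^ 'd \<Rightarrow> int" where
  "lattice_dist i j = (MAX k. \<bar>i $ k - j $ k\<bar>)"

text \<open>A matrix \<open>(A\<^sub>i\<^sub>j)\<close> indexed by a finite set \<open>I\<close> is a function of two arguments, of which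
  only the values on \<open>I\<close> are relevant; likewise for vectors.\<close>

definition quad_form :: "'i set \<Rightarrow> ('i \<Rightarrow> 'i \<Rightarrow> real) \<Rightarrow> ('i \<Rightarrow> real) \<Rightarrow> real" where
  "quad_form I A x = (\<Sum>i\<in>I. \<Sum>j\<in>I. x i * A i j * x j)"

definition sym_psd_on :: "'i set \<Rightarrow> ('i \<Rightarrow> 'i \<Rightarrow> real) \<Rightarrow> bool" where
  "sym_psd_on I A \<longleftrightarrow> (\<forall>i\<in>I. \<forall>j\<in>I. A i j = A j i) \<and> (\<forall>x. 0 \<le> quad_form I A x)"

text \<open>Operator norm on \<open>\<real>\<^sup>I\<close> with its Euclidean norm (\<^const>\<open>onorm\<close> needs the
  space to be a type, whereas here the index set varies). For finite \<open>I\<close> the supremum is over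
  a nonempty set that is bounded above.\<close>

definition op_norm_on :: "'i set \<Rightarrow> ('i \<Rightarrow> 'i \<Rightarrow> real) \<Rightarrow> real" where
  "op_norm_on I A = (SUP v \<in> {v. L2_set v I \<le> 1}. L2_set (\<lambda>i. \<Sum>j\<in>I. A i j * v j) I)"

definition spin_configs :: "'i set \<Rightarrow> ('i \<Rightarrow> real) set" where
  "spin_configs I = I \<rightarrow>\<^sub>E {-1, 1}"

definition ising_weight :: "'i set \<Rightarrow> ('i \<Rightarrow> 'i \<Rightarrow> real) \<Rightarrow> ('i \<Rightarrow> real) \<Rightarrow> ('i \<Rightarrow> real) \<Rightarrow> real" where
  "ising_weight I A h x = exp (1 / 2 * quad_form I A x + (\<Sum>i\<in>I. h i * x i))"

definition ising_prob :: "'i set \<Rightarrow> ('i \<Rightarrow> 'i \<Rightarrow> real) \<Rightarrow> ('i \<Rightarrow> real) \<Rightarrow> ('i \<Rightarrow> real) \<Rightarrow> real" where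
  "ising_prob I A h x = ising_weight I A h x / (\<Sum>y\<in>spin_configs I. ising_weight I A h y)"

definition follows_ising ::
    "'w measure \<Rightarrow> 'i set \<Rightarrow> ('i \<Rightarrow> 'i \<Rightarrow> real) \<Rightarrow> ('i \<Rightarrow> real) \<Rightarrow> ('i \<Rightarrow> 'w \<Rightarrow> real) \<Rightarrow> bool" where
  "follows_ising M I A h X \<longleftrightarrow> prob_space M \<and>
     distributed M (count_space (spin_configs I)) (\<lambda>\<omega>. \<lambda>i\<in>I. X i \<omega>)
       (\<lambda>x. ennreal (ising_prob I A h x))"

text \<open>The normal distribution \<open>N(m, v)\<close> with mean \<open>m\<close> and variance \<open>v\<close>; \<open>N(m, 0)\<close> is the
  point mass at \<open>m\<close>, whereas \<^const>\<open>normal_density\<close> with zero deviation is identically 0.\<close>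

definition normal_law :: "real \<Rightarrow> real \<Rightarrow> real measure" where
  "normal_law m v =
     (if v = 0 then return borel m else density lborel (normal_density m (sqrt v)))"

text \<open>A coupling is represented by the joint law of \<open>(X, Y)\<close>.\<close>

definition couplings :: "real measure \<Rightarrow> real measure \<Rightarrow> (real \<times> real) measure set" where
  "couplings \<mu> \<nu> = {\<gamma>. prob_space \<gamma> \<and> sets \<gamma> = sets (borel \<Otimes>\<^sub>M borel) \<and>
     distr \<gamma> borel fst = \<mu> \<and> distr \<gamma> borel snd = \<nu>}"

definition ennreal_sqrt :: "ennreal \<Rightarrow> ennreal" where
  "ennreal_sqrt x = (if x = top then top else ennreal (sqrt (enn2real x)))"

definition wasserstein2 :: "real measure \<Rightarrow> real measure \<Rightarrow> ennreal" where
  "wasserstein2 \<mu> \<nu> =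
     ennreal_sqrt (INF \<gamma>\<in>couplings \<mu> \<nu>. \<integral>\<^sup>+ p. ennreal (\<bar>fst p - snd p\<bar>\<^sup>2) \<partial>\<gamma>)"

end

theory Submission
  imports Defs "HOL-Complex_Analysis.Great_Picard"
begin

text \<open>The Ising measure is the endpoint \<open>t = 1\<close> of the flow of measures with weights proportional to
\<open>exp (t/2 * x\<^sup>T A x + h\<^sup>T x)\<close>, which starts at a product measure. Write \<open>A\<close> as the sum of
\<open>a\<^sub>k a\<^sub>k\<^sup>T\<close>, and let \<open>V t h\<close> be the logarithm of the partition sum. Its derivatives in the field \<open>h\<close>
are the cumulants of the spins, and with \<open>D\<^sub>k\<close> for the derivative in direction \<open>a\<^sub>k\<close> it solves the
Hamilton-Jacobi equation \<open>\<partial>\<^sub>t V = 1/2 * (\<Sum>k. D\<^sub>k\<^sup>2 V + (D\<^sub>k V)\<^sup>2)\<close>. Differentiating this equation,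
one finds that every cumulant solves a heat equation with drift \<open>D\<^sub>k V\<close> and with a source made of
cumulants of at most the same order (\<open>cum2_deriv_time\<close>, \<open>cum3_deriv_time\<close>). A maximum principle,
taken over all fields \<open>h\<close> and over the test vectors that measure the norm of the cumulant, turns
these equations into ordinary differential inequalities for the norms
(\<open>parabolic_maximum_principle\<close>).

For the covariance the inequality is the Riccati inequality \<open>y' \<le> \<alpha> * y\<^sup>2\<close> with \<open>y 0 \<le> 1\<close>, where
\<open>\<alpha>\<close> bounds the operator norm of \<open>A\<close>. So the covariance matrix has norm at most \<open>1 / (1 - \<alpha>)\<close>,
whatever the field (\<open>covariance_weighted_bound\<close>). The argument survives conjugation with
exponential weights centred at a site: since \<open>A\<close> has finite range, a small exponent changes its
norm only slightly. Hence covariances decay exponentially in the distance (\<open>covariance_decay\<close>),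
and the rows of the covariance matrix are summable uniformly in \<open>n\<close> and \<open>h\<close>. With this, the
equation for the third cumulant, viewed as a trilinear form on
\<open>\<ell>\<^sup>\<infinity> \<times> \<ell>\<^sup>2 \<times> \<ell>\<^sup>2\<close>, is a linear differential inequality (\<open>third_cumulant_bound\<close>), and
the third cumulant of \<open>W\<^sub>n\<close> is \<open>O(1 / sqrt n)\<close> uniformly in the field. It is here that
the finite range enters: a single spin influencing a fixed share of the variance would spoil the
limit law.

Weighting the measure with \<open>exp (s * W\<^sub>n)\<close> merely shifts the field, so the bound on the third cumulant
is a bound on the third derivative of the logarithm of the moment generating function, and
\<open>E exp (s * (W\<^sub>n - \<mu>\<^sub>n)) = exp (\<sigma>\<^sub>n\<^sup>2 * s\<^sup>2 / 2 + O(\<bar>s\<bar>\<^sup>3 / sqrt n))\<close>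
(\<open>uniform_magnetization_estimates\<close>). Along indices where \<open>\<sigma>\<^sub>n\<close> is bounded below, the
standardised moment generating functions converge to the Gaussian one. Montel's theorem and the
identity theorem carry this over to characteristic functions
(\<open>finite_mgf_tendsto_imp_char_tendsto\<close>), and Levy's theorem gives the central limit theorem there.
Since the second moments agree, a Skorohod coupling upgrades weak convergence to convergence in
\<open>\<W>\<^sub>2\<close> (\<open>wasserstein2_affine_tendsto_0\<close>). Where \<open>\<sigma>\<^sub>n\<close> is small, both laws are close to a point mass
(\<open>wasserstein2_le_second_moments\<close>). Finally, bounded fields keep \<open>\<sigma>\<^sub>n\<close> away from zero
(\<open>variance_lower_bound\<close>).\<close>

section \<open>The interpolating flow and its cumulants\<close>

definition dot :: "'i set \<Rightarrow> ('i \<Rightarrow> real) \<Rightarrow> ('i \<Rightarrow> real) \<Rightarrow> real" where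
  "dot I u x = (\<Sum>i\<in>I. u i * x i)"

definition tilt :: "('i \<Rightarrow> real) \<Rightarrow> real \<Rightarrow> ('i \<Rightarrow> real) \<Rightarrow> 'i \<Rightarrow> real" where
  "tilt h s d = (\<lambda>i. h i + s * d i)"

lemma dot_tilt: "dot I (tilt h s d) x = dot I h x + s * dot I d x"
  by (simp add: dot_def tilt_def sum.distrib sum_distrib_left algebra_simps)

lemma tilt_0 [simp]: "tilt h 0 d = h"
  by (simp add: tilt_def)

lemma finite_spin_configs: "finite I \<Longrightarrow> finite (spin_configs I)"
  by (simp add: spin_configs_def finite_PiE)

lemma spin_configs_nonempty: "spin_configs I \<noteq> {}"
  by (auto simp: spin_configs_def PiE_eq_empty_iff)

lemma spin_abs: "x \<in> spin_configs I \<Longrightarrow> i \<in> I \<Longrightarrow> \<bar>x i\<bar> = 1"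
  by (auto simp: spin_configs_def PiE_iff)

text \<open>The index set of the factorisation \<open>A = (\<Sum>k. a\<^sub>k a\<^sub>k\<^sup>T)\<close> is taken to be \<open>I\<close> itself. The vectors \<open>a k\<close>
vanish outside \<open>I\<close> so that moving the field along them changes only coordinates in \<open>I\<close>.\<close>

locale ising_flow =
  fixes I :: "'i set" and a :: "'i \<Rightarrow> 'i \<Rightarrow> real"
  assumes finite_I [simp]: "finite I"
    and a_outside: "i \<notin> I \<Longrightarrow> a k i = 0"
begin

abbreviation dir :: "'i \<Rightarrow> ('i \<Rightarrow> real) \<Rightarrow> real" where
  "dir k \<equiv> dot I (a k)"

definition weight :: "real \<Rightarrow> ('i \<Rightarrow> real) \<Rightarrow> ('i \<Rightarrow> real) \<Rightarrow> real" where
  "weight t h x = exp (t / 2 * (\<Sum>k\<in>I. (dir k x)\<^sup>2) + dot I h x)"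

definition part :: "real \<Rightarrow> ('i \<Rightarrow> real) \<Rightarrow> real" where
  "part t h = (\<Sum>x\<in>spin_configs I. weight t h x)"

definition mean :: "real \<Rightarrow> ('i \<Rightarrow> real) \<Rightarrow> (('i \<Rightarrow> real) \<Rightarrow> real) \<Rightarrow> real" where
  "mean t h p = (\<Sum>x\<in>spin_configs I. p x * weight t h x) / part t h"

lemma part_pos: "part t h > 0"
  unfolding part_def
  by (intro sum_pos) (auto simp: finite_spin_configs spin_configs_nonempty weight_def)

lemma mean_add: "mean t h (\<lambda>x. p x + q x) = mean t h p + mean t h q"
  by (simp add: mean_def sum.distrib algebra_simps add_divide_distrib)

lemma mean_diff: "mean t h (\<lambda>x. p x - q x) = mean t h p - mean t h q"
  by (simp add: mean_def sum_subtractf algebra_simps diff_divide_distrib)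

lemma mean_cmult: "mean t h (\<lambda>x. c * p x) = c * mean t h p"
  by (simp add: mean_def sum_distrib_left mult.assoc)

lemma mean_const [simp]: "mean t h (\<lambda>x. c) = c"
  using part_pos[of t h] by (simp add: mean_def sum_distrib_left[symmetric] part_def)

lemma mean_sum: "mean t h (\<lambda>x. \<Sum>j\<in>J. p j x) = (\<Sum>j\<in>J. mean t h (p j))"
  by (simp add: mean_def sum_distrib_right sum_divide_distrib) (rule sum.swap)

lemma mean_cong: "(\<And>x. x \<in> spin_configs I \<Longrightarrow> p x = q x) \<Longrightarrow> mean t h p = mean t h q"
  by (simp add: mean_def)

lemma mean_mono: "(\<And>x. x \<in> spin_configs I \<Longrightarrow> p x \<le> q x) \<Longrightarrow> mean t h p \<le> mean t h q"
  unfolding mean_def using part_pos[of t h]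
  by (intro divide_right_mono sum_mono mult_right_mono) (auto simp: weight_def)

lemma mean_abs_le:
  assumes "\<And>x. x \<in> spin_configs I \<Longrightarrow> \<bar>p x\<bar> \<le> c"
  shows "\<bar>mean t h p\<bar> \<le> c"
  using mean_mono[of p "\<lambda>_. c" t h] mean_mono[of "\<lambda>_. - c" p t h] assms
  by (auto simp: abs_le_iff minus_le_iff)

lemma weight_deriv_field:
  "((\<lambda>s. weight t (tilt h s d) x) has_real_derivative dot I d x * weight t (tilt h s d) x) (at s)"
  unfolding weight_def dot_tilt by (auto intro!: derivative_eq_intros)

lemma weight_deriv_time:
  "((\<lambda>t. weight t h x) has_real_derivative (1/2) * (\<Sum>k\<in>I. (dir k x)\<^sup>2) * weight t h x) (at t)"
  unfolding weight_def by (auto intro!: derivative_eq_intros)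

lemma mean_deriv_field:
  "((\<lambda>s. mean t (tilt h s d) p) has_real_derivative
     mean t (tilt h s d) (\<lambda>x. p x * dot I d x)
       - mean t (tilt h s d) p * mean t (tilt h s d) (dot I d)) (at s)"
proof -
  let ?h = "tilt h s d"
  have 1: "((\<lambda>s. \<Sum>x\<in>spin_configs I. p x * weight t (tilt h s d) x) has_real_derivative
      (\<Sum>x\<in>spin_configs I. p x * dot I d x * weight t ?h x)) (at s)"
    by (rule DERIV_sum) (auto intro!: derivative_eq_intros weight_deriv_field)
  have 2: "((\<lambda>s. part t (tilt h s d)) has_real_derivative
      (\<Sum>x\<in>spin_configs I. dot I d x * weight t ?h x)) (at s)"
    unfolding part_def by (rule DERIV_sum) (rule weight_deriv_field)
  have "((\<lambda>s. mean t (tilt h s d) p) has_real_derivative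
     ((\<Sum>x\<in>spin_configs I. p x * dot I d x * weight t ?h x) * part t ?h
       - (\<Sum>x\<in>spin_configs I. p x * weight t ?h x) * (\<Sum>x\<in>spin_configs I. dot I d x * weight t ?h x))
      / (part t ?h * part t ?h)) (at s)"
    unfolding mean_def by (rule DERIV_divide[OF 1 2]) (use part_pos[of t ?h] in auto)
  thus ?thesis
    by (rule DERIV_cong) (use part_pos[of t ?h] in \<open>simp add: mean_def field_simps\<close>)
qed

lemma mean_deriv_time:
  "((\<lambda>t. mean t h p) has_real_derivative
     (\<Sum>k\<in>I. (1/2) * (mean t h (\<lambda>x. p x * (dir k x)\<^sup>2)
       - mean t h p * mean t h (\<lambda>x. (dir k x)\<^sup>2)))) (at t)"
proof -
  define q where "q x = (\<Sum>k\<in>I. (dir k x)\<^sup>2)" for x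
  have 1: "((\<lambda>t. \<Sum>x\<in>spin_configs I. p x * weight t h x) has_real_derivative
      (\<Sum>x\<in>spin_configs I. p x * (1/2 * q x * weight t h x))) (at t)"
    unfolding q_def by (rule DERIV_sum) (rule DERIV_cmult[OF weight_deriv_time])
  have 2: "((\<lambda>t. part t h) has_real_derivative
      (\<Sum>x\<in>spin_configs I. 1/2 * q x * weight t h x)) (at t)"
    unfolding part_def q_def by (rule DERIV_sum) (rule weight_deriv_time)
  have 3: "((\<lambda>t. mean t h p) has_real_derivative
     ((\<Sum>x\<in>spin_configs I. p x * (1/2 * q x * weight t h x)) * part t h
       - (\<Sum>x\<in>spin_configs I. p x * weight t h x) * (\<Sum>x\<in>spin_configs I. 1/2 * q x * weight t h x))
      / (part t h * part t h)) (at t)"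
    unfolding mean_def by (rule DERIV_divide[OF 1 2]) (use part_pos[of t h] in auto)
  have 4: "(\<Sum>x\<in>spin_configs I. p x * (1/2 * q x * weight t h x))
        = 1/2 * (\<Sum>x\<in>spin_configs I. (p x * q x) * weight t h x)"
      "(\<Sum>x\<in>spin_configs I. 1/2 * q x * weight t h x) = 1/2 * (\<Sum>x\<in>spin_configs I. q x * weight t h x)"
    by (simp_all add: sum_distrib_left mult_ac)
  have 5: "((\<lambda>t. mean t h p) has_real_derivative
     (1/2) * (mean t h (\<lambda>x. p x * q x) - mean t h p * mean t h q)) (at t)"
    using 3 unfolding 4
    by (rule DERIV_cong) (use part_pos[of t h] in \<open>simp add: mean_def field_simps\<close>)
  have 6: "mean t h (\<lambda>x. p x * q x) = (\<Sum>k\<in>I. mean t h (\<lambda>x. p x * (dir k x)\<^sup>2))"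
    unfolding q_def sum_distrib_left by (rule mean_sum)
  have 7: "mean t h q = (\<Sum>k\<in>I. mean t h (\<lambda>x. (dir k x)\<^sup>2))"
    unfolding q_def by (rule mean_sum)
  show ?thesis using 5 unfolding 6 7
    by (rule DERIV_cong) (simp add: sum_distrib_left sum_subtractf algebra_simps)
qed

text \<open>Joint cumulants, as polynomials in moments. Admitting arbitrary observables makes the derivative of
a cumulant along a field direction, which is the next cumulant, a matter of formal differentiation.\<close>

definition cum2 where
  "cum2 t h p q = mean t h (\<lambda>x. p x * q x) - mean t h p * mean t h q"

definition cum3 where
  "cum3 t h p q r = mean t h (\<lambda>x. p x * q x * r x)
     - mean t h (\<lambda>x. p x * q x) * mean t h r - mean t h (\<lambda>x. p x * r x) * mean t h q
     - mean t h (\<lambda>x. q x * r x) * mean t h p + 2 * mean t h p * mean t h q * mean t h r"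

definition cum4 where
  "cum4 t h p q r s = mean t h (\<lambda>x. p x * q x * r x * s x)
     - mean t h (\<lambda>x. p x * q x * r x) * mean t h s - mean t h (\<lambda>x. p x * q x * s x) * mean t h r
     - mean t h (\<lambda>x. p x * r x * s x) * mean t h q - mean t h (\<lambda>x. q x * r x * s x) * mean t h p
     - mean t h (\<lambda>x. p x * q x) * mean t h (\<lambda>x. r x * s x)
     - mean t h (\<lambda>x. p x * r x) * mean t h (\<lambda>x. q x * s x)
     - mean t h (\<lambda>x. p x * s x) * mean t h (\<lambda>x. q x * r x)
     + 2 * (mean t h (\<lambda>x. p x * q x) * mean t h r * mean t h s
          + mean t h (\<lambda>x. p x * r x) * mean t h q * mean t h s
          + mean t h (\<lambda>x. p x * s x) * mean t h q * mean t h r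
          + mean t h (\<lambda>x. q x * r x) * mean t h p * mean t h s
          + mean t h (\<lambda>x. q x * s x) * mean t h p * mean t h r
          + mean t h (\<lambda>x. r x * s x) * mean t h p * mean t h q)
     - 6 * mean t h p * mean t h q * mean t h r * mean t h s"

lemma cum2_deriv_field:
  "((\<lambda>s. cum2 t (tilt h s d) p q) has_real_derivative cum3 t (tilt h s d) p q (dot I d)) (at s)"
  unfolding cum2_def cum3_def
  by (rule derivative_eq_intros mean_deriv_field refl)+ (simp add: algebra_simps)

lemma cum3_deriv_field:
  "((\<lambda>s. cum3 t (tilt h s d) p q r) has_real_derivative cum4 t (tilt h s d) p q r (dot I d)) (at s)"
  unfolding cum3_def cum4_def
  by (rule derivative_eq_intros mean_deriv_field refl)+ (simp add: algebra_simps)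

text \<open>The fifth joint cumulant, with its fifty-two terms folded into lower cumulants: the fourth
cumulant with the product of the last two observables as one entry, minus the contributions of the
partitions into two blocks that separate these two.\<close>

definition cum5 where
  "cum5 t h p q r s u = cum4 t h p q r (\<lambda>x. s x * u x) - cum4 t h p q r s * mean t h u - cum4 t h p q r u * mean t h s
    - cum3 t h p q s * cum2 t h r u - cum3 t h p r s * cum2 t h q u - cum3 t h q r s * cum2 t h p u
    - cum3 t h p q u * cum2 t h r s - cum3 t h p r u * cum2 t h q s - cum3 t h q r u * cum2 t h p s"

lemma cum4_deriv_field:
  "((\<lambda>s. cum4 t (tilt h s d) p q r w) has_real_derivative cum5 t (tilt h s d) p q r w (dot I d)) (at s)"
  unfolding cum4_def
  apply (rule derivative_eq_intros mean_deriv_field refl)+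
  apply (simp add: cum5_def cum4_def cum3_def cum2_def algebra_simps)
  done

text \<open>The evolution equation of the covariance: a heat operator in the directions \<open>a k\<close>, a drift
given by the means, and the covariance matrix squared through \<open>A\<close> as a source. Both sides are sums
over \<open>k\<close>, and for each \<open>k\<close> the equation is a polynomial identity between moments.\<close>

lemma cum2_deriv_time:
  "((\<lambda>t. cum2 t h p q) has_real_derivative
     (\<Sum>k\<in>I. 1/2 * cum4 t h p q (dir k) (dir k) + mean t h (dir k) * cum3 t h p q (dir k)
        + cum2 t h p (dir k) * cum2 t h q (dir k))) (at t)"
  unfolding cum2_def
  apply (rule derivative_eq_intros mean_deriv_time refl)+
  apply (simp only: sum_distrib_left sum_distrib_right sum.distrib[symmetric] sum_subtractf[symmetric])
  apply (rule sum.cong[OF refl])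
  apply (simp add: cum4_def cum3_def cum2_def algebra_simps power2_eq_square)
  done

text \<open>The source is linear in the third cumulant, which is what makes Gronwall's argument possible once
the covariance is under control.\<close>

lemma cum3_deriv_time:
  "((\<lambda>t. cum3 t h p q r) has_real_derivative
     (\<Sum>k\<in>I. 1/2 * cum5 t h p q r (dir k) (dir k) + mean t h (dir k) * cum4 t h p q r (dir k)
        + cum2 t h p (dir k) * cum3 t h q r (dir k)
        + cum2 t h q (dir k) * cum3 t h p r (dir k)
        + cum2 t h r (dir k) * cum3 t h p q (dir k))) (at t)"
  unfolding cum3_def
  apply (rule derivative_eq_intros mean_deriv_time refl)+
  apply (simp only: mult_zero_left add_0 sum_distrib_left sum_distrib_right sum.distrib[symmetric] sum_subtractf[symmetric])
  apply (rule sum.cong[OF refl])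
  apply (simp add: cum5_def cum4_def cum3_def cum2_def algebra_simps power2_eq_square)
  done

end

section \<open>A parabolic maximum principle\<close>

lemma compact_box:
  fixes lo hi :: "'i \<Rightarrow> real"
  shows "compact {h. \<forall>i. lo i \<le> h i \<and> h i \<le> hi i}"
proof -
  have "compactin (product_topology (\<lambda>i::'i. euclidean :: real topology) UNIV) (PiE UNIV (\<lambda>i. {lo i..hi i}))"
    by (subst compactin_PiE) auto
  moreover have "PiE UNIV (\<lambda>i. {lo i..hi i}) = {h. \<forall>i. lo i \<le> h i \<and> h i \<le> hi i}"
    by auto
  ultimately show ?thesis
    by (simp add: euclidean_product_topology)
qed

lemma derivatives_at_global_max:
  fixes g g' :: "real \<Rightarrow> real"
  assumes max: "\<And>s. g s \<le> g 0"
    and g: "\<And>s. (g has_real_derivative g' s) (at s)"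
    and g': "(g' has_real_derivative c) (at 0)"
  shows "g' 0 = 0" "c \<le> 0"
proof -
  show 0: "g' 0 = 0"
    using DERIV_local_max[OF g, of 1 0] max by simp
  show "c \<le> 0"
  proof (rule ccontr)
    assume "\<not> c \<le> 0"
    then obtain d where d: "d > 0" "\<And>h. 0 < h \<Longrightarrow> h < d \<Longrightarrow> g' 0 < g' h"
      using DERIV_pos_inc_right[OF g'] by force
    obtain z where z: "0 < z" "z < d / 2" "g (d/2) - g 0 = (d/2 - 0) * g' z"
      using MVT2[of 0 "d/2" g g'] g d(1) by auto
    have "g' z > 0" using d(2)[of z] z d(1) 0 by simp
    hence "(d/2 - 0) * g' z > 0" using d(1) by (intro mult_pos_pos) auto
    hence "g (d/2) > g 0" using z(3) by linarith
    thus False using max[of "d/2"] by simp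
  qed
qed

lemma derivative_at_left_max:
  fixes g :: "real \<Rightarrow> real"
  assumes "(g has_real_derivative c) (at t)" "t > 0" "\<And>s. 0 \<le> s \<Longrightarrow> s \<le> t \<Longrightarrow> g s \<le> g t"
  shows "c \<ge> 0"
proof (rule ccontr)
  assume "\<not> c \<ge> 0"
  then obtain d where d: "d > 0" "\<And>h. 0 < h \<Longrightarrow> h < d \<Longrightarrow> g t < g (t - h)"
    using DERIV_neg_dec_left[OF assms(1)] by force
  have "g t < g (t - min (d/2) t)"
    using d assms(2) by (intro d(2)) auto
  thus False using assms(3)[of "t - min (d/2) t"] assms(2) d(1) by auto
qed

text \<open>The differential inequality is required only where \<open>\<theta>\<close> maximises \<open>f \<theta> t h\<close> at the given \<open>t\<close> and
\<open>h\<close>. With \<open>\<theta>\<close> ranging over test vectors this means that \<open>f \<theta> t h\<close> is there the norm of a form, so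
nonlinear sources can be estimated by that norm. As the fields form a noncompact space, a
penalty growing like \<open>\<bar>h\<bar>\<^sup>2\<close> is subtracted to make sure that the maximum is attained; it grows
exponentially in \<open>t\<close> in order to beat its own image under the generator.\<close>

lemma parabolic_maximum_principle:
  fixes f :: "'p::topological_space \<Rightarrow> real \<Rightarrow> ('i \<Rightarrow> real) \<Rightarrow> real"
  assumes finI: "finite I" and finK: "finite K" and comp: "compact \<Theta>"
    and cont: "continuous_on (\<Theta> \<times> {0..1} \<times> UNIV) (\<lambda>(\<theta>, t, h). f \<theta> t h)"
    and bdd: "\<And>\<theta> t h. \<theta> \<in> \<Theta> \<Longrightarrow> t \<in> {0..1} \<Longrightarrow> f \<theta> t h \<le> B"
    and init: "\<And>\<theta> h. \<theta> \<in> \<Theta> \<Longrightarrow> f \<theta> 0 h \<le> 0"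
    and a0: "\<And>k i. i \<notin> I \<Longrightarrow> a k i = 0"
    and dt: "\<And>\<theta> t h. \<theta> \<in> \<Theta> \<Longrightarrow> 0 < t \<Longrightarrow> t \<le> 1 \<Longrightarrow>
        ((\<lambda>t. f \<theta> t h) has_real_derivative ft \<theta> t h) (at t)"
    and d1: "\<And>\<theta> t h k s. ((\<lambda>s. f \<theta> t (tilt h s (a k))) has_real_derivative fx k \<theta> t (tilt h s (a k))) (at s)"
    and d2: "\<And>\<theta> t h k s. ((\<lambda>s. fx k \<theta> t (tilt h s (a k))) has_real_derivative fxx k \<theta> t (tilt h s (a k))) (at s)"
    and drift: "\<And>k t h. k \<in> K \<Longrightarrow> \<bar>b k t h\<bar> \<le> B'"
    and ineq: "\<And>\<theta> t h. \<theta> \<in> \<Theta> \<Longrightarrow> 0 < t \<Longrightarrow> t \<le> 1 \<Longrightarrow> f \<theta> t h > 0 \<Longrightarrow>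
        (\<And>\<theta>'. \<theta>' \<in> \<Theta> \<Longrightarrow> f \<theta>' t h \<le> f \<theta> t h) \<Longrightarrow>
        ft \<theta> t h \<le> (\<Sum>k\<in>K. 1/2 * fxx k \<theta> t h + b k t h * fx k \<theta> t h) + C * f \<theta> t h"
    and \<theta>: "\<theta> \<in> \<Theta>" and t: "t \<in> {0..1}"
  shows "f \<theta> t h \<le> 0"
proof (rule ccontr)
  assume pos: "\<not> f \<theta> t h \<le> 0"
  \<comment> \<open>\<open>c\<close> dominates the generator applied to \<open>1 + \<bar>h\<bar>\<^sup>2\<close>.\<close>
  define p where "p h = (\<Sum>i\<in>I. (h i)\<^sup>2)" for h :: "'i \<Rightarrow> real"
  define c where "c = (\<Sum>k\<in>K. p (a k) + \<bar>B'\<bar> * (1 + p (a k))) + 1"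
  have p_nonneg: "p h \<ge> 0" for h by (simp add: p_def sum_nonneg)
  have B'0: "B' \<ge> 0" if "k \<in> K" for k using drift[OF that] by (meson abs_ge_zero order_trans)
  define E where "E = exp (\<bar>C\<bar>)"
  \<comment> \<open>Half of the positive value at \<open>(\<theta>, t, h)\<close> survives the penalty.\<close>
  define \<epsilon> where "\<epsilon> = exp (- C * t) * f \<theta> t h / (2 * (exp (c * t) * (1 + p h)))"
  have \<epsilon>: "\<epsilon> > 0"
    unfolding \<epsilon>_def using pos p_nonneg[of h] by (auto intro!: divide_pos_pos mult_pos_pos add_pos_nonneg)
  define w where "w \<theta> t h = exp (- C * t) * f \<theta> t h - \<epsilon> * exp (c * t) * (1 + p h)" for \<theta> t h
  have w_pos: "w \<theta> t h > 0"
  proof -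
    define N where "N = exp (c * t) * (1 + p h)"
    have "N > 0" unfolding N_def using p_nonneg[of h] by (intro mult_pos_pos) auto
    hence "w \<theta> t h = exp (- C * t) * f \<theta> t h / 2"
      unfolding w_def \<epsilon>_def mult.assoc N_def[symmetric] by (simp add: field_simps)
    moreover have "exp (- C * t) * f \<theta> t h > 0" using pos by (intro mult_pos_pos) auto
    ultimately show ?thesis by linarith
  qed
  define B1 where "B1 = E * \<bar>B\<bar>"
  have c0: "c \<ge> 1"
    unfolding c_def by (simp add: sum_nonneg p_nonneg)
  have w_neg: "w \<theta>' t' h' \<le> 0" if "\<theta>' \<in> \<Theta>" "t' \<in> {0..1}" "B1 / \<epsilon> \<le> p h'" for \<theta>' t' h'
  proof -
    have "exp (- C * t') * f \<theta>' t' h' \<le> exp (- C * t') * \<bar>B\<bar>"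
      using bdd[OF that(1,2), of h'] by (intro mult_left_mono) auto
    also have "\<dots> \<le> B1"
    proof -
      have "- C * t' \<le> \<bar>C\<bar> * t'" using that(2) by (intro mult_right_mono) auto
      also have "\<dots> \<le> \<bar>C\<bar>" using that(2) by (simp add: mult_left_le)
      finally show ?thesis unfolding B1_def E_def by (intro mult_right_mono) auto
    qed
    also have "B1 \<le> \<epsilon> * p h'" using that(3) \<epsilon> by (simp add: field_simps)
    also have "\<dots> \<le> \<epsilon> * exp (c * t') * (1 + p h')"
    proof -
      have "1 * p h' \<le> exp (c * t') * (1 + p h')"
        using c0 that(2) p_nonneg[of h'] by (intro mult_mono) auto
      thus ?thesis using \<epsilon> by simp
    qed
    finally show ?thesis by (simp add: w_def)
  qed
  \<comment> \<open>Outside the box with half side \<open>R\<close> the penalised function is nonpositive.\<close>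
  define R where "R = max (Max (insert 0 ((\<lambda>i. \<bar>h i\<bar>) ` I))) (sqrt (B1 / \<epsilon>))"
  have hR: "\<bar>h i\<bar> \<le> R" if "i \<in> I" for i
    unfolding R_def by (rule le_max_iff_disj[THEN iffD2], rule disjI1, rule Max_ge) (use that finI in auto)
  have outside: "B1 / \<epsilon> \<le> p h'" if "i \<in> I" "\<bar>h' i\<bar> \<ge> R" for h' i
  proof -
    have "0 \<le> B1 / \<epsilon>" using \<epsilon> by (simp add: B1_def E_def)
    hence "B1 / \<epsilon> = (sqrt (B1 / \<epsilon>))\<^sup>2" by simp
    also have "\<dots> \<le> (h' i)\<^sup>2"
      using that(2) \<open>0 \<le> B1 / \<epsilon>\<close> by (subst abs_le_square_iff[symmetric]) (auto simp: R_def)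
    also have "\<dots> \<le> p h'" unfolding p_def using that(1) finI
      by (intro member_le_sum[of i I "\<lambda>i. (h' i)\<^sup>2"]) auto
    finally show ?thesis .
  qed
  define S where "S = {h'. \<forall>i. (if i \<in> I then - R else h i) \<le> h' i \<and> h' i \<le> (if i \<in> I then R else h i)}"
  have "compact S" unfolding S_def by (rule compact_box)
  hence cS: "compact (\<Theta> \<times> {0..1::real} \<times> S)"
    using comp by (intro compact_Times compact_Icc)
  have hS: "h \<in> S" using hR unfolding S_def by (auto simp: abs_le_iff minus_le_iff)
  have "continuous_on (\<Theta> \<times> {0..1::real} \<times> S) (\<lambda>(\<theta>, t, h). w \<theta> t h)"
  proof -
    have 1: "continuous_on (\<Theta> \<times> {0..1::real} \<times> S) (\<lambda>z. f (fst z) (fst (snd z)) (snd (snd z)))"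
      using continuous_on_subset[OF cont, of "\<Theta> \<times> {0..1} \<times> S"] by (auto simp: case_prod_unfold)
    have 2: "continuous_on (\<Theta> \<times> {0..1::real} \<times> S) (\<lambda>z. snd (snd z) i)" for i
      by (rule continuous_on_product_then_coordinatewise) (intro continuous_intros)
    show ?thesis
      unfolding w_def p_def case_prod_unfold
      by (intro continuous_intros 1 2)
  qed
  moreover have "\<Theta> \<times> {0..1::real} \<times> S \<noteq> {}" using \<theta> t hS by blast
  ultimately obtain z where z: "z \<in> \<Theta> \<times> {0..1::real} \<times> S"
    and zmax: "\<And>y. y \<in> \<Theta> \<times> {0..1::real} \<times> S \<Longrightarrow> (\<lambda>(\<theta>, t, h). w \<theta> t h) y \<le> (\<lambda>(\<theta>, t, h). w \<theta> t h) z"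
    using continuous_attains_sup[OF cS] by blast
  obtain \<theta>0 t0 h0 where z_eq: "z = (\<theta>0, t0, h0)" by (cases z)
  have m: "\<theta>0 \<in> \<Theta>" "t0 \<in> {0..1}" "h0 \<in> S"
    using z unfolding z_eq by auto
  have mx: "w \<theta>' t' h' \<le> w \<theta>0 t0 h0" if "\<theta>' \<in> \<Theta>" "t' \<in> {0..1}" "h' \<in> S" for \<theta>' t' h'
    using zmax[of "(\<theta>', t', h')"] that unfolding z_eq by simp
  have w0: "w \<theta>0 t0 h0 > 0"
    using mx[OF \<theta> t hS] w_pos by simp
  have exp_pos': "\<epsilon> * exp (c * t0) * (1 + p h0) > 0"
    using \<epsilon> p_nonneg[of h0] by (intro mult_pos_pos) auto
  have f0: "f \<theta>0 t0 h0 > 0"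
  proof -
    have "exp (- C * t0) * f \<theta>0 t0 h0 > 0" using w0 exp_pos' unfolding w_def by linarith
    thus ?thesis by (simp add: zero_less_mult_iff)
  qed
  have t0: "t0 > 0" using m(2) f0 init[OF m(1), of h0] by (cases "t0 = 0") auto
  have global: "w \<theta>0 t0 (tilt h0 s (a k)) \<le> w \<theta>0 t0 h0" for s k
  proof (cases "tilt h0 s (a k) \<in> S")
    case False
    then obtain i where "\<not> ((if i \<in> I then - R else h i) \<le> tilt h0 s (a k) i \<and> tilt h0 s (a k) i \<le> (if i \<in> I then R else h i))"
      unfolding S_def by blast
    moreover have "tilt h0 s (a k) i = h i" if "i \<notin> I" 
    proof -
      have "h i \<le> h0 i \<and> h0 i \<le> h i" using m(3) that unfolding S_def by (auto dest: spec[of _ i])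
      hence "h0 i = h i" by simp
      thus ?thesis using a0[OF that] by (simp add: tilt_def)
    qed
    ultimately have "i \<in> I" "\<bar>tilt h0 s (a k) i\<bar> \<ge> R" by (auto split: if_splits)
    hence "B1 / \<epsilon> \<le> p (tilt h0 s (a k))" by (rule outside)
    from w_neg[OF m(1,2) this] w0 show ?thesis by simp
  qed (use mx[OF m(1,2)] in auto)
  define p1 where "p1 k h = 2 * (\<Sum>i\<in>I. h i * a k i)" for k h
  have dp1: "((\<lambda>s. p (tilt h' s (a k))) has_real_derivative p1 k (tilt h' s (a k))) (at s)" for h' s k
    unfolding p_def p1_def tilt_def sum_distrib_left
    by (rule DERIV_sum) (auto intro!: derivative_eq_intros simp: algebra_simps)
  have dp2: "((\<lambda>s. p1 k (tilt h' s (a k))) has_real_derivative 2 * p (a k)) (at s)" for h' s k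
    unfolding p_def p1_def tilt_def
    by (rule DERIV_cmult, rule DERIV_sum) (auto intro!: derivative_eq_intros simp: power2_eq_square)
  have max1: "exp (- C * t0) * fx k \<theta>0 t0 h0 = \<epsilon> * exp (c * t0) * p1 k h0"
    and max2: "exp (- C * t0) * fxx k \<theta>0 t0 h0 \<le> \<epsilon> * exp (c * t0) * (2 * p (a k))" for k
  proof -
    let ?g = "\<lambda>s. w \<theta>0 t0 (tilt h0 s (a k))"
    let ?g' = "\<lambda>s. exp (- C * t0) * fx k \<theta>0 t0 (tilt h0 s (a k)) - \<epsilon> * exp (c * t0) * p1 k (tilt h0 s (a k))"
    have A: "(?g has_real_derivative ?g' s) (at s)" for s
      unfolding w_def
      by (rule derivative_eq_intros d1 dp1 refl)+ simp
    have B: "(?g' has_real_derivative exp (- C * t0) * fxx k \<theta>0 t0 h0 - \<epsilon> * exp (c * t0) * (2 * p (a k))) (at 0)"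
      using d2[of k \<theta>0 t0 h0 0]
      by (intro DERIV_diff DERIV_cmult dp2) auto
    have "?g s \<le> ?g 0" for s using global by simp
    from derivatives_at_global_max[OF this A B]
    show "exp (- C * t0) * fx k \<theta>0 t0 h0 = \<epsilon> * exp (c * t0) * p1 k h0"
      and "exp (- C * t0) * fxx k \<theta>0 t0 h0 \<le> \<epsilon> * exp (c * t0) * (2 * p (a k))" by auto
  qed
  have \<theta>max: "f \<theta>' t0 h0 \<le> f \<theta>0 t0 h0" if "\<theta>' \<in> \<Theta>" for \<theta>'
    using mx[OF that m(2,3)] unfolding w_def by simp
  have time: "exp (- C * t0) * (ft \<theta>0 t0 h0 - C * f \<theta>0 t0 h0) - \<epsilon> * c * exp (c * t0) * (1 + p h0) \<ge> 0"
  proof (rule derivative_at_left_max[OF _ t0])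
    show "((\<lambda>t. w \<theta>0 t h0) has_real_derivative
       exp (- C * t0) * (ft \<theta>0 t0 h0 - C * f \<theta>0 t0 h0) - \<epsilon> * c * exp (c * t0) * (1 + p h0)) (at t0)"
      unfolding w_def using t0 m(2)
      by (auto intro!: derivative_eq_intros dt m(1) simp: algebra_simps)
    show "\<And>s. 0 \<le> s \<Longrightarrow> s \<le> t0 \<Longrightarrow> w \<theta>0 s h0 \<le> w \<theta>0 t0 h0"
      using mx[OF m(1) _ m(3)] m(2) by auto
  qed
  have p1_le: "\<bar>p1 k h0\<bar> \<le> p (a k) + p h0" for k
  proof -
    have "\<bar>p1 k h0\<bar> \<le> (\<Sum>i\<in>I. \<bar>2 * (h0 i * a k i)\<bar>)"
      unfolding p1_def sum_distrib_left by (rule sum_abs)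
    also have "\<dots> \<le> (\<Sum>i\<in>I. (a k i)\<^sup>2 + (h0 i)\<^sup>2)"
    proof (rule sum_mono)
      fix i
      have "0 \<le> (\<bar>h0 i\<bar> - \<bar>a k i\<bar>)\<^sup>2" by simp
      thus "\<bar>2 * (h0 i * a k i)\<bar> \<le> (a k i)\<^sup>2 + (h0 i)\<^sup>2"
        by (simp add: power2_diff abs_mult)
    qed
    finally show ?thesis by (simp add: p_def sum.distrib)
  qed
  have "exp (- C * t0) * (ft \<theta>0 t0 h0 - C * f \<theta>0 t0 h0)
      \<le> exp (- C * t0) * (\<Sum>k\<in>K. 1/2 * fxx k \<theta>0 t0 h0 + b k t0 h0 * fx k \<theta>0 t0 h0)"
    using ineq[OF m(1) t0 _ f0 \<theta>max] m(2) by (intro mult_left_mono) auto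
  also have "\<dots> = (\<Sum>k\<in>K. 1/2 * (exp (- C * t0) * fxx k \<theta>0 t0 h0) + b k t0 h0 * (exp (- C * t0) * fx k \<theta>0 t0 h0))"
    by (simp add: sum_distrib_left algebra_simps)
  also have "\<dots> \<le> (\<Sum>k\<in>K. \<epsilon> * exp (c * t0) * ((p (a k) + \<bar>B'\<bar> * (1 + p (a k))) * (1 + p h0)))"
  proof (rule sum_mono)
    fix k assume k: "k \<in> K"
    have "b k t0 h0 * p1 k h0 \<le> \<bar>b k t0 h0\<bar> * \<bar>p1 k h0\<bar>"
      by (metis abs_ge_self abs_mult)
    also have "\<dots> \<le> \<bar>B'\<bar> * (p (a k) + p h0)"
      using drift[OF k, of t0 h0] p1_le[of k] by (intro mult_mono) auto
    also have "\<dots> \<le> \<bar>B'\<bar> * ((1 + p (a k)) * (1 + p h0))"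
      using p_nonneg[of h0] p_nonneg[of "a k"] by (intro mult_left_mono) (auto simp: algebra_simps)
    finally have "b k t0 h0 * p1 k h0 \<le> \<bar>B'\<bar> * (1 + p (a k)) * (1 + p h0)" by (simp add: mult_ac)
    moreover have "p (a k) \<le> p (a k) * (1 + p h0)"
      using p_nonneg[of h0] p_nonneg[of "a k"] by (simp add: algebra_simps)
    ultimately have "p (a k) + b k t0 h0 * p1 k h0 \<le> (p (a k) + \<bar>B'\<bar> * (1 + p (a k))) * (1 + p h0)"
      by (simp add: distrib_right)
    hence "\<epsilon> * exp (c * t0) * (p (a k) + b k t0 h0 * p1 k h0)
        \<le> \<epsilon> * exp (c * t0) * ((p (a k) + \<bar>B'\<bar> * (1 + p (a k))) * (1 + p h0))"
      using \<epsilon> by (intro mult_left_mono) auto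
    thus "1/2 * (exp (- C * t0) * fxx k \<theta>0 t0 h0) + b k t0 h0 * (exp (- C * t0) * fx k \<theta>0 t0 h0)
        \<le> \<epsilon> * exp (c * t0) * ((p (a k) + \<bar>B'\<bar> * (1 + p (a k))) * (1 + p h0))"
      using max2[of k] unfolding max1 by (simp add: algebra_simps)
  qed
  also have "\<dots> = \<epsilon> * exp (c * t0) * ((c - 1) * (1 + p h0))"
    unfolding c_def by (simp add: sum_distrib_left sum_distrib_right)
  also have "\<dots> < \<epsilon> * c * exp (c * t0) * (1 + p h0)"
    using exp_pos' by (simp add: algebra_simps)
  finally show False using time by simp
qed

section \<open>Factorisation of positive semidefinite matrices\<close>

text \<open>Cholesky's factorisation, by induction on the index set.\<close>

lemma psd_factorization:
  assumes "finite I" "sym_psd_on I A"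
  shows "\<exists>a. (\<forall>i\<in>I. \<forall>j\<in>I. A i j = (\<Sum>k\<in>I. a k i * a k j)) \<and> (\<forall>k i. i \<notin> I \<longrightarrow> a k i = (0::real))"
  using assms
proof (induction I arbitrary: A rule: finite_induct)
  case empty
  show ?case by (intro exI[of _ "\<lambda>_ _. 0"]) auto
next
  case (insert p J)
  note fin = insert.hyps(1) and pJ = insert.hyps(2)
  have sym: "A i j = A j i" if "i \<in> insert p J" "j \<in> insert p J" for i j
    using insert.prems that unfolding sym_psd_on_def by blast
  have psd: "0 \<le> quad_form (insert p J) A x" for x
    using insert.prems unfolding sym_psd_on_def by blast
  have qf: "quad_form (insert p J) A x
      = A p p * (x p)\<^sup>2 + 2 * x p * (\<Sum>j\<in>J. A p j * x j) + quad_form J A x" for x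
  proof -
    have "(\<Sum>i\<in>J. x i * A i p * x p) = x p * (\<Sum>j\<in>J. A p j * x j)"
      unfolding sum_distrib_left by (rule sum.cong) (auto simp: sym)
    moreover have "(\<Sum>j\<in>J. x p * A p j * x j) = x p * (\<Sum>j\<in>J. A p j * x j)"
      by (simp add: sum_distrib_left mult_ac)
    ultimately show ?thesis
      using fin pJ by (simp add: quad_form_def sum.distrib power2_eq_square)
  qed
  have App: "A p p \<ge> 0"
  proof -
    have "quad_form (insert p J) A (\<lambda>i. if i = p then 1 else 0) = A p p"
    proof -
      have "(\<Sum>j\<in>J. A p j * (if j = p then 1 else 0)) = 0"
        "quad_form J A (\<lambda>i. if i = p then 1 else 0) = 0"
        unfolding quad_form_def using pJ by (auto intro!: sum.neutral)
      thus ?thesis unfolding qf by simp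
    qed
    thus ?thesis using psd by metis
  qed
  \<comment> \<open>Complete the square in coordinate \<open>p\<close>; the Schur complement stays positive semidefinite.\<close>
  \<comment> \<open>If \<open>A p p = 0\<close>, then \<open>v = 0\<close> as division by zero yields zero, and row \<open>p\<close> of \<open>A\<close> vanishes as well.\<close>
  define v where "v i = A p i / sqrt (A p p)" for i
  define A' where "A' i j = A i j - v i * v j" for i j
  have zero: "A p j = 0" if "A p p = 0" "j \<in> J" for j
  proof (rule ccontr)
    assume nz: "A p j \<noteq> 0"
    define s where "s = - (A j j + 1) / (2 * A p j)"
    define x where "x i = (if i = p then s else if i = j then 1 else 0)" for i
    have e: "(\<Sum>i\<in>J. A p i * x i) = A p j"
    proof -
      have "(\<Sum>i\<in>J. A p i * x i) = (\<Sum>i\<in>J. if i = j then A p i else 0)"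
        by (rule sum.cong) (use pJ that in \<open>auto simp: x_def\<close>)
      thus ?thesis using fin that by simp
    qed
    have "quad_form J A x = (\<Sum>i\<in>J. \<Sum>l\<in>J. if i = j \<and> l = j then A j j else 0)"
      unfolding quad_form_def by (intro sum.cong) (use pJ that in \<open>auto simp: x_def\<close>)
    also have "\<dots> = (\<Sum>i\<in>J. if i = j then A j j else 0)"
      using fin that by (intro sum.cong) auto
    also have "\<dots> = A j j" using fin that by simp
    finally have "quad_form (insert p J) A x = 2 * s * A p j + A j j"
      unfolding qf e using that(1) by (simp add: x_def)
    also have "\<dots> = - 1" using nz by (simp add: s_def field_simps)
    finally show False using psd[of x] by simp
  qed
  have vv: "v p * v i = A p i" if "i \<in> insert p J" for i
    using App zero that by (cases "A p p = 0") (auto simp: v_def)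
  have "sym_psd_on J A'"
    unfolding sym_psd_on_def
  proof (intro conjI ballI allI)
    fix i j assume "i \<in> J" "j \<in> J"
    thus "A' i j = A' j i" by (simp add: A'_def sym mult.commute)
  next
    fix x
    define T where "T = (\<Sum>j\<in>J. A p j * x j)"
    define y where "y = x(p := - T / A p p)"
    have yJ: "(\<Sum>j\<in>J. A p j * y j) = T" "quad_form J A y = quad_form J A x"
      unfolding T_def quad_form_def y_def using pJ by (auto intro!: sum.cong)
    have "quad_form J A' x = quad_form J A x - (\<Sum>i\<in>J. v i * x i)\<^sup>2"
      unfolding quad_form_def A'_def power2_eq_square sum_product
      by (simp add: algebra_simps sum_subtractf)
    also have "(\<Sum>i\<in>J. v i * x i) = T / sqrt (A p p)"
      unfolding T_def v_def sum_divide_distrib by (rule sum.cong) auto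
    also have "quad_form J A x - (T / sqrt (A p p))\<^sup>2 = quad_form (insert p J) A y"
      unfolding qf yJ using App by (cases "A p p = 0") (auto simp: y_def power2_eq_square field_simps)
    finally show "0 \<le> quad_form J A' x" using psd[of y] by simp
  qed
  from insert.IH[OF this] obtain a where
    a: "\<And>i j. i \<in> J \<Longrightarrow> j \<in> J \<Longrightarrow> A' i j = (\<Sum>k\<in>J. a k i * a k j)" and
    a0: "\<And>k i. i \<notin> J \<Longrightarrow> a k i = 0" by blast
  define a' where "a' k i = (if k = p then if i \<in> insert p J then v i else 0 else a k i)" for k i
  have s: "(\<Sum>k\<in>insert p J. a' k i * a' k j) = v i * v j + (\<Sum>k\<in>J. a k i * a k j)"
    if "i \<in> insert p J" "j \<in> insert p J" for i j
  proof -
    have "(\<Sum>k\<in>J. a' k i * a' k j) = (\<Sum>k\<in>J. a k i * a k j)"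
      by (rule sum.cong) (use pJ in \<open>auto simp: a'_def\<close>)
    thus ?thesis using fin pJ that by (simp add: a'_def)
  qed
  show ?case
  proof (intro exI[of _ a'] conjI ballI allI impI)
    fix i j assume ij: "i \<in> insert p J" "j \<in> insert p J"
    show "A i j = (\<Sum>k\<in>insert p J. a' k i * a' k j)"
    proof (cases "i = p \<or> j = p")
      case True
      hence "(\<Sum>k\<in>J. a k i * a k j) = 0" using pJ a0 by (auto intro!: sum.neutral)
      thus ?thesis using s[OF ij] vv ij True sym[of i j] by (auto simp: mult.commute)
    next
      case False
      thus ?thesis using s[OF ij] a[of i j] ij by (simp add: A'_def)
    qed
  next
    fix k i assume "i \<notin> insert p J" thus "a' k i = 0" using a0 by (auto simp: a'_def)
  qed
qed

section \<open>Test vectors, spin flips and the product measure\<close>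

lemma L2_set_le_by_duality:
  assumes fin: "finite I" and N: "0 \<le> N"
    and dual: "\<And>w. L2_set w I \<le> 1 \<Longrightarrow> (\<And>i. i \<notin> I \<Longrightarrow> w i = 0) \<Longrightarrow> (\<Sum>i\<in>I. p i * w i) \<le> N"
  shows "L2_set p I \<le> N"
proof (cases "L2_set p I = 0")
  case False
  define l where "l = L2_set p I"
  have l: "l > 0" using False L2_set_nonneg[of p I] unfolding l_def by linarith
  define w where "w i = (if i \<in> I then p i / l else 0)" for i
  have "L2_set w I = L2_set (\<lambda>i. (1/l) * p i) I"
    by (rule L2_set_cong) (auto simp: w_def)
  also have "\<dots> = (1/l) * l" unfolding l_def by (rule L2_set_right_distrib[symmetric]) simp
  finally have "L2_set w I \<le> 1" using l by simp
  hence "(\<Sum>i\<in>I. p i * w i) \<le> N" by (rule dual) (simp add: w_def)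
  also have "(\<Sum>i\<in>I. p i * w i) = (\<Sum>i\<in>I. (p i)\<^sup>2) / l"
    unfolding sum_divide_distrib by (rule sum.cong) (auto simp: w_def power2_eq_square)
  also have "(\<Sum>i\<in>I. (p i)\<^sup>2) = l\<^sup>2"
    unfolding l_def L2_set_def by (simp add: sum_nonneg)
  finally show ?thesis using l unfolding l_def by (simp add: power2_eq_square)
qed (use N in simp)

lemma L2_set_abs_le: "finite I \<Longrightarrow> i \<in> I \<Longrightarrow> \<bar>u i\<bar> \<le> L2_set u I"
  using member_le_L2_set[of I i "\<lambda>i. \<bar>u i\<bar>"] by (simp add: L2_set_def)

lemma compact_L2_ball:
  assumes "finite I"
  shows "compact {u :: 'i \<Rightarrow> real. L2_set u I \<le> 1 \<and> (\<forall>i. i \<notin> I \<longrightarrow> u i = 0)}"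
proof -
  let ?box = "{u. \<forall>i. (if i \<in> I then - 1 else 0) \<le> u i \<and> u i \<le> (if i \<in> I then 1 else (0::real))}"
  have "compact ?box" by (rule compact_box)
  moreover have "closed {u :: 'i \<Rightarrow> real. L2_set u I \<le> 1}"
    unfolding L2_set_def
    by (intro closed_Collect_le continuous_intros) (auto intro: continuous_on_product_coordinates)
  ultimately have "compact (?box \<inter> {u. L2_set u I \<le> 1})" by (rule compact_Int_closed)
  moreover have "?box \<inter> {u. L2_set u I \<le> 1} = {u. L2_set u I \<le> 1 \<and> (\<forall>i. i \<notin> I \<longrightarrow> u i = 0)}"
  proof (intro equalityI subsetI)
    fix u assume u: "u \<in> {u. L2_set u I \<le> 1 \<and> (\<forall>i. i \<notin> I \<longrightarrow> u i = 0)}"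
    have "\<bar>u i\<bar> \<le> 1" if "i \<in> I" for i using L2_set_abs_le[OF assms that, of u] u by simp
    thus "u \<in> ?box \<inter> {u. L2_set u I \<le> 1}" using u by (auto simp: abs_le_iff minus_le_iff)
  next
    fix u assume "u \<in> ?box \<inter> {u. L2_set u I \<le> 1}"
    thus "u \<in> {u. L2_set u I \<le> 1 \<and> (\<forall>i. i \<notin> I \<longrightarrow> u i = 0)}"
      by (auto intro: antisym split: if_splits dest: spec)
  qed
  ultimately show ?thesis by simp
qed

lemma dot_abs_le:
  assumes "x \<in> spin_configs I"
  shows "\<bar>dot I u x\<bar> \<le> (\<Sum>i\<in>I. \<bar>u i\<bar>)"
  unfolding dot_def by (rule order_trans[OF sum_abs], rule sum_mono)
    (use spin_abs[OF assms] in \<open>simp add: abs_mult\<close>)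

context ising_flow begin

definition coup :: "'i \<Rightarrow> 'i \<Rightarrow> real" where
  "coup i j = (\<Sum>k\<in>I. a k i * a k j)"

definition local_field :: "real \<Rightarrow> ('i \<Rightarrow> real) \<Rightarrow> 'i \<Rightarrow> ('i \<Rightarrow> real) \<Rightarrow> real" where
  "local_field t h i x = h i + t * (\<Sum>j\<in>I - {i}. coup i j * x j)"

text \<open>Flipping one spin changes the weight by a factor governed by the local field, whose sum omits the
site \<open>i\<close> itself because \<open>x\<^sub>i\<^sup>2 = 1\<close>.\<close>

lemma weight_flip:
  assumes i: "i \<in> I"
  shows "weight t h (x(i := - x i)) = weight t h x * exp (- 2 * x i * local_field t h i x)"
proof -
  define r where "r k = (\<Sum>j\<in>I - {i}. a k j * x j)" for k
  have rest: "(\<Sum>j\<in>I - {i}. u j * (x(i := - x i)) j) = (\<Sum>j\<in>I - {i}. u j * x j)" for u :: "'i \<Rightarrow> real"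
    by (rule sum.cong) auto
  have d: "dot I u x = u i * x i + (\<Sum>j\<in>I - {i}. u j * x j)"
    "dot I u (x(i := - x i)) = - (u i * x i) + (\<Sum>j\<in>I - {i}. u j * x j)" for u
    unfolding dot_def sum.remove[OF finite_I i] rest by simp_all
  have "(\<Sum>k\<in>I. (dir k (x(i := - x i)))\<^sup>2) = (\<Sum>k\<in>I. (dir k x)\<^sup>2 - 4 * x i * (a k i * r k))"
    unfolding d r_def[symmetric] by (rule sum.cong) (auto simp: power2_eq_square algebra_simps)
  also have "\<dots> = (\<Sum>k\<in>I. (dir k x)\<^sup>2) - 4 * x i * (\<Sum>k\<in>I. a k i * r k)"
    by (simp add: sum_subtractf sum_distrib_left)
  also have "(\<Sum>k\<in>I. a k i * r k) = (\<Sum>j\<in>I - {i}. coup i j * x j)"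
    unfolding r_def coup_def sum_distrib_left sum_distrib_right
    by (subst sum.swap) (simp add: mult_ac)
  finally have q: "(\<Sum>k\<in>I. (dir k (x(i := - x i)))\<^sup>2)
      = (\<Sum>k\<in>I. (dir k x)\<^sup>2) - 4 * x i * (\<Sum>j\<in>I - {i}. coup i j * x j)" .
  have h': "dot I h (x(i := - x i)) = dot I h x - 2 * x i * h i"
    unfolding d by simp
  show ?thesis
    unfolding weight_def q h' exp_add[symmetric] local_field_def by (simp add: algebra_simps)
qed

text \<open>Given the other spins, the conditional mean of \<open>x i\<close> is the hyperbolic tangent of its local field.
In the sum, the terms of \<open>x\<close> and of its flip at \<open>i\<close> cancel.\<close>

lemma mean_flip_zero:
  assumes i: "i \<in> I" and \<phi>: "\<And>x y. \<phi> (x(i := y)) = \<phi> x"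
  shows "mean t h (\<lambda>x. (x i - tanh (local_field t h i x)) * \<phi> x) = 0"
proof -
  let ?C = "spin_configs I" and ?F = "local_field t h i"
  let ?fl = "\<lambda>x. x(i := - x i)"
  let ?G = "\<lambda>x. (x i - tanh (?F x)) * \<phi> x * weight t h x"
  have F: "?F (x(i := y)) = ?F x" for x y
    unfolding local_field_def by (auto intro!: sum.cong)
  have flC: "?fl x \<in> ?C" if "x \<in> ?C" for x
    using that i by (auto simp: spin_configs_def PiE_iff extensional_def)
  have opp: "?G x + ?G (?fl x) = 0" if x: "x \<in> ?C" for x
  proof -
    define f where "f = ?F x"
    have xi: "x i = 1 \<or> x i = -1" using spin_abs[OF x i] by linarith
    have T: "tanh f = (1 - exp (-2 * f)) / (1 + exp (- 2 * f))" by (rule tanh_real_altdef)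
    have "(x i - tanh f) + (- x i - tanh f) * exp (- 2 * x i * f) = 0"
      using xi
    proof
      assume 1: "x i = 1"
      have "(1 - tanh f) + (- 1 - tanh f) * exp (- 2 * f) = 0"
      proof -
        define w where "w = exp (-2 * f)"
        have w: "w > 0" unfolding w_def by simp
        show ?thesis unfolding T w_def[symmetric] using w by (auto simp: divide_simps algebra_simps)
      qed
      thus ?thesis using 1 by simp
    next
      assume 1: "x i = -1"
      have "(- 1 - tanh f) + (1 - tanh f) * exp (2 * f) = 0"
      proof -
        define w where "w = exp (-2 * f)"
        have w: "w > 0" "exp (2 * f) = 1 / w" unfolding w_def by (auto simp: exp_minus field_simps)
        show ?thesis unfolding T w_def[symmetric] w(2) using w(1) by (auto simp: divide_simps algebra_simps)
      qed
      thus ?thesis using 1 by simp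
    qed
    hence "((x i - tanh f) + (- x i - tanh f) * exp (- 2 * x i * f)) * (\<phi> x * weight t h x) = 0" by simp
    thus ?thesis
      unfolding weight_flip[OF i] F \<phi> f_def by (simp add: algebra_simps)
  qed
  have "(\<Sum>x\<in>?C. ?G x) = (\<Sum>x\<in>?C. ?G (?fl x))"
    by (rule sum.reindex_bij_witness[of _ ?fl ?fl]) (auto simp: flC)
  moreover have "(\<Sum>x\<in>?C. ?G x) + (\<Sum>x\<in>?C. ?G (?fl x)) = (\<Sum>x\<in>?C. ?G x + ?G (?fl x))"
    by (rule sum.distrib[symmetric])
  moreover have "(\<Sum>x\<in>?C. ?G x + ?G (?fl x)) = 0"
    by (rule sum.neutral) (use opp in blast)
  ultimately have "(\<Sum>x\<in>?C. ?G x) = 0" by linarith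
  thus ?thesis by (simp add: mean_def)
qed

lemma cum2_sym: "cum2 t h p q = cum2 t h q p"
  by (simp add: cum2_def mult.commute)

lemma cum2_dot_right: "cum2 t h p (dot I v) = (\<Sum>j\<in>I. v j * cum2 t h p (\<lambda>x. x j))"
proof -
  have "mean t h (\<lambda>x. p x * dot I v x) = (\<Sum>j\<in>I. v j * mean t h (\<lambda>x. p x * x j))"
    unfolding dot_def sum_distrib_left mean_sum
    by (rule sum.cong[OF refl]) (simp add: mean_cmult[symmetric] mult_ac)
  moreover have "mean t h (dot I v) = (\<Sum>j\<in>I. v j * mean t h (\<lambda>x. x j))"
    unfolding dot_def mean_sum mean_cmult ..
  ultimately show ?thesis
    by (simp add: cum2_def sum_distrib_left sum_subtractf algebra_simps)
qed

lemma cum3_perm: "cum3 t h p q r = cum3 t h q p r" "cum3 t h p q r = cum3 t h p r q"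
  by (simp_all add: cum3_def mult_ac)

lemma cum3_dot_right: "cum3 t h p q (dot I v) = (\<Sum>j\<in>I. v j * cum3 t h p q (\<lambda>x. x j))"
proof -
  have 1: "mean t h (\<lambda>x. p x * dot I v x) = (\<Sum>j\<in>I. v j * mean t h (\<lambda>x. p x * x j))" for p
    unfolding dot_def sum_distrib_left mean_sum
    by (rule sum.cong[OF refl]) (simp add: mean_cmult[symmetric] mult_ac)
  have 2: "mean t h (dot I v) = (\<Sum>j\<in>I. v j * mean t h (\<lambda>x. x j))"
    unfolding dot_def mean_sum mean_cmult ..
  show ?thesis
    unfolding cum3_def 1 2
    by (simp add: sum_distrib_left sum_distrib_right sum_subtractf sum.distrib algebra_simps)
qed

lemma cum3_central:
  "cum3 t h p q r = mean t h (\<lambda>x. (p x - mean t h p) * ((q x - mean t h q) * (r x - mean t h r)))"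
proof -
  have "mean t h (\<lambda>x. (p x - mean t h p) * ((q x - mean t h q) * (r x - mean t h r)))
    = mean t h (\<lambda>x. p x * q x * r x - mean t h r * (p x * q x) - mean t h q * (p x * r x) - mean t h p * (q x * r x)
       + mean t h q * mean t h r * p x + mean t h p * mean t h r * q x + mean t h p * mean t h q * r x
       - mean t h p * mean t h q * mean t h r)"
    by (rule mean_cong) (simp add: algebra_simps)
  also have "\<dots> = cum3 t h p q r"
    unfolding mean_add mean_diff mean_cmult mean_const cum3_def by (simp add: algebra_simps)
  finally show ?thesis ..
qed

lemma mean_spin_0: "i \<in> I \<Longrightarrow> mean 0 h (\<lambda>x. x i) = tanh (h i)"
  using mean_flip_zero[of i "\<lambda>_. 1" 0 h] by (simp add: local_field_def mean_diff)

text \<open>At time \<open>0\<close> the local field is the constant \<open>h i\<close>, so the flip identity expresses the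
independence of the spins.\<close>

lemma cum2_spin_0:
  assumes "i \<in> I" "j \<in> I"
  shows "cum2 0 h (\<lambda>x. x i) (\<lambda>x. x j) = (if i = j then 1 - (tanh (h i))\<^sup>2 else 0)"
proof (cases "i = j")
  case True
  have "mean 0 h (\<lambda>x. x i * x i) = mean 0 h (\<lambda>x. 1)"
  proof (rule mean_cong)
    fix x assume "x \<in> spin_configs I"
    hence "x i = 1 \<or> x i = -1" using spin_abs[of x I i] assms(1) by linarith
    thus "x i * x i = 1" by auto
  qed
  thus ?thesis using True assms by (simp add: cum2_def mean_spin_0 power2_eq_square)
next
  case False
  have "mean 0 h (\<lambda>x. (x i - tanh (local_field 0 h i x)) * x j) = 0"
    by (rule mean_flip_zero) (use assms False in auto)
  hence "mean 0 h (\<lambda>x. x i * x j) = tanh (h i) * mean 0 h (\<lambda>x. x j)"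
    by (simp add: local_field_def left_diff_distrib mean_diff mean_cmult)
  thus ?thesis using False assms by (simp add: cum2_def mean_spin_0)
qed

lemma cum3_spin_0:
  assumes "i \<in> I" "j \<in> I" "l \<in> I" "i \<noteq> j \<or> i \<noteq> l"
  shows "cum3 0 h (\<lambda>x. x i) (\<lambda>x. x j) (\<lambda>x. x l) = 0"
proof -
  have *: "cum3 0 h (\<lambda>x. x i) (\<lambda>x. x j) (\<lambda>x. x l) = 0" if "i \<in> I" "j \<in> I" "l \<in> I" "i \<noteq> j" "i \<noteq> l" for i j l
  proof -
    have "mean 0 h (\<lambda>x. (x i - tanh (local_field 0 h i x)) * ((x j - tanh (h j)) * (x l - tanh (h l)))) = 0"
      by (rule mean_flip_zero) (use that in auto)
    thus ?thesis using that unfolding cum3_central by (simp add: mean_spin_0 local_field_def)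
  qed
  consider "i \<noteq> j" "i \<noteq> l" | "i = j" "l \<noteq> i" | "i = l" "j \<noteq> i" using assms(4) by blast
  thus ?thesis
  proof cases
    case 1 thus ?thesis using * assms by blast
  next
    case 2
    have "cum3 0 h (\<lambda>x. x i) (\<lambda>x. x j) (\<lambda>x. x l) = cum3 0 h (\<lambda>x. x l) (\<lambda>x. x i) (\<lambda>x. x j)"
      by (subst cum3_perm(2), subst cum3_perm(1)) (rule refl)
    thus ?thesis using *[of l i j] assms 2 by auto
  next
    case 3
    have "cum3 0 h (\<lambda>x. x i) (\<lambda>x. x j) (\<lambda>x. x l) = cum3 0 h (\<lambda>x. x j) (\<lambda>x. x i) (\<lambda>x. x l)"
      by (rule cum3_perm(1))
    thus ?thesis using *[of j i l] assms 3 by auto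
  qed
qed

lemma cum3_spin_0_bound:
  assumes "i \<in> I"
  shows "\<bar>cum3 0 h (\<lambda>x. x i) (\<lambda>x. x i) (\<lambda>x. x i)\<bar> \<le> 8"
proof -
  have "\<bar>mean 0 h (\<lambda>x. (x i - mean 0 h (\<lambda>x. x i)) * ((x i - mean 0 h (\<lambda>x. x i)) * (x i - mean 0 h (\<lambda>x. x i))))\<bar> \<le> 8"
  proof (rule mean_abs_le)
    fix x assume "x \<in> spin_configs I"
    hence "\<bar>x i\<bar> = 1" by (rule spin_abs[OF _ assms])
    moreover have "\<bar>mean 0 h (\<lambda>x. x i)\<bar> \<le> 1" by (rule mean_abs_le) (simp add: spin_abs[OF _ assms])
    ultimately have "\<bar>x i - mean 0 h (\<lambda>x. x i)\<bar> \<le> 2" by linarith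
    hence "\<bar>x i - mean 0 h (\<lambda>x. x i)\<bar> ^ 3 \<le> 2 ^ 3" by (intro power_mono) auto
    thus "\<bar>(x i - mean 0 h (\<lambda>x. x i)) * ((x i - mean 0 h (\<lambda>x. x i)) * (x i - mean 0 h (\<lambda>x. x i)))\<bar> \<le> 8"
      by (simp add: abs_mult power3_eq_cube mult.assoc)
  qed
  thus ?thesis unfolding cum3_central .
qed

lemma cum2_dot_0: "cum2 0 h (dot I u) (dot I v) = (\<Sum>i\<in>I. u i * v i * (1 - (tanh (h i))\<^sup>2))"
proof -
  have "cum2 0 h (dot I u) (\<lambda>x. x j) = u j * (1 - (tanh (h j))\<^sup>2)" if "j \<in> I" for j
    unfolding cum2_sym[of 0 h "dot I u"] cum2_dot_right
    using that by (simp add: cum2_spin_0 if_distrib[of "(*) _"] cong: if_cong)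
  thus ?thesis unfolding cum2_dot_right by (auto intro!: sum.cong)
qed

lemma cum3_dot_0:
  "cum3 0 h (dot I u) (dot I v) (dot I w)
    = (\<Sum>i\<in>I. u i * v i * w i * cum3 0 h (\<lambda>x. x i) (\<lambda>x. x i) (\<lambda>x. x i))"
proof -
  let ?k = "\<lambda>i. cum3 0 h (\<lambda>x. x i) (\<lambda>x. x i) (\<lambda>x. x i)"
  have z: "cum3 0 h (\<lambda>x. x j) (\<lambda>x. x l) (\<lambda>x. x i) = (if i = j \<and> i = l then ?k i else 0)"
    if "i \<in> I" "j \<in> I" "l \<in> I" for i j l using cum3_spin_0[of j l i] that by auto
  have 1: "cum3 0 h (\<lambda>x. x j) (\<lambda>x. x l) (dot I u) = (if j = l then u j * ?k j else 0)" if "j \<in> I" "l \<in> I" for u j l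
  proof -
    have "cum3 0 h (\<lambda>x. x j) (\<lambda>x. x l) (dot I u) = (\<Sum>i\<in>I. if i = j then (if j = l then u j * ?k j else 0) else 0)"
      unfolding cum3_dot_right
    proof (rule sum.cong[OF refl])
      fix i assume "i \<in> I"
      show "u i * cum3 0 h (\<lambda>x. x j) (\<lambda>x. x l) (\<lambda>x. x i) = (if i = j then (if j = l then u j * ?k j else 0) else 0)"
        unfolding z[OF \<open>i \<in> I\<close> that] by (cases "i = j"; cases "i = l") auto
    qed
    thus ?thesis using that by simp
  qed
  have 2: "cum3 0 h (\<lambda>x. x j) (dot I u) (dot I v) = u j * v j * ?k j" if "j \<in> I" for u v j
  proof -
    have "cum3 0 h (\<lambda>x. x j) (dot I u) (dot I v) = cum3 0 h (\<lambda>x. x j) (dot I v) (dot I u)"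
      by (rule cum3_perm(2))
    also have "\<dots> = (\<Sum>i\<in>I. u i * cum3 0 h (\<lambda>x. x j) (\<lambda>x. x i) (dot I v))"
      unfolding cum3_dot_right[of _ _ _ _ u] by (rule sum.cong[OF refl]) (simp add: cum3_perm(2)[of _ _ _ "dot I v"])
    also have "\<dots> = (\<Sum>i\<in>I. if i = j then u j * v j * ?k j else 0)"
      by (rule sum.cong[OF refl]) (use 1 that in auto)
    finally show ?thesis using that by simp
  qed
  have "cum3 0 h (dot I u) (dot I v) (dot I w) = cum3 0 h (dot I v) (dot I w) (dot I u)"
    by (subst cum3_perm(1), subst cum3_perm(2)) (rule refl)
  also have "\<dots> = (\<Sum>i\<in>I. u i * cum3 0 h (\<lambda>x. x i) (dot I v) (dot I w))"
    unfolding cum3_dot_right[of _ _ _ _ u] by (rule sum.cong[OF refl], subst cum3_perm(2), subst cum3_perm(1)) (rule refl)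
  also have "\<dots> = (\<Sum>i\<in>I. u i * v i * w i * ?k i)"
    by (rule sum.cong[OF refl]) (use 2 in \<open>simp add: mult.assoc\<close>)
  finally show ?thesis .
qed

lemma continuous_on_mean:
  assumes "continuous_on S \<tau>" "\<And>i. continuous_on S (\<lambda>z. \<eta> z i)"
    "\<And>x. continuous_on S (\<lambda>z. p z x)"
  shows "continuous_on S (\<lambda>z. mean (\<tau> z) (\<eta> z) (p z))"
proof -
  have "part t h \<noteq> 0" for t h using part_pos[of t h] by simp
  moreover have "continuous_on S (\<lambda>z. weight (\<tau> z) (\<eta> z) x)" for x
    unfolding weight_def dot_def by (intro continuous_intros assms) auto
  ultimately show ?thesis
    unfolding mean_def by (intro continuous_intros assms) (auto simp: part_def intro!: continuous_intros)
qed

lemma coup_bilinear: "(\<Sum>k\<in>I. (\<Sum>i\<in>I. a k i * u i) * (\<Sum>j\<in>I. a k j * v j)) = (\<Sum>i\<in>I. \<Sum>j\<in>I. u i * coup i j * v j)"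
proof -
  have "(\<Sum>k\<in>I. (\<Sum>i\<in>I. a k i * u i) * (\<Sum>j\<in>I. a k j * v j))
      = (\<Sum>k\<in>I. \<Sum>i\<in>I. \<Sum>j\<in>I. u i * (a k i * a k j) * v j)"
    unfolding sum_product by (simp add: mult_ac)
  also have "\<dots> = (\<Sum>i\<in>I. \<Sum>k\<in>I. \<Sum>j\<in>I. u i * (a k i * a k j) * v j)"
    by (rule sum.swap)
  also have "\<dots> = (\<Sum>i\<in>I. \<Sum>j\<in>I. \<Sum>k\<in>I. u i * (a k i * a k j) * v j)"
    by (intro sum.cong refl sum.swap)
  finally show ?thesis by (simp add: coup_def sum_distrib_left sum_distrib_right)
qed

end

section \<open>Covariance and third cumulant along the flow\<close>

lemma continuous_on_coordinates:
  "continuous_on S (\<lambda>z. snd (snd z) i)" "continuous_on S' (\<lambda>z. fst (fst z) i)"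
  "continuous_on T (\<lambda>z. snd (fst z) i)" "continuous_on T' (\<lambda>z. fst (snd (fst z)) i)"
  "continuous_on R (\<lambda>z. snd (snd (fst z)) i)"
  by (rule continuous_on_product_then_coordinatewise, intro continuous_intros)+

context ising_flow begin

lemma drift_abs_le:
  assumes "k \<in> I"
  shows "\<bar>mean t h (dir k)\<bar> \<le> (\<Sum>k\<in>I. \<Sum>i\<in>I. \<bar>a k i\<bar>)"
proof -
  have "(\<Sum>i\<in>I. \<bar>a k i\<bar>) \<le> (\<Sum>k\<in>I. \<Sum>i\<in>I. \<bar>a k i\<bar>)"
    using assms by (intro member_le_sum[of k I "\<lambda>k. \<Sum>i\<in>I. \<bar>a k i\<bar>"]) (auto intro!: sum_nonneg)
  moreover have "\<bar>mean t h (dir k)\<bar> \<le> (\<Sum>i\<in>I. \<bar>a k i\<bar>)"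
    by (intro mean_abs_le dot_abs_le)
  ultimately show ?thesis by linarith
qed

lemma cum2_abs_le:
  assumes "\<And>x. x \<in> spin_configs I \<Longrightarrow> \<bar>p x\<bar> \<le> b" "\<And>x. x \<in> spin_configs I \<Longrightarrow> \<bar>q x\<bar> \<le> c" "0 \<le> b"
  shows "\<bar>cum2 t h p q\<bar> \<le> 2 * b * c"
proof -
  have "\<bar>mean t h (\<lambda>x. p x * q x)\<bar> \<le> b * c"
    by (rule mean_abs_le) (use assms in \<open>simp add: abs_mult mult_mono\<close>)
  moreover have "\<bar>mean t h p * mean t h q\<bar> \<le> b * c"
    unfolding abs_mult by (intro mult_mono mean_abs_le assms) auto
  ultimately show ?thesis unfolding cum2_def by linarith
qed

lemma cum3_abs_le:
  assumes "\<And>x. x \<in> spin_configs I \<Longrightarrow> \<bar>p x\<bar> \<le> b" "\<And>x. x \<in> spin_configs I \<Longrightarrow> \<bar>q x\<bar> \<le> c"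
    "\<And>x. x \<in> spin_configs I \<Longrightarrow> \<bar>r x\<bar> \<le> d" "0 \<le> b" "0 \<le> c" "0 \<le> d"
  shows "\<bar>cum3 t h p q r\<bar> \<le> 8 * (b * c * d)"
proof -
  have *: "\<bar>p x - mean t h p\<bar> \<le> 2 * b" if "\<And>x. x \<in> spin_configs I \<Longrightarrow> \<bar>p x\<bar> \<le> b" "x \<in> spin_configs I" for p b x
    using that(1)[OF that(2)] mean_abs_le[of p b t h] that(1) by fastforce
  have "\<bar>cum3 t h p q r\<bar> \<le> (2 * b) * ((2 * c) * (2 * d))"
    unfolding cum3_central
    by (rule mean_abs_le, unfold abs_mult, intro mult_mono *) (use assms in auto)
  thus ?thesis by simp
qed

lemma continuous_on_k2:
  assumes "continuous_on S \<tau>" "\<And>i. continuous_on S (\<lambda>z. \<eta> z i)"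
    "\<And>x. continuous_on S (\<lambda>z. p z x)" "\<And>x. continuous_on S (\<lambda>z. q z x)"
  shows "continuous_on S (\<lambda>z. cum2 (\<tau> z) (\<eta> z) (p z) (q z))"
  unfolding cum2_def by (intro continuous_intros continuous_on_mean assms)

lemma continuous_on_k3:
  assumes "continuous_on S \<tau>" "\<And>i. continuous_on S (\<lambda>z. \<eta> z i)"
    "\<And>x. continuous_on S (\<lambda>z. p z x)" "\<And>x. continuous_on S (\<lambda>z. q z x)" "\<And>x. continuous_on S (\<lambda>z. r z x)"
  shows "continuous_on S (\<lambda>z. cum3 (\<tau> z) (\<eta> z) (p z) (q z) (r z))"
  unfolding cum3_def by (intro continuous_intros continuous_on_mean assms)

lemma cum2_contraction:
  "(\<Sum>k\<in>I. cum2 t h p (dir k) * cum2 t h q (dir k))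
    = (\<Sum>i\<in>I. \<Sum>j\<in>I. cum2 t h p (\<lambda>x. x i) * coup i j * cum2 t h q (\<lambda>x. x j))"
  unfolding cum2_dot_right by (rule coup_bilinear)

text \<open>The covariance matrix conjugated with the diagonal matrix of the weights \<open>g\<close> satisfies the same
evolution equation, with \<open>A\<close> conjugated as well. Its norm is at most \<open>1\<close> at time \<open>0\<close>, where it is
diagonal with entries at most \<open>1\<close>, and stays below the solution \<open>1 / (1 - \<alpha> * t)\<close> of the Riccati
equation \<open>y' = \<alpha> * y\<^sup>2\<close>. The two unit balls of test vectors serve as the parameter space.\<close>

lemma covariance_weighted_bound:
  assumes g: "\<And>i. g i > 0" and \<alpha>: "0 \<le> \<alpha>" "\<alpha> < 1"
    and conj: "\<And>p q. \<bar>\<Sum>i\<in>I. \<Sum>j\<in>I. (p i * g i) * coup i j * (q j / g j)\<bar> \<le> \<alpha> * L2_set p I * L2_set q I"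
    and t: "t \<in> {0..1}"
    and u: "L2_set u I \<le> 1" "\<And>i. i \<notin> I \<Longrightarrow> u i = 0"
    and v: "L2_set v I \<le> 1" "\<And>i. i \<notin> I \<Longrightarrow> v i = 0"
  shows "cum2 t h (dot I (\<lambda>i. g i * u i)) (dot I (\<lambda>i. v i / g i)) \<le> 1 / (1 - \<alpha> * t)"
proof -
  define U where "U = {u :: 'i \<Rightarrow> real. L2_set u I \<le> 1 \<and> (\<forall>i. i \<notin> I \<longrightarrow> u i = 0)}"
  define P where "P e = dot I (\<lambda>i. g i * fst e i)" for e :: "('i \<Rightarrow> real) \<times> ('i \<Rightarrow> real)"
  define Q where "Q e = dot I (\<lambda>i. snd e i / g i)" for e :: "('i \<Rightarrow> real) \<times> ('i \<Rightarrow> real)"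
  define y where "y t = 1 / (1 - \<alpha> * t)" for t
  define f where "f e t h = cum2 t h (P e) (Q e) - y t" for e t h
  define G where "G = (\<Sum>i\<in>I. g i)"
  define G' where "G' = (\<Sum>i\<in>I. 1 / g i)"
  define C where "C = \<alpha> * (2 * G * G' + 1 / (1 - \<alpha>))"
  have den: "1 - \<alpha> \<le> 1 - \<alpha> * t" "0 < 1 - \<alpha> * t" if "0 \<le> t" "t \<le> 1" for t
  proof -
    show 1: "1 - \<alpha> \<le> 1 - \<alpha> * t" using \<alpha>(1) that by (simp add: mult_left_le)
    show "0 < 1 - \<alpha> * t" using 1 \<alpha>(2) by linarith
  qed
  have y_pos: "0 < y t" "y t \<le> 1 / (1 - \<alpha>)" if "0 \<le> t" "t \<le> 1" for t
    using den[OF that] \<alpha> unfolding y_def by (auto intro!: divide_left_mono)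
  have GG: "G \<ge> 0" "G' \<ge> 0" unfolding G_def G'_def using g by (auto intro!: sum_nonneg simp: less_imp_le)
  have U1: "\<bar>u i\<bar> \<le> 1" if "u \<in> U" "i \<in> I" for u i
    using L2_set_abs_le[OF finite_I that(2), of u] that(1) unfolding U_def by simp
  have Pb: "\<bar>P e x\<bar> \<le> G" if "e \<in> U \<times> U" "x \<in> spin_configs I" for e x
  proof -
    have "\<bar>P e x\<bar> \<le> (\<Sum>i\<in>I. \<bar>g i * fst e i\<bar>)" unfolding P_def by (rule dot_abs_le[OF that(2)])
    also have "\<dots> \<le> G" unfolding G_def
      by (rule sum_mono) (use U1[of "fst e"] that g in \<open>auto simp: abs_mult less_imp_le mult_left_le\<close>)
    finally show ?thesis .
  qed
  have Qb: "\<bar>Q e x\<bar> \<le> G'" if "e \<in> U \<times> U" "x \<in> spin_configs I" for e x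
  proof -
    have "\<bar>Q e x\<bar> \<le> (\<Sum>i\<in>I. \<bar>snd e i / g i\<bar>)" unfolding Q_def by (rule dot_abs_le[OF that(2)])
    also have "\<dots> \<le> G'" unfolding G'_def
      by (rule sum_mono) (use U1[of "snd e"] that g in \<open>auto simp: abs_mult less_imp_le intro!: divide_right_mono\<close>)
    finally show ?thesis .
  qed
  have k2b: "\<bar>cum2 t h (P e) (Q e)\<bar> \<le> 2 * G * G'" if "e \<in> U \<times> U" for e t h
    using cum2_abs_le[of "P e" G "Q e" G'] Pb[OF that] Qb[OF that] GG by auto
  have dy: "(y has_real_derivative \<alpha> * (y t)\<^sup>2) (at t)" if "0 < t" "t \<le> 1" for t
    unfolding y_def using den[of t] that
    by (auto intro!: derivative_eq_intros simp: power2_eq_square)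
  define L where "L e t h = (\<Sum>k\<in>I. 1/2 * cum4 t h (P e) (Q e) (dir k) (dir k)
    + mean t h (dir k) * cum3 t h (P e) (Q e) (dir k))" for e t h
  define src where "src e t h = (\<Sum>k\<in>I. cum2 t h (P e) (dir k) * cum2 t h (Q e) (dir k))" for e t h
  have "f (u, v) t h \<le> 0"
  proof (rule parabolic_maximum_principle[where \<Theta> = "U \<times> U" and I = I and K = I and a = a and B = "2 * G * G'"
      and f = f and b = "\<lambda>k t h. mean t h (dir k)" and C = C
      and fx = "\<lambda>k e t h. cum3 t h (P e) (Q e) (dir k)"
      and fxx = "\<lambda>k e t h. cum4 t h (P e) (Q e) (dir k) (dir k)"
      and ft = "\<lambda>e t h. L e t h + src e t h - \<alpha> * (y t)\<^sup>2"
      and B' = "\<Sum>k\<in>I. \<Sum>i\<in>I. \<bar>a k i\<bar>"])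
    show "compact (U \<times> U)" unfolding U_def by (intro compact_Times compact_L2_ball finite_I)
    show "continuous_on ((U \<times> U) \<times> {0..1} \<times> UNIV) (\<lambda>(e, t, h). f e t h)"
      unfolding f_def case_prod_unfold P_def Q_def y_def dot_def
      by (intro continuous_intros continuous_on_k2 continuous_on_coordinates) (use g den in \<open>force simp: less_imp_neq[symmetric]\<close>)+
    show "f e t h \<le> 2 * G * G'" if "e \<in> U \<times> U" "t \<in> {0..1}" for e t h
      using k2b[OF that(1), of t h] y_pos[of t] that(2) unfolding f_def by auto
    show "f e 0 h \<le> 0" if e: "e \<in> U \<times> U" for e h
    proof -
      have "cum2 0 h (P e) (Q e) = (\<Sum>i\<in>I. fst e i * snd e i * (1 - (tanh (h i))\<^sup>2))"
        unfolding P_def Q_def cum2_dot_0 by (rule sum.cong) (use g in \<open>auto simp: less_imp_neq[symmetric]\<close>)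
      also have "\<dots> \<le> (\<Sum>i\<in>I. \<bar>fst e i\<bar> * \<bar>snd e i\<bar>)"
      proof (rule sum_mono)
        fix i
        have T: "0 \<le> 1 - (tanh (h i))\<^sup>2" "1 - (tanh (h i))\<^sup>2 \<le> 1"
          using abs_square_le_1[of "tanh (h i)"] tanh_real_lt_1[of "h i"] tanh_real_gt_neg1[of "h i"] by auto
        have "fst e i * snd e i * (1 - (tanh (h i))\<^sup>2) \<le> \<bar>fst e i * snd e i\<bar> * (1 - (tanh (h i))\<^sup>2)"
          using T by (intro mult_right_mono) auto
        also have "\<dots> \<le> \<bar>fst e i * snd e i\<bar>" using T by (simp add: mult_left_le)
        finally show "fst e i * snd e i * (1 - (tanh (h i))\<^sup>2) \<le> \<bar>fst e i\<bar> * \<bar>snd e i\<bar>" by (simp add: abs_mult)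
      qed
      also have "\<dots> \<le> L2_set (fst e) I * L2_set (snd e) I" by (rule L2_set_mult_ineq)
      also have "\<dots> \<le> 1 * 1" by (rule mult_mono) (use e in \<open>auto simp: U_def\<close>)
      finally show ?thesis by (simp add: f_def y_def)
    qed
    show "((\<lambda>t. f e t h) has_real_derivative L e t h + src e t h - \<alpha> * (y t)\<^sup>2) (at t)"
      if "0 < t" "t \<le> 1" for e t h
      unfolding f_def
      by (rule DERIV_cong[OF DERIV_diff[OF cum2_deriv_time dy[OF that]]]) (simp add: L_def src_def sum.distrib)
    show "((\<lambda>s. f e t (tilt h s (a k))) has_real_derivative
        cum3 t (tilt h s (a k)) (P e) (Q e) (dir k)) (at s)" for e t h k s
      unfolding f_def by (rule DERIV_cong[OF DERIV_diff[OF cum2_deriv_field DERIV_const]]) simp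
    show "\<bar>mean t h (dir k)\<bar> \<le> (\<Sum>k\<in>I. \<Sum>i\<in>I. \<bar>a k i\<bar>)" if "k \<in> I" for k t h
      using that by (rule drift_abs_le)
    fix e :: "('i \<Rightarrow> real) \<times> ('i \<Rightarrow> real)" and t :: real and h :: "'i \<Rightarrow> real"
    assume e: "e \<in> U \<times> U" and t: "0 < t" "t \<le> 1" and pos: "f e t h > 0"
      and max: "\<And>e'. e' \<in> U \<times> U \<Longrightarrow> f e' t h \<le> f e t h"
    define N where "N = cum2 t h (P e) (Q e)"
    have N: "N = f e t h + y t" by (simp add: N_def f_def)
    have N0: "N > 0" using N pos y_pos[of t] t by simp
    have N_max: "cum2 t h (P e') (Q e') \<le> N" if "e' \<in> U \<times> U" for e'
      using max[OF that] by (simp add: N_def f_def)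
    define p where "p i = cum2 t h (P e) (\<lambda>x. x i) / g i" for i
    define q where "q i = cum2 t h (Q e) (\<lambda>x. x i) * g i" for i
    \<comment> \<open>At a maximising pair of test vectors, both contractions of the covariance have norm at most its value.\<close>
    have p: "L2_set p I \<le> N"
    proof (rule L2_set_le_by_duality)
      fix w assume w: "L2_set w I \<le> 1" "\<And>i. i \<notin> I \<Longrightarrow> w i = 0"
      have "(\<Sum>i\<in>I. p i * w i) = cum2 t h (P (fst e, w)) (Q (fst e, w))"
        unfolding P_def Q_def cum2_dot_right p_def by (rule sum.cong) (auto simp: P_def)
      also have "\<dots> \<le> N" using e w by (intro N_max) (auto simp: U_def)
      finally show "(\<Sum>i\<in>I. p i * w i) \<le> N" .
    qed (use N0 in auto)
    have q: "L2_set q I \<le> N"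
    proof (rule L2_set_le_by_duality)
      fix w assume w: "L2_set w I \<le> 1" "\<And>i. i \<notin> I \<Longrightarrow> w i = 0"
      have "(\<Sum>i\<in>I. q i * w i) = cum2 t h (Q (w, snd e)) (P (w, snd e))"
        unfolding P_def Q_def cum2_dot_right q_def by (rule sum.cong) (auto simp: Q_def)
      also have "\<dots> = cum2 t h (P (w, snd e)) (Q (w, snd e))" by (rule cum2_sym)
      also have "\<dots> \<le> N" using e w by (intro N_max) (auto simp: U_def)
      finally show "(\<Sum>i\<in>I. q i * w i) \<le> N" .
    qed (use N0 in auto)
    have "(\<Sum>k\<in>I. cum2 t h (P e) (dir k) * cum2 t h (Q e) (dir k))
        = (\<Sum>i\<in>I. \<Sum>j\<in>I. (p i * g i) * coup i j * (q j / g j))"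
      unfolding cum2_contraction p_def q_def using g by (simp add: less_imp_neq[symmetric])
    also have "\<dots> \<le> \<alpha> * L2_set p I * L2_set q I" using conj[of p q] by linarith
    also have "\<dots> \<le> \<alpha> * N * N"
      using p q \<alpha> N0 by (intro mult_mono) auto
    finally have src: "(\<Sum>k\<in>I. cum2 t h (P e) (dir k) * cum2 t h (Q e) (dir k)) \<le> \<alpha> * N * N" .
    have "\<alpha> * N * N - \<alpha> * (y t)\<^sup>2 = \<alpha> * (N + y t) * f e t h"
      unfolding N by (simp add: power2_eq_square algebra_simps)
    also have "\<dots> \<le> C * f e t h"
    proof (rule mult_right_mono)
      have "N \<le> 2 * G * G'" unfolding N_def using k2b[OF e, of t h] by linarith
      thus "\<alpha> * (N + y t) \<le> C" unfolding C_def
        using \<alpha> y_pos[of t] t by (intro mult_left_mono) auto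
    qed (use pos in simp)
    finally show "L e t h + src e t h - \<alpha> * (y t)\<^sup>2
      \<le> (\<Sum>k\<in>I. 1/2 * cum4 t h (P e) (Q e) (dir k) (dir k)
        + mean t h (dir k) * cum3 t h (P e) (Q e) (dir k)) + C * f e t h"
      unfolding L_def[symmetric] src_def using src by simp
  qed (use t u v in \<open>auto simp: U_def a_outside intro: cum3_deriv_field\<close>)
  thus ?thesis by (simp add: f_def P_def Q_def y_def)
qed

text \<open>Each of the three sources is a third cumulant with one of its vectors \<open>v\<close> replaced by
\<open>A * Cov * v\<close>. This map is bounded by \<open>c1\<close> in the supremum norm, used for the first vector, and
by \<open>c2\<close> in the Euclidean norm, used for the other two, so the norm of the trilinear form grows
at most at rate \<open>c1 + 2 * c2\<close>. It starts from at most \<open>8\<close>, because the form is diagonal at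
time \<open>0\<close> and a centred spin is bounded by \<open>2\<close>.\<close>

lemma third_cumulant_bound:
  assumes c: "c1 > 0" "c2 > 0"
    and row: "\<And>t h v j. t \<in> {0..1} \<Longrightarrow> (\<And>i. \<bar>v i\<bar> \<le> 1) \<Longrightarrow> j \<in> I \<Longrightarrow>
       \<bar>\<Sum>i\<in>I. coup j i * cum2 t h (dot I v) (\<lambda>x. x i)\<bar> \<le> c1"
    and l2: "\<And>t h u. t \<in> {0..1} \<Longrightarrow> L2_set u I \<le> 1 \<Longrightarrow> (\<And>i. i \<notin> I \<Longrightarrow> u i = 0) \<Longrightarrow>
       L2_set (\<lambda>j. \<Sum>i\<in>I. coup j i * cum2 t h (dot I u) (\<lambda>x. x i)) I \<le> c2"
    and t: "t \<in> {0..1}"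
    and z: "\<And>i. \<bar>z i\<bar> \<le> 1" "\<And>i. i \<notin> I \<Longrightarrow> z i = 0"
    and u: "L2_set u I \<le> 1" "\<And>i. i \<notin> I \<Longrightarrow> u i = 0"
    and v: "L2_set v I \<le> 1" "\<And>i. i \<notin> I \<Longrightarrow> v i = 0"
  shows "cum3 t h (dot I z) (dot I u) (dot I v) \<le> 8 * exp ((c1 + 2 * c2) * t)"
proof -
  define U where "U = {u :: 'i \<Rightarrow> real. L2_set u I \<le> 1 \<and> (\<forall>i. i \<notin> I \<longrightarrow> u i = 0)}"
  define V where "V = {u :: 'i \<Rightarrow> real. \<forall>i. (if i \<in> I then - 1 else 0) \<le> u i \<and> u i \<le> (if i \<in> I then 1 else 0)}"
  define K where "K = c1 + 2 * c2"
  define p where "p e = dot I (fst e)" for e :: "('i \<Rightarrow> real) \<times> ('i \<Rightarrow> real) \<times> ('i \<Rightarrow> real)"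
  define q where "q e = dot I (fst (snd e))" for e :: "('i \<Rightarrow> real) \<times> ('i \<Rightarrow> real) \<times> ('i \<Rightarrow> real)"
  define r where "r e = dot I (snd (snd e))" for e :: "('i \<Rightarrow> real) \<times> ('i \<Rightarrow> real) \<times> ('i \<Rightarrow> real)"
  define y where "y t = 8 * exp (K * t)" for t
  define f where "f e t h = cum3 t h (p e) (q e) (r e) - y t" for e t h
  define n where "n = real (card I)"
  have V_alt: "V = {u. (\<forall>i. \<bar>u i\<bar> \<le> 1) \<and> (\<forall>i. i \<notin> I \<longrightarrow> u i = 0)}"
    unfolding V_def by (auto simp: abs_le_iff minus_le_iff intro: antisym split: if_splits) (metis order_antisym neg_le_0_iff_le zero_le_one order_refl)+
  have U1: "\<bar>u i\<bar> \<le> 1" if "u \<in> U" "i \<in> I" for u i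
    using L2_set_abs_le[OF finite_I that(2), of u] that(1) unfolding U_def by simp
  have db: "\<bar>dot I u x\<bar> \<le> n" if "\<And>i. i \<in> I \<Longrightarrow> \<bar>u i\<bar> \<le> 1" "x \<in> spin_configs I" for u x
    using order_trans[OF dot_abs_le[OF that(2), of u] sum_bounded_above[of I "\<lambda>i. \<bar>u i\<bar>" 1]] that(1) unfolding n_def by simp
  define src where "src e t h = (\<Sum>k\<in>I. cum2 t h (p e) (dir k) * cum3 t h (q e) (r e) (dir k)
        + cum2 t h (q e) (dir k) * cum3 t h (p e) (r e) (dir k)
        + cum2 t h (r e) (dir k) * cum3 t h (p e) (q e) (dir k))" for e t h
  define L where "L e t h = (\<Sum>k\<in>I. 1/2 * cum5 t h (p e) (q e) (r e) (dir k) (dir k)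
    + mean t h (dir k) * cum4 t h (p e) (q e) (r e) (dir k))" for e t h
  have "f (z, u, v) t h \<le> 0"
  proof (rule parabolic_maximum_principle[where \<Theta> = "V \<times> U \<times> U" and I = I and K = I and a = a and B = "8 * (n * n * n)"
      and f = f and b = "\<lambda>k t h. mean t h (dir k)" and C = K
      and fx = "\<lambda>k e t h. cum4 t h (p e) (q e) (r e) (dir k)"
      and fxx = "\<lambda>k e t h. cum5 t h (p e) (q e) (r e) (dir k) (dir k)"
      and ft = "\<lambda>e t h. L e t h + src e t h - K * y t"
      and B' = "\<Sum>k\<in>I. \<Sum>i\<in>I. \<bar>a k i\<bar>"])
    show "compact (V \<times> U \<times> U)" unfolding U_def V_def by (intro compact_Times compact_L2_ball compact_box finite_I)
    show "continuous_on ((V \<times> U \<times> U) \<times> {0..1} \<times> UNIV) (\<lambda>(e, t, h). f e t h)"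
      unfolding f_def case_prod_unfold p_def q_def r_def y_def dot_def
      by (intro continuous_intros continuous_on_k3 continuous_on_coordinates)
    show "f e t h \<le> 8 * (n * n * n)" if "e \<in> V \<times> U \<times> U" "t \<in> {0..1}" for e t h
    proof -
      have "\<bar>cum3 t h (p e) (q e) (r e)\<bar> \<le> 8 * (n * n * n)"
        unfolding p_def q_def r_def
        by (rule cum3_abs_le; (rule db)?) (use that U1 in \<open>auto simp: V_alt n_def\<close>)
      moreover have "y t > 0" by (simp add: y_def)
      ultimately show ?thesis unfolding f_def by linarith
    qed
    show "f e 0 h \<le> 0" if e: "e \<in> V \<times> U \<times> U" for e h
    proof -
      have "cum3 0 h (p e) (q e) (r e) \<le> (\<Sum>i\<in>I. 8 * (\<bar>fst (snd e) i\<bar> * \<bar>snd (snd e) i\<bar>))"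
        unfolding p_def q_def r_def cum3_dot_0
      proof (rule sum_mono)
        fix i assume i: "i \<in> I"
        let ?k = "cum3 0 h (\<lambda>x. x i) (\<lambda>x. x i) (\<lambda>x. x i)"
        have "fst e i * fst (snd e) i * snd (snd e) i * ?k \<le> \<bar>fst e i * fst (snd e) i * snd (snd e) i * ?k\<bar>" by simp
        also have "\<dots> = \<bar>fst e i\<bar> * (\<bar>fst (snd e) i\<bar> * \<bar>snd (snd e) i\<bar>) * \<bar>?k\<bar>" by (simp add: abs_mult)
        also have "\<dots> \<le> 1 * (\<bar>fst (snd e) i\<bar> * \<bar>snd (snd e) i\<bar>) * 8"
          using cum3_spin_0_bound[OF i, of h] e by (intro mult_mono) (auto simp: V_alt)
        finally show "fst e i * fst (snd e) i * snd (snd e) i * ?k \<le> 8 * (\<bar>fst (snd e) i\<bar> * \<bar>snd (snd e) i\<bar>)" by simp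
      qed
      also have "\<dots> = 8 * (\<Sum>i\<in>I. \<bar>fst (snd e) i\<bar> * \<bar>snd (snd e) i\<bar>)" by (simp add: sum_distrib_left)
      also have "\<dots> \<le> 8 * (L2_set (fst (snd e)) I * L2_set (snd (snd e)) I)"
        by (intro mult_left_mono L2_set_mult_ineq) auto
      also have "\<dots> \<le> 8 * (1 * 1)" by (intro mult_left_mono mult_mono) (use e in \<open>auto simp: U_def\<close>)
      finally show ?thesis by (simp add: f_def y_def)
    qed
    show "((\<lambda>t. f e t h) has_real_derivative L e t h + src e t h - K * y t) (at t)" for e t h
    proof -
      have "(y has_real_derivative K * y t) (at t)"
        unfolding y_def by (auto intro!: derivative_eq_intros)
      from DERIV_diff[OF cum3_deriv_time this] show ?thesis
        unfolding f_def by (rule DERIV_cong) (simp add: L_def src_def sum.distrib)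
    qed
    show "((\<lambda>s. f e t (tilt h s (a k))) has_real_derivative
        cum4 t (tilt h s (a k)) (p e) (q e) (r e) (dir k)) (at s)" for e t h k s
      unfolding f_def by (rule DERIV_cong[OF DERIV_diff[OF cum3_deriv_field DERIV_const]]) simp
    show "\<bar>mean t h (dir k)\<bar> \<le> (\<Sum>k\<in>I. \<Sum>i\<in>I. \<bar>a k i\<bar>)" if "k \<in> I" for k t h
      using that by (rule drift_abs_le)
    fix e :: "('i \<Rightarrow> real) \<times> ('i \<Rightarrow> real) \<times> ('i \<Rightarrow> real)" and t :: real and h :: "'i \<Rightarrow> real"
    assume e: "e \<in> V \<times> U \<times> U" and t: "0 < t" "t \<le> 1" and pos: "f e t h > 0"
      and max: "\<And>e'. e' \<in> V \<times> U \<times> U \<Longrightarrow> f e' t h \<le> f e t h"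
    obtain v0 u0 w0 where e_eq: "e = (v0, u0, w0)" by (cases e)
    have mem: "v0 \<in> V" "u0 \<in> U" "w0 \<in> U" using e unfolding e_eq by auto
    define N where "N = cum3 t h (dot I v0) (dot I u0) (dot I w0)"
    have N: "N = f e t h + y t" by (simp add: N_def f_def p_def q_def r_def e_eq)
    have N_max: "cum3 t h (dot I v') (dot I u') (dot I w') \<le> N" if "v' \<in> V" "u' \<in> U" "w' \<in> U" for v' u' w'
      using max[of "(v', u', w')"] that by (simp add: N_def f_def p_def q_def r_def e_eq)
    define T where "T v j = (\<Sum>i\<in>I. coup j i * cum2 t h (dot I v) (\<lambda>x. x i))" for v j
    have coup0: "coup j i = 0" if "j \<notin> I" for i j using that by (simp add: coup_def a_outside)
    have T0: "T v j = 0" if "j \<notin> I" for v j using that by (simp add: T_def coup0)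
    \<comment> \<open>Contracting the covariance with \<open>a\<close> amounts to feeding the transported vector into the cumulant.\<close>
    have contract: "(\<Sum>k\<in>I. cum2 t h (dot I v) (dir k) * cum3 t h p q (dir k)) = c * cum3 t h p q (dot I (\<lambda>j. T v j / c))"
      if "c > 0" for v p q c
    proof -
      have "(\<Sum>k\<in>I. cum2 t h (dot I v) (dir k) * cum3 t h p q (dir k))
        = (\<Sum>i\<in>I. \<Sum>j\<in>I. cum2 t h (dot I v) (\<lambda>x. x i) * coup i j * cum3 t h p q (\<lambda>x. x j))"
        unfolding cum2_dot_right cum3_dot_right by (rule coup_bilinear)
      also have "\<dots> = (\<Sum>j\<in>I. \<Sum>i\<in>I. cum2 t h (dot I v) (\<lambda>x. x i) * coup i j * cum3 t h p q (\<lambda>x. x j))"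
        by (rule sum.swap)
      also have "\<dots> = (\<Sum>j\<in>I. T v j * cum3 t h p q (\<lambda>x. x j))"
        unfolding T_def sum_distrib_right by (simp add: coup_def mult_ac)
      also have "\<dots> = c * cum3 t h p q (dot I (\<lambda>j. T v j / c))"
        unfolding cum3_dot_right sum_distrib_left using that by simp
      finally show ?thesis .
    qed
    have TU: "(\<lambda>j. T u j / c2) \<in> U" if "u \<in> U" for u
    proof -
      have "L2_set (\<lambda>j. T u j / c2) I = (1 / c2) * L2_set (T u) I"
        using L2_set_right_distrib[of "1/c2" "T u" I] c by simp
      also have "\<dots> \<le> (1 / c2) * c2"
        unfolding T_def using t that c by (intro mult_left_mono l2) (auto simp: U_def)
      finally show ?thesis using c T0 by (simp add: U_def)
    qed
    have TV: "(\<lambda>j. T u j / c1) \<in> V" if "u \<in> V" for u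
    proof -
      have "\<bar>T u j\<bar> \<le> c1" for j
      proof (cases "j \<in> I")
        case True thus ?thesis unfolding T_def using t that by (intro row) (auto simp: V_alt)
      qed (use T0 c in simp)
      thus ?thesis unfolding V_alt using c T0 by (simp add: abs_divide)
    qed
    have s1: "(\<Sum>k\<in>I. cum2 t h (dot I v0) (dir k) * cum3 t h (dot I u0) (dot I w0) (dir k)) \<le> c1 * N"
    proof -
      have "cum3 t h (dot I u0) (dot I w0) (dot I (\<lambda>j. T v0 j / c1)) = cum3 t h (dot I (\<lambda>j. T v0 j / c1)) (dot I u0) (dot I w0)"
        by (subst cum3_perm(2), subst cum3_perm(1)) (rule refl)
      also have "\<dots> \<le> N" by (intro N_max TV mem)
      finally show ?thesis unfolding contract[OF c(1)] using c by simp
    qed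
    have s2: "(\<Sum>k\<in>I. cum2 t h (dot I u0) (dir k) * cum3 t h (dot I v0) (dot I w0) (dir k)) \<le> c2 * N"
    proof -
      have "cum3 t h (dot I v0) (dot I w0) (dot I (\<lambda>j. T u0 j / c2)) = cum3 t h (dot I v0) (dot I (\<lambda>j. T u0 j / c2)) (dot I w0)"
        by (rule cum3_perm(2))
      also have "\<dots> \<le> N" by (intro N_max TU mem)
      finally show ?thesis unfolding contract[OF c(2)] using c by simp
    qed
    have s3: "(\<Sum>k\<in>I. cum2 t h (dot I w0) (dir k) * cum3 t h (dot I v0) (dot I u0) (dir k)) \<le> c2 * N"
    proof -
      have "cum3 t h (dot I v0) (dot I u0) (dot I (\<lambda>j. T w0 j / c2)) \<le> N" by (intro N_max TU mem)
      thus ?thesis unfolding contract[OF c(2)] using c by simp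
    qed
    have "src e t h \<le> K * N"
      using s1 s2 s3 by (simp add: src_def p_def q_def r_def e_eq sum.distrib K_def algebra_simps)
    also have "K * N = K * f e t h + K * y t" unfolding N by (simp add: algebra_simps)
    finally show "L e t h + src e t h - K * y t
      \<le> (\<Sum>k\<in>I. 1/2 * cum5 t h (p e) (q e) (r e) (dir k) (dir k)
        + mean t h (dir k) * cum4 t h (p e) (q e) (r e) (dir k)) + K * f e t h"
      unfolding L_def[symmetric] by simp
  qed (use t z u v in \<open>auto simp: U_def V_alt a_outside intro: cum4_deriv_field\<close>)
  thus ?thesis by (simp add: f_def p_def q_def r_def y_def K_def)
qed

end

section \<open>Finite range on the lattice\<close>

lemma lattice_dist_ge: "\<bar>i $ k - j $ k\<bar> \<le> lattice_dist i j"
  unfolding lattice_dist_def by (rule Max_ge) auto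

lemma lattice_dist_leI: "(\<And>k. \<bar>i $ k - j $ k\<bar> \<le> m) \<Longrightarrow> lattice_dist i j \<le> m"
  unfolding lattice_dist_def by (subst Max_le_iff) auto

lemma lattice_dist_self [simp]: "lattice_dist i i = 0"
  by (simp add: lattice_dist_def)

lemma lattice_dist_commute: "lattice_dist i j = lattice_dist j i"
  by (simp add: lattice_dist_def abs_minus_commute)

lemma lattice_dist_triangle: "lattice_dist i l \<le> lattice_dist i j + lattice_dist j l"
proof (rule lattice_dist_leI)
  fix k
  show "\<bar>i $ k - l $ k\<bar> \<le> lattice_dist i j + lattice_dist j l"
    using lattice_dist_ge[of i k j] lattice_dist_ge[of j k l] by linarith
qed

lemma sum_exp_interval_le:
  fixes \<eta> :: real and L :: int
  assumes "\<eta> > 0"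
  shows "(\<Sum>m\<in>{-L..L}. exp (- \<eta> * real_of_int \<bar>m\<bar>)) \<le> 2 / (1 - exp (- \<eta>))"
proof -
  let ?f = "\<lambda>m::int. exp (- \<eta> * real_of_int \<bar>m\<bar>)"
  define q where "q = exp (- \<eta>)"
  have q: "0 < q" "q < 1" unfolding q_def using assms by auto
  have fq: "?f (int n) = q ^ n" "?f (- int n) = q ^ n" for n
    unfolding q_def by (simp_all add: exp_of_nat_mult[symmetric] mult.commute)
  define N where "N = {..nat L}"
  have geo: "(\<Sum>n\<in>N. q ^ n) \<le> 1 / (1 - q)"
    using sum_le_suminf[of "\<lambda>n. q ^ n" N] q by (simp add: N_def suminf_geometric summable_geometric)
  have sub: "{-L..L} \<subseteq> int ` N \<union> (\<lambda>n. - int n) ` N"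
  proof
    fix m assume m: "m \<in> {-L..L}"
    show "m \<in> int ` N \<union> (\<lambda>n. - int n) ` N"
    proof (cases "m \<ge> 0")
      case True
      hence "m = int (nat m)" "nat m \<in> N" using m by (auto simp: N_def)
      thus ?thesis by blast
    next
      case False
      hence "m = - int (nat (- m))" "nat (- m) \<in> N" using m by (auto simp: N_def)
      thus ?thesis by blast
    qed
  qed
  have "(\<Sum>m\<in>{-L..L}. ?f m) \<le> (\<Sum>m\<in>int ` N \<union> (\<lambda>n. - int n) ` N. ?f m)"
    by (rule sum_mono2[OF _ sub]) (auto simp: N_def)
  also have "\<dots> \<le> (\<Sum>m\<in>int ` N. ?f m) + (\<Sum>m\<in>(\<lambda>n. - int n) ` N. ?f m)"
    by (subst sum.union_inter[symmetric]) (auto simp: N_def intro!: sum_nonneg)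
  also have "\<dots> = (\<Sum>n\<in>N. ?f (int n)) + (\<Sum>n\<in>N. ?f (- int n))"
    by (subst (1 2) sum.reindex) (auto simp: inj_on_def)
  also have "\<dots> = (\<Sum>n\<in>N. q ^ n) + (\<Sum>n\<in>N. q ^ n)" unfolding fq ..
  finally show ?thesis using geo unfolding q_def by linarith
qed

text \<open>The maximum of the coordinate distances is at least their average, so the sum over the lattice is
dominated by a product of one-dimensional geometric sums.\<close>

lemma lattice_sum_bound:
  fixes \<theta> :: real
  assumes "\<theta> > 0"
  shows "\<exists>C>0. \<forall>(\<Lambda> :: (int ^ 'd) set) i. finite \<Lambda> \<longrightarrow> (\<Sum>j\<in>\<Lambda>. exp (- \<theta> * real_of_int (lattice_dist i j))) \<le> C"
proof -
  define D where "D = real CARD('d)"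
  define \<eta> where "\<eta> = \<theta> / D"
  have D: "D > 0" by (simp add: D_def)
  have \<eta>: "\<eta> > 0" using assms D by (simp add: \<eta>_def)
  define C where "C = (2 / (1 - exp (- \<eta>))) ^ CARD('d)"
  have "C > 0" unfolding C_def using \<eta> by simp
  moreover have "(\<Sum>j\<in>\<Lambda>. exp (- \<theta> * real_of_int (lattice_dist i j))) \<le> C"
    if fin: "finite \<Lambda>" for \<Lambda> :: "(int ^ 'd) set" and i
  proof -
    let ?F = "\<lambda>g :: 'd \<Rightarrow> int. \<Prod>k\<in>UNIV. exp (- \<eta> * real_of_int \<bar>g k\<bar>)"
    let ?e = "\<lambda>j :: int ^ 'd. \<lambda>k. j $ k - i $ k"
    have le: "exp (- \<theta> * real_of_int (lattice_dist i j)) \<le> ?F (?e j)" for j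
    proof -
      have "(\<Sum>k\<in>UNIV. real_of_int \<bar>j $ k - i $ k\<bar>) \<le> (\<Sum>k\<in>(UNIV::'d set). real_of_int (lattice_dist i j))"
        by (rule sum_mono) (use lattice_dist_ge[of i _ j] in \<open>simp only: of_int_le_iff abs_minus_commute\<close>)
      hence "\<eta> * (\<Sum>k\<in>UNIV. real_of_int \<bar>j $ k - i $ k\<bar>) \<le> \<eta> * (D * real_of_int (lattice_dist i j))"
        using \<eta> by (intro mult_left_mono) (auto simp: D_def)
      also have "\<dots> = \<theta> * real_of_int (lattice_dist i j)" using D by (simp add: \<eta>_def)
      finally show ?thesis
        by (simp add: exp_sum[symmetric] sum_distrib_left sum_negf)
    qed
    define L where "L = Max (insert 0 (lattice_dist i ` \<Lambda>))"
    have L: "lattice_dist i j \<le> L" if "j \<in> \<Lambda>" for j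
      unfolding L_def by (rule Max_ge) (use fin that in auto)
    have inj: "inj_on ?e \<Lambda>"
      by (rule inj_onI) (auto simp: vec_eq_iff fun_eq_iff)
    have "(\<Sum>j\<in>\<Lambda>. exp (- \<theta> * real_of_int (lattice_dist i j))) \<le> (\<Sum>j\<in>\<Lambda>. ?F (?e j))"
      by (rule sum_mono) (rule le)
    also have "\<dots> = (\<Sum>g\<in>?e ` \<Lambda>. ?F g)"
      by (subst sum.reindex[OF inj]) simp
    also have "\<dots> \<le> (\<Sum>g\<in>PiE UNIV (\<lambda>_. {-L..L}). ?F g)"
    proof (rule sum_mono2)
      show "?e ` \<Lambda> \<subseteq> PiE UNIV (\<lambda>_. {-L..L})"
      proof (clarsimp simp: PiE_iff)
        fix j k assume "j \<in> \<Lambda>"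
        thus "- L \<le> j $ k - i $ k \<and> j $ k - i $ k \<le> L"
          using L[of j] lattice_dist_ge[of i k j] by linarith
      qed
    qed (auto intro!: prod_nonneg finite_PiE)
    also have "\<dots> = (\<Prod>k\<in>(UNIV::'d set). \<Sum>m\<in>{-L..L}. exp (- \<eta> * real_of_int \<bar>m\<bar>))"
      by (rule prod_sum_PiE[symmetric]) auto
    also have "\<dots> = (\<Sum>m\<in>{-L..L}. exp (- \<eta> * real_of_int \<bar>m\<bar>)) ^ CARD('d)" by simp
    also have "\<dots> \<le> C"
      unfolding C_def by (intro power_mono sum_exp_interval_le \<eta> sum_nonneg) auto
    finally show ?thesis .
  qed
  ultimately show ?thesis by blast
qed

lemma lattice_ball_card_bound:
  fixes r :: nat
  shows "\<exists>m::real. m \<ge> 1 \<and> (\<forall>(\<Lambda> :: (int ^ 'd) set) i. finite \<Lambda> \<longrightarrow>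
     real (card {j\<in>\<Lambda>. lattice_dist i j \<le> int r}) \<le> m)"
proof -
  obtain C where C: "\<And>(\<Lambda> :: (int ^ 'd) set) i. finite \<Lambda> \<Longrightarrow> (\<Sum>j\<in>\<Lambda>. exp (- 1 * real_of_int (lattice_dist i j))) \<le> C"
    using lattice_sum_bound[of 1, where 'd = 'd] by auto
  have "real (card {j\<in>\<Lambda>. lattice_dist i j \<le> int r}) \<le> max 1 (exp (real r) * C)"
    if fin: "finite \<Lambda>" for \<Lambda> :: "(int ^ 'd) set" and i
  proof -
    let ?B = "{j\<in>\<Lambda>. lattice_dist i j \<le> int r}"
    have "real (card ?B) = (\<Sum>j\<in>?B. 1)" by simp
    also have "\<dots> \<le> (\<Sum>j\<in>?B. exp (real r) * exp (- 1 * real_of_int (lattice_dist i j)))"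
      by (rule sum_mono) (auto simp: exp_add[symmetric])
    also have "\<dots> = exp (real r) * (\<Sum>j\<in>?B. exp (- 1 * real_of_int (lattice_dist i j)))"
      by (simp add: sum_distrib_left)
    also have "\<dots> \<le> exp (real r) * C"
      using C[of ?B i] fin by (intro mult_left_mono) auto
    finally show ?thesis by simp
  qed
  thus ?thesis by (intro exI[of _ "max 1 (exp (real r) * C)"]) auto
qed

text \<open>Cauchy-Schwarz over pairs of indices, with weight \<open>B\<close>.\<close>

lemma schur_test:
  assumes B: "\<And>i j. 0 \<le> B i j" and m: "0 \<le> m"
    and row: "\<And>i. i \<in> I \<Longrightarrow> (\<Sum>j\<in>I. B i j) \<le> m" and col: "\<And>j. j \<in> I \<Longrightarrow> (\<Sum>i\<in>I. B i j) \<le> m"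
  shows "(\<Sum>i\<in>I. \<Sum>j\<in>I. B i j * (\<bar>p i\<bar> * \<bar>q j\<bar>)) \<le> m * (L2_set p I * L2_set q I)"
proof -
  let ?P = "\<lambda>z. sqrt (B (fst z) (snd z)) * p (fst z)" and ?Q = "\<lambda>z. sqrt (B (fst z) (snd z)) * q (snd z)"
  have "(\<Sum>i\<in>I. \<Sum>j\<in>I. B i j * (\<bar>p i\<bar> * \<bar>q j\<bar>)) = (\<Sum>z\<in>I \<times> I. \<bar>?P z\<bar> * \<bar>?Q z\<bar>)"
    unfolding sum.cartesian_product
  proof (rule sum.cong[OF refl], clarify)
    fix i j
    have "\<bar>sqrt (B i j) * p i\<bar> * \<bar>sqrt (B i j) * q j\<bar> = (sqrt (B i j) * sqrt (B i j)) * (\<bar>p i\<bar> * \<bar>q j\<bar>)"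
      using B[of i j] unfolding abs_mult by (simp only: abs_of_nonneg real_sqrt_ge_zero mult_ac)
    thus "B i j * (\<bar>p i\<bar> * \<bar>q j\<bar>) = \<bar>?P (i, j)\<bar> * \<bar>?Q (i, j)\<bar>"
      using B[of i j] by simp
  qed
  also have "\<dots> \<le> L2_set ?P (I \<times> I) * L2_set ?Q (I \<times> I)" by (rule L2_set_mult_ineq)
  also have "\<dots> \<le> (sqrt m * L2_set p I) * (sqrt m * L2_set q I)"
  proof (rule mult_mono)
    have "(\<Sum>z\<in>I \<times> I. (?P z)\<^sup>2) = (\<Sum>i\<in>I. \<Sum>j\<in>I. B i j * (p i)\<^sup>2)"
      unfolding sum.cartesian_product by (rule sum.cong) (use B in \<open>auto simp: power_mult_distrib\<close>)
    also have "\<dots> = (\<Sum>i\<in>I. (\<Sum>j\<in>I. B i j) * (p i)\<^sup>2)" by (simp add: sum_distrib_right)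
    also have "\<dots> \<le> (\<Sum>i\<in>I. m * (p i)\<^sup>2)" by (intro sum_mono mult_right_mono row) auto
    finally show "L2_set ?P (I \<times> I) \<le> sqrt m * L2_set p I"
      unfolding L2_set_def by (simp add: real_sqrt_mult[symmetric] sum_distrib_left)
    have "(\<Sum>z\<in>I \<times> I. (?Q z)\<^sup>2) = (\<Sum>i\<in>I. \<Sum>j\<in>I. B i j * (q j)\<^sup>2)"
      unfolding sum.cartesian_product by (rule sum.cong) (use B in \<open>auto simp: power_mult_distrib\<close>)
    also have "\<dots> = (\<Sum>j\<in>I. (\<Sum>i\<in>I. B i j) * (q j)\<^sup>2)" by (subst sum.swap) (simp add: sum_distrib_right)
    also have "\<dots> \<le> (\<Sum>j\<in>I. m * (q j)\<^sup>2)" by (intro sum_mono mult_right_mono col) auto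
    finally show "L2_set ?Q (I \<times> I) \<le> sqrt m * L2_set q I"
      unfolding L2_set_def by (simp add: real_sqrt_mult[symmetric] sum_distrib_left)
  qed (use m in \<open>auto intro: mult_nonneg_nonneg L2_set_nonneg\<close>)
  also have "\<dots> = (sqrt m * sqrt m) * (L2_set p I * L2_set q I)" by (simp only: mult_ac)
  also have "sqrt m * sqrt m = m" using m by simp
  finally show ?thesis .
qed

lemma op_norm_on_upper:
  assumes "finite I" "L2_set v I \<le> 1"
  shows "L2_set (\<lambda>i. \<Sum>j\<in>I. A i j * v j) I \<le> op_norm_on I A"
  unfolding op_norm_on_def
proof (rule cSUP_upper)
  show "v \<in> {v. L2_set v I \<le> 1}" using assms by simp
  show "bdd_above ((\<lambda>v. L2_set (\<lambda>i. \<Sum>j\<in>I. A i j * v j) I) ` {v. L2_set v I \<le> 1})"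
  proof (rule bdd_aboveI2)
    fix w assume "w \<in> {v. L2_set v I \<le> 1}"
    hence w: "\<bar>w i\<bar> \<le> 1" if "i \<in> I" for i using L2_set_abs_le[OF assms(1) that, of w] by simp
    have "L2_set (\<lambda>i. \<Sum>j\<in>I. A i j * w j) I \<le> (\<Sum>i\<in>I. \<bar>\<Sum>j\<in>I. A i j * w j\<bar>)"
      by (rule L2_set_le_sum_abs)
    also have "\<dots> \<le> (\<Sum>i\<in>I. \<Sum>j\<in>I. \<bar>A i j\<bar>)"
      by (intro sum_mono order_trans[OF sum_abs]) (use w in \<open>auto simp: abs_mult mult_left_le\<close>)
    finally show "L2_set (\<lambda>i. \<Sum>j\<in>I. A i j * w j) I \<le> (\<Sum>i\<in>I. \<Sum>j\<in>I. \<bar>A i j\<bar>)" .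
  qed
qed

lemma op_norm_on_bilinear:
  assumes fin: "finite I"
  shows "\<bar>\<Sum>i\<in>I. \<Sum>j\<in>I. p i * A i j * q j\<bar> \<le> op_norm_on I A * L2_set p I * L2_set q I"
proof (cases "L2_set q I = 0")
  case True
  hence "q j = 0" if "j \<in> I" for j using that fin by (simp add: L2_set_eq_0_iff)
  thus ?thesis using True by simp
next
  case False
  define l where "l = L2_set q I"
  have l: "l > 0" using False L2_set_nonneg[of q I] unfolding l_def by linarith
  define v where "v j = q j / l" for j
  have "L2_set v I = (1/l) * L2_set q I"
    unfolding v_def using L2_set_right_distrib[of "1/l" q I] l by simp
  hence v: "L2_set v I \<le> 1" using l by (simp add: l_def)
  let ?y = "\<lambda>i. \<Sum>j\<in>I. A i j * v j"
  have "\<bar>\<Sum>i\<in>I. \<Sum>j\<in>I. p i * A i j * q j\<bar> = \<bar>\<Sum>i\<in>I. l * (p i * ?y i)\<bar>"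
    unfolding v_def sum_distrib_left using l by (simp add: mult_ac)
  also have "\<dots> = l * \<bar>\<Sum>i\<in>I. p i * ?y i\<bar>"
    using l by (simp add: sum_distrib_left[symmetric] abs_mult)
  also have "\<dots> \<le> l * (\<Sum>i\<in>I. \<bar>p i\<bar> * \<bar>?y i\<bar>)"
    using l by (intro mult_left_mono order_trans[OF sum_abs]) (auto simp: abs_mult)
  also have "\<dots> \<le> l * (L2_set p I * L2_set ?y I)"
    using l by (intro mult_left_mono L2_set_mult_ineq) auto
  also have "\<dots> \<le> l * (L2_set p I * op_norm_on I A)"
    using l by (intro mult_left_mono op_norm_on_upper fin v L2_set_nonneg) auto
  finally show ?thesis by (simp add: l_def mult_ac)
qed

lemma L2_set_indicator: "finite I \<Longrightarrow> i \<in> I \<Longrightarrow> L2_set (\<lambda>j. if j = i then c else 0) I = \<bar>c\<bar>"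
  by (simp add: L2_set_def if_distrib[of "\<lambda>x. x ^ 2"] cong: if_cong)

lemma op_norm_on_entry:
  assumes "finite I" "i \<in> I" "j \<in> I"
  shows "\<bar>A i j\<bar> \<le> op_norm_on I A"
proof -
  have "(\<Sum>k\<in>I. \<Sum>l\<in>I. (if k = i then 1 else 0) * A k l * (if l = j then 1 else 0)) = A i j"
    using assms by (simp add: if_distrib[of "\<lambda>x. x * _"] if_distrib[of "\<lambda>x. _ * x"] cong: if_cong)
  thus ?thesis
    using op_norm_on_bilinear[OF assms(1), of "\<lambda>k. if k = i then 1 else 0" A "\<lambda>k. if k = j then 1 else 0"] assms
    by (simp add: L2_set_indicator)
qed

lemma abs_exp_minus_1_le: "\<bar>exp x - 1\<bar> \<le> exp \<bar>x\<bar> - (1::real)"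
proof (cases "x \<ge> 0")
  case False
  have "1 - exp x \<le> - x" using exp_ge_add_one_self[of x] by linarith
  also have "\<dots> \<le> exp (- x) - 1" using exp_ge_add_one_self[of "- x"] by linarith
  finally show ?thesis using False by simp
qed simp

section \<open>Decay of covariances and a lower bound for the variance\<close>

context ising_flow begin

lemma coup_sym: "coup i j = coup j i"
  by (simp add: coup_def mult.commute)

lemma cum2_scale: "cum2 t h (\<lambda>x. c * p x) q = c * cum2 t h p q"
proof -
  have "mean t h (\<lambda>x. c * p x * q x) = c * mean t h (\<lambda>x. p x * q x)"
    unfolding mult.assoc by (rule mean_cmult)
  thus ?thesis by (simp add: cum2_def mean_cmult algebra_simps)
qed

lemma cum3_scale: "cum3 t h (\<lambda>x. c * p x) q r = c * cum3 t h p q r"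
proof -
  have "mean t h (\<lambda>x. c * p x * q x * r x) = c * mean t h (\<lambda>x. p x * q x * r x)"
    "mean t h (\<lambda>x. c * p x * q x) = c * mean t h (\<lambda>x. p x * q x)"
    "mean t h (\<lambda>x. c * p x * r x) = c * mean t h (\<lambda>x. p x * r x)"
    unfolding mult.assoc by (rule mean_cmult)+
  thus ?thesis by (simp add: cum3_def mean_cmult algebra_simps)
qed

lemma dot_scale: "dot I (\<lambda>i. c * u i) = (\<lambda>x. c * dot I u x)"
  by (simp add: dot_def sum_distrib_left mult.assoc fun_eq_iff)

lemma dot_indicator: "l \<in> I \<Longrightarrow> dot I (\<lambda>i. if i = l then c else 0) = (\<lambda>x. c * x l)"
  by (simp add: dot_def fun_eq_iff if_distrib[of "\<lambda>x. x * _"] cong: if_cong)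

lemma covariance_bound:
  assumes \<delta>: "0 < \<delta>" "\<delta> \<le> 1" and op: "op_norm_on I coup \<le> 1 - \<delta>" and t: "t \<in> {0..1}"
    and u: "L2_set u I \<le> 1" "\<And>i. i \<notin> I \<Longrightarrow> u i = 0"
    and v: "L2_set v I \<le> 1" "\<And>i. i \<notin> I \<Longrightarrow> v i = 0"
  shows "cum2 t h (dot I u) (dot I v) \<le> 1 / \<delta>"
proof -
  have "cum2 t h (dot I (\<lambda>i. 1 * u i)) (dot I (\<lambda>i. v i / 1)) \<le> 1 / (1 - (1 - \<delta>) * t)"
  proof (rule covariance_weighted_bound)
    fix p q :: "'i \<Rightarrow> real"
    have "\<bar>\<Sum>i\<in>I. \<Sum>j\<in>I. p i * coup i j * q j\<bar> \<le> op_norm_on I coup * L2_set p I * L2_set q I"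
      by (rule op_norm_on_bilinear[OF finite_I])
    also have "\<dots> \<le> (1 - \<delta>) * L2_set p I * L2_set q I"
      by (intro mult_right_mono op) auto
    finally show "\<bar>\<Sum>i\<in>I. \<Sum>j\<in>I. p i * 1 * coup i j * (q j / 1)\<bar> \<le> (1 - \<delta>) * L2_set p I * L2_set q I"
      by simp
  qed (use assms in auto)
  also have "\<dots> \<le> 1 / \<delta>"
  proof (rule divide_left_mono)
    have "(1 - \<delta>) * t \<le> 1 - \<delta>" using t \<delta> by (intro mult_left_le) auto
    thus 1: "\<delta> \<le> 1 - (1 - \<delta>) * t" by linarith
    show "0 < (1 - (1 - \<delta>) * t) * \<delta>" using 1 \<delta> by (intro mult_pos_pos) linarith+
  qed simp
  finally show ?thesis by simp
qed

lemma transported_L2_bound: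
  assumes \<delta>: "0 < \<delta>" "\<delta> \<le> 1" and op: "op_norm_on I coup \<le> 1 - \<delta>" and t: "t \<in> {0..1}"
    and u: "L2_set u I \<le> 1" "\<And>i. i \<notin> I \<Longrightarrow> u i = 0"
  shows "L2_set (\<lambda>j. \<Sum>i\<in>I. coup j i * cum2 t h (dot I u) (\<lambda>x. x i)) I \<le> 1 / \<delta>"
proof (rule L2_set_le_by_duality[OF finite_I])
  let ?p = "\<lambda>i. cum2 t h (dot I u) (\<lambda>x. x i)"
  fix w assume w: "L2_set w I \<le> 1" "\<And>i. i \<notin> I \<Longrightarrow> w i = 0"
  have p: "L2_set ?p I \<le> 1 / \<delta>"
  proof (rule L2_set_le_by_duality[OF finite_I])
    fix v assume v: "L2_set v I \<le> 1" "\<And>i. i \<notin> I \<Longrightarrow> v i = 0"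
    have "(\<Sum>i\<in>I. ?p i * v i) = cum2 t h (dot I u) (dot I v)"
      unfolding cum2_dot_right by (simp add: mult.commute)
    also have "\<dots> \<le> 1 / \<delta>" by (rule covariance_bound[OF \<delta> op t u v])
    finally show "(\<Sum>i\<in>I. ?p i * v i) \<le> 1 / \<delta>" .
  qed (use \<delta> in auto)
  have "(\<Sum>j\<in>I. (\<Sum>i\<in>I. coup j i * ?p i) * w j) = (\<Sum>j\<in>I. \<Sum>i\<in>I. w j * coup j i * ?p i)"
    by (simp add: sum_distrib_right sum_distrib_left mult_ac)
  also have "\<dots> \<le> op_norm_on I coup * L2_set w I * L2_set ?p I"
    using op_norm_on_bilinear[OF finite_I, of w coup ?p] by linarith
  also have "\<dots> \<le> 1 * 1 * (1 / \<delta>)"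
    using op \<delta> w p by (intro mult_mono) (auto intro: L2_set_nonneg)
  finally show "(\<Sum>j\<in>I. (\<Sum>i\<in>I. coup j i * ?p i) * w j) \<le> 1 / \<delta>" by simp
qed (use \<delta> in auto)

text \<open>The weights \<open>exp (\<theta> * dist i l)\<close> centred at \<open>i\<close> vary by a factor of at most \<open>exp (\<theta> * r)\<close> over
the range \<open>r\<close> of the couplings. As \<open>m\<close> bounds the number of neighbours of a site, Schur's test
shows that conjugation with these weights increases the norm of the coupling matrix by at most
\<open>\<delta> / 2\<close>. A bound for the conjugated covariance matrix is a bound for each of its entries, in which
the weight at \<open>j\<close> appears as a factor.\<close>

lemma covariance_decay:
  fixes dist :: "'i \<Rightarrow> 'i \<Rightarrow> real"
  assumes \<delta>: "0 < \<delta>" "\<delta> \<le> 1" and op: "op_norm_on I coup \<le> 1 - \<delta>" and t: "t \<in> {0..1}"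
    and dist: "\<And>i. dist i i = 0" "\<And>i j. dist i j = dist j i" "\<And>i j l. dist i l \<le> dist i j + dist j l"
    and range: "\<And>i j. i \<in> I \<Longrightarrow> j \<in> I \<Longrightarrow> dist i j > r \<Longrightarrow> coup i j = 0"
    and m: "\<And>i. i \<in> I \<Longrightarrow> real (card {j\<in>I. dist i j \<le> r}) \<le> m"
    and \<theta>: "\<theta> \<ge> 0" "(exp (\<theta> * r) - 1) * m \<le> \<delta> / 2" and r: "r \<ge> 0"
    and ij: "i \<in> I" "j \<in> I"
  shows "\<bar>cum2 t h (\<lambda>x. x i) (\<lambda>x. x j)\<bar> \<le> 2 / \<delta> * exp (- \<theta> * dist i j)"
proof -
  have m0: "m \<ge> 0" using m[OF ij(1)] by (meson of_nat_0_le_iff order_trans)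
  have er: "exp (\<theta> * r) - 1 \<ge> 0" using \<theta> r by simp
  define g where "g l = exp (\<theta> * dist i l)" for l
  define B where "B k l = (if dist k l \<le> r then exp (\<theta> * r) - 1 else 0)" for k l
  have Brow: "(\<Sum>l\<in>I. B k l) \<le> (exp (\<theta> * r) - 1) * m" if "k \<in> I" for k
  proof -
    have "(\<Sum>l\<in>I. B k l) = (\<Sum>l\<in>{l\<in>I. dist k l \<le> r}. exp (\<theta> * r) - 1)"
      unfolding B_def by (rule sum.mono_neutral_cong_right) auto
    also have "\<dots> = (exp (\<theta> * r) - 1) * real (card {l\<in>I. dist k l \<le> r})" by simp
    also have "\<dots> \<le> (exp (\<theta> * r) - 1) * m" using er m[OF that] by (intro mult_left_mono) auto
    finally show ?thesis .
  qed
  have Bsym: "B k l = B l k" for k l by (simp add: B_def dist(2)[of k l])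
  have entry: "\<bar>coup k l * (g k / g l - 1)\<bar> \<le> B k l" if kl: "k \<in> I" "l \<in> I" for k l
  proof (cases "dist k l \<le> r")
    case True
    have "\<bar>dist i k - dist i l\<bar> \<le> dist k l"
      using dist(3)[of i k l] dist(3)[of i l k] dist(2)[of k l] by linarith
    hence "\<theta> * \<bar>dist i k - dist i l\<bar> \<le> \<theta> * r" using True \<theta> by (intro mult_left_mono) auto
    hence 1: "\<bar>\<theta> * dist i k - \<theta> * dist i l\<bar> \<le> \<theta> * r"
      using \<theta>(1) by (metis abs_mult abs_of_nonneg right_diff_distrib)
    have "\<bar>g k / g l - 1\<bar> = \<bar>exp (\<theta> * dist i k - \<theta> * dist i l) - 1\<bar>" by (simp add: g_def exp_diff)
    also have "\<dots> \<le> exp \<bar>\<theta> * dist i k - \<theta> * dist i l\<bar> - 1" by (rule abs_exp_minus_1_le)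
    also have "\<dots> \<le> exp (\<theta> * r) - 1" using 1 by simp
    finally have 2: "\<bar>g k / g l - 1\<bar> \<le> exp (\<theta> * r) - 1" .
    have "\<bar>coup k l\<bar> \<le> 1" using op_norm_on_entry[OF finite_I kl, of coup] op \<delta> by linarith
    hence "\<bar>coup k l\<bar> * \<bar>g k / g l - 1\<bar> \<le> 1 * (exp (\<theta> * r) - 1)" using 2 by (intro mult_mono) auto
    thus ?thesis using True by (simp add: B_def abs_mult)
  qed (use range[OF kl] in \<open>simp add: B_def\<close>)
  have conj: "\<bar>\<Sum>k\<in>I. \<Sum>l\<in>I. (p k * g k) * coup k l * (q l / g l)\<bar> \<le> (1 - \<delta> / 2) * L2_set p I * L2_set q I" for p q
  proof -
    have "(\<Sum>k\<in>I. \<Sum>l\<in>I. (p k * g k) * coup k l * (q l / g l))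
       = (\<Sum>k\<in>I. \<Sum>l\<in>I. p k * coup k l * q l) + (\<Sum>k\<in>I. \<Sum>l\<in>I. (coup k l * (g k / g l - 1)) * (p k * q l))"
      by (simp add: sum.distrib[symmetric] algebra_simps)
    moreover have "\<bar>\<Sum>k\<in>I. \<Sum>l\<in>I. p k * coup k l * q l\<bar> \<le> (1 - \<delta>) * (L2_set p I * L2_set q I)"
    proof -
      have "\<bar>\<Sum>k\<in>I. \<Sum>l\<in>I. p k * coup k l * q l\<bar> \<le> op_norm_on I coup * (L2_set p I * L2_set q I)"
        using op_norm_on_bilinear[OF finite_I, of p coup q] by (simp add: mult.assoc)
      also have "\<dots> \<le> (1 - \<delta>) * (L2_set p I * L2_set q I)" by (intro mult_right_mono op) auto
      finally show ?thesis .
    qed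
    moreover have "\<bar>\<Sum>k\<in>I. \<Sum>l\<in>I. (coup k l * (g k / g l - 1)) * (p k * q l)\<bar> \<le> \<delta> / 2 * (L2_set p I * L2_set q I)"
    proof -
      have "\<bar>\<Sum>k\<in>I. \<Sum>l\<in>I. (coup k l * (g k / g l - 1)) * (p k * q l)\<bar> \<le> (\<Sum>k\<in>I. \<Sum>l\<in>I. B k l * (\<bar>p k\<bar> * \<bar>q l\<bar>))"
      proof (intro order_trans[OF sum_abs] sum_mono)
        fix k l assume "k \<in> I" "l \<in> I"
        from mult_right_mono[OF entry[OF this], of "\<bar>p k\<bar> * \<bar>q l\<bar>"]
        show "\<bar>(coup k l * (g k / g l - 1)) * (p k * q l)\<bar> \<le> B k l * (\<bar>p k\<bar> * \<bar>q l\<bar>)"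
          by (simp add: abs_mult)
      qed
      also have "\<dots> \<le> ((exp (\<theta> * r) - 1) * m) * (L2_set p I * L2_set q I)"
        by (rule schur_test) (use Brow er m0 Bsym in \<open>auto simp: B_def\<close>)
      also have "\<dots> \<le> \<delta> / 2 * (L2_set p I * L2_set q I)"
        by (intro mult_right_mono \<theta>) auto
      finally show ?thesis .
    qed
    ultimately have "\<bar>\<Sum>k\<in>I. \<Sum>l\<in>I. (p k * g k) * coup k l * (q l / g l)\<bar>
      \<le> (1 - \<delta>) * (L2_set p I * L2_set q I) + \<delta> / 2 * (L2_set p I * L2_set q I)" by linarith
    thus ?thesis by (simp add: algebra_simps)
  qed
  have main: "c * g j * cum2 t h (\<lambda>x. x j) (\<lambda>x. x i) \<le> 2 / \<delta>" if c: "\<bar>c\<bar> = 1" for c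
  proof -
    have "cum2 t h (dot I (\<lambda>l. g l * (if l = j then c else 0))) (dot I (\<lambda>l. (if l = i then 1 else 0) / g l))
        \<le> 1 / (1 - (1 - \<delta> / 2) * t)"
      by (rule covariance_weighted_bound[OF _ _ _ conj t]) (use \<delta> ij c in \<open>auto simp: g_def L2_set_indicator\<close>)
    also have "(\<lambda>l. g l * (if l = j then c else 0)) = (\<lambda>l. if l = j then g j * c else 0)" by auto
    also have "(\<lambda>l. (if l = i then 1 else 0) / g l) = (\<lambda>l. if l = i then 1 else 0)" by (auto simp: g_def dist)
    also have "1 / (1 - (1 - \<delta> / 2) * t) \<le> 1 / (\<delta> / 2)"
    proof (rule divide_left_mono)
      have "(1 - \<delta> / 2) * t \<le> 1 - \<delta> / 2" using t \<delta> by (intro mult_left_le) auto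
      thus 1: "\<delta> / 2 \<le> 1 - (1 - \<delta> / 2) * t" by linarith
      show "0 < (1 - (1 - \<delta> / 2) * t) * (\<delta> / 2)" using 1 \<delta> by (intro mult_pos_pos) linarith+
    qed simp
    finally show ?thesis
      unfolding dot_indicator[OF ij(2)] dot_indicator[OF ij(1)] cum2_scale by (simp add: mult.commute)
  qed
  have "\<bar>cum2 t h (\<lambda>x. x i) (\<lambda>x. x j)\<bar> * g j \<le> 2 / \<delta>"
  proof (cases "cum2 t h (\<lambda>x. x i) (\<lambda>x. x j) \<ge> 0")
    case True thus ?thesis using main[of 1] by (simp add: cum2_sym[of t h "\<lambda>x. x j"] mult.commute)
  next
    case False thus ?thesis using main[of "-1"] by (simp add: cum2_sym[of t h "\<lambda>x. x j"] mult.commute)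
  qed
  hence "\<bar>cum2 t h (\<lambda>x. x i) (\<lambda>x. x j)\<bar> \<le> 2 / \<delta> / g j" by (subst pos_le_divide_eq) (simp_all add: g_def)
  thus ?thesis by (simp add: g_def exp_minus divide_inverse)
qed

lemma cum2_quadratic_lower_bound:
  assumes "mean t h g = 0"
  shows "cum2 t h p p \<ge> 2 * c * mean t h (\<lambda>x. p x * g x) - c\<^sup>2 * mean t h (\<lambda>x. g x * g x)"
proof -
  let ?\<mu> = "mean t h p"
  have "0 \<le> mean t h (\<lambda>x. (p x - ?\<mu> - c * g x)\<^sup>2)"
    using mean_mono[of "\<lambda>_. 0" "\<lambda>x. (p x - ?\<mu> - c * g x)\<^sup>2" t h] by simp
  also have "(\<lambda>x. (p x - ?\<mu> - c * g x)\<^sup>2) = (\<lambda>x. p x * p x - 2 * ?\<mu> * p x + ?\<mu> * ?\<mu>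
      - 2 * c * (p x * g x) + 2 * c * ?\<mu> * g x + c\<^sup>2 * (g x * g x))"
    by (simp add: fun_eq_iff power2_eq_square algebra_simps)
  also have "mean t h \<dots> = cum2 t h p p - 2 * c * mean t h (\<lambda>x. p x * g x) + c\<^sup>2 * mean t h (\<lambda>x. g x * g x)"
    unfolding mean_add mean_diff mean_cmult mean_const assms cum2_def by (simp add: algebra_simps)
  finally show ?thesis by simp
qed

text \<open>A Cramer-Rao argument. The score \<open>g\<close>, the sum of \<open>x i\<close> minus its conditional mean given the other
spins, has covariance of order \<open>sqrt n\<close> with the normalised magnetisation, because each term is
uncorrelated with all other spins. The variance of \<open>g\<close> is of order \<open>n\<close>, because two terms
are uncorrelated unless their sites interact. Bounded fields and couplings bound the local fields,
so the conditional variances of the spins are bounded below.\<close>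

lemma variance_lower_bound:
  assumes nonempty: "I \<noteq> {}" and entries: "\<And>i j. i \<in> I \<Longrightarrow> j \<in> I \<Longrightarrow> \<bar>coup i j\<bar> \<le> 1"
    and m: "\<And>i. i \<in> I \<Longrightarrow> real (card {j\<in>I. j = i \<or> coup i j \<noteq> 0}) \<le> m"
    and H: "\<And>i. i \<in> I \<Longrightarrow> \<bar>h i\<bar> \<le> H"
  shows "cum2 1 h (dot I (\<lambda>_. 1 / sqrt (card I))) (dot I (\<lambda>_. 1 / sqrt (card I))) \<ge> (1 - (tanh (H + m))\<^sup>2)\<^sup>2 / (4 * m)"
proof -
  define n where "n = real (card I)"
  define s where "s = 1 / sqrt n"
  define \<tau> where "\<tau> = 1 - (tanh (H + m))\<^sup>2"
  define F where "F i x = tanh (local_field 1 h i x)" for i x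
  define Y where "Y i x = x i - F i x" for i x
  define g where "g x = (\<Sum>i\<in>I. Y i x)" for x
  have n0: "n > 0" unfolding n_def using nonempty by (simp add: card_gt_0_iff)
  obtain i0 where i0: "i0 \<in> I" using nonempty by blast
  have "{j\<in>I. j = i0 \<or> coup i0 j \<noteq> 0} \<noteq> {}" using i0 by blast
  hence "card {j\<in>I. j = i0 \<or> coup i0 j \<noteq> 0} \<ge> 1" by (simp add: Suc_le_eq card_gt_0_iff)
  hence m1: "m \<ge> 1" using m[OF i0] by linarith
  have flip: "mean 1 h (\<lambda>x. Y i x * \<phi> x) = 0" if "i \<in> I" "\<And>x y. \<phi> (x(i := y)) = \<phi> x" for i \<phi>
    unfolding Y_def F_def by (rule mean_flip_zero[OF that])
  have F_indep: "F i (x(j := y)) = F i x" if "j = i \<or> coup i j = 0" for i j x y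
  proof -
    have "(\<Sum>l\<in>I - {i}. coup i l * (x(j := y)) l) = (\<Sum>l\<in>I - {i}. coup i l * x l)"
      by (rule sum.cong) (use that in auto)
    thus ?thesis by (simp add: F_def local_field_def)
  qed
  have F_le: "\<bar>F i x\<bar> \<le> tanh (H + m)" if "i \<in> I" "x \<in> spin_configs I" for i x
  proof -
    have "\<bar>\<Sum>j\<in>I - {i}. coup i j * x j\<bar> \<le> (\<Sum>j\<in>I - {i}. \<bar>coup i j * x j\<bar>)" by (rule sum_abs)
    also have "\<dots> \<le> (\<Sum>j\<in>I - {i}. if j = i \<or> coup i j \<noteq> 0 then 1 else 0)"
      using that spin_abs[OF that(2)] entries[OF that(1)] by (intro sum_mono) (auto simp: abs_mult)
    also have "\<dots> \<le> (\<Sum>j\<in>I. if j = i \<or> coup i j \<noteq> 0 then 1 else 0)"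
      by (rule sum_mono2) auto
    also have "\<dots> = real (card {j\<in>I. j = i \<or> coup i j \<noteq> 0})" by (simp add: sum.If_cases Int_def)
    also have "\<dots> \<le> m" by (rule m[OF that(1)])
    finally have "\<bar>local_field 1 h i x\<bar> \<le> H + m" using H[OF that(1)] unfolding local_field_def by linarith
    thus ?thesis unfolding F_def by (simp add: abs_le_iff tanh_real_le_iff flip: tanh_minus)
  qed
  have \<tau>0: "\<tau> > 0"
    unfolding \<tau>_def using tanh_real_lt_1[of "H + m"] tanh_real_gt_neg1[of "H + m"]
    by (simp add: abs_square_less_1)
  have g0: "mean 1 h g = 0"
    unfolding g_def mean_sum using flip[of _ "\<lambda>_. 1"] by simp
  have cov: "mean 1 h (\<lambda>x. dot I (\<lambda>_. s) x * g x) \<ge> s * (n * \<tau>)"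
  proof -
    have diag: "mean 1 h (\<lambda>x. x j * Y i x) = 0" if "i \<in> I" "j \<noteq> i" for i j
      using flip[OF that(1), of "\<lambda>x. x j"] that(2) by (simp add: mult.commute)
    have self: "mean 1 h (\<lambda>x. x i * Y i x) \<ge> \<tau>" if i: "i \<in> I" for i
    proof -
      have "mean 1 h (\<lambda>x. Y i x * F i x) = 0" by (rule flip[OF i]) (simp add: F_indep)
      hence "mean 1 h (\<lambda>x. x i * Y i x) = mean 1 h (\<lambda>x. x i * Y i x + Y i x * F i x)"
        by (simp add: mean_add)
      also have "\<dots> \<ge> mean 1 h (\<lambda>_. \<tau>)"
      proof (rule mean_mono)
        fix x assume x: "x \<in> spin_configs I"
        have "x i * x i = 1" using spin_abs[OF x i] by (metis abs_mult_self_eq mult_1)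
        hence "x i * Y i x + Y i x * F i x = 1 - (F i x)\<^sup>2"
          by (simp add: Y_def power2_eq_square algebra_simps)
        moreover have "(F i x)\<^sup>2 \<le> (tanh (H + m))\<^sup>2"
          using F_le[OF i x] by (metis abs_ge_zero abs_le_square_iff abs_of_nonneg order_trans)
        ultimately show "\<tau> \<le> x i * Y i x + Y i x * F i x" by (simp add: \<tau>_def)
      qed
      finally show ?thesis by simp
    qed
    have "mean 1 h (\<lambda>x. dot I (\<lambda>_. s) x * g x) = (\<Sum>i\<in>I. \<Sum>j\<in>I. s * mean 1 h (\<lambda>x. x j * Y i x))"
    proof -
      have "(\<lambda>x. dot I (\<lambda>_. s) x * g x) = (\<lambda>x. \<Sum>i\<in>I. \<Sum>j\<in>I. s * (x j * Y i x))"
        by (simp add: fun_eq_iff dot_def g_def sum_product sum_distrib_left mult_ac) (intro allI sum.swap)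
      thus ?thesis by (simp add: mean_sum mean_cmult)
    qed
    also have "\<dots> = (\<Sum>i\<in>I. s * mean 1 h (\<lambda>x. x i * Y i x))"
    proof (rule sum.cong[OF refl])
      fix i assume i: "i \<in> I"
      have "(\<Sum>j\<in>I. s * mean 1 h (\<lambda>x. x j * Y i x)) = (\<Sum>j\<in>I. if j = i then s * mean 1 h (\<lambda>x. x i * Y i x) else 0)"
        using diag[OF i] by (intro sum.cong) auto
      thus "(\<Sum>j\<in>I. s * mean 1 h (\<lambda>x. x j * Y i x)) = s * mean 1 h (\<lambda>x. x i * Y i x)" using i by simp
    qed
    also have "\<dots> \<ge> (\<Sum>i\<in>I. s * \<tau>)"
      using n0 self by (intro sum_mono mult_left_mono) (auto simp: s_def)
    also have "(\<Sum>i\<in>I. s * \<tau>) = s * (n * \<tau>)" by (simp add: n_def)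
    finally show ?thesis .
  qed
  have gg: "mean 1 h (\<lambda>x. g x * g x) \<le> 4 * m * n"
  proof -
    have YY: "mean 1 h (\<lambda>x. Y i x * Y j x) \<le> (if j = i \<or> coup i j \<noteq> 0 then 4 else 0)" if ij: "i \<in> I" "j \<in> I" for i j
    proof (cases "j = i \<or> coup i j \<noteq> 0")
      case True
      have "\<bar>mean 1 h (\<lambda>x. Y i x * Y j x)\<bar> \<le> 2 * 2"
      proof (rule mean_abs_le)
        fix x assume x: "x \<in> spin_configs I"
        have "\<bar>Y i x\<bar> \<le> 2" if "i \<in> I" for i
          using spin_abs[OF x that] F_le[OF that x] tanh_real_lt_1[of "H + m"] unfolding Y_def by linarith
        thus "\<bar>Y i x * Y j x\<bar> \<le> 2 * 2" unfolding abs_mult using ij by (intro mult_mono) auto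
      qed
      thus ?thesis using True by simp
    next
      case False
      hence "Y j (x(i := y)) = Y j x" for x y using F_indep[of i j] coup_sym[of i j] by (simp add: Y_def)
      thus ?thesis using flip[OF ij(1), of "Y j"] False by simp
    qed
    have "mean 1 h (\<lambda>x. g x * g x) = (\<Sum>i\<in>I. \<Sum>j\<in>I. mean 1 h (\<lambda>x. Y i x * Y j x))"
      by (simp add: g_def sum_product mean_sum)
    also have "\<dots> \<le> (\<Sum>i\<in>I. \<Sum>j\<in>I. if j = i \<or> coup i j \<noteq> 0 then 4 else 0)"
      by (intro sum_mono YY)
    also have "\<dots> = (\<Sum>i\<in>I. 4 * real (card {j\<in>I. j = i \<or> coup i j \<noteq> 0}))"
      by (simp add: sum.If_cases Int_def mult.commute)
    also have "\<dots> \<le> (\<Sum>i\<in>I. 4 * m)" by (intro sum_mono mult_left_mono m) auto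
    finally show ?thesis by (simp add: n_def mult_ac)
  qed
  \<comment> \<open>The multiplier that optimises the quadratic lower bound, given \<open>cov\<close> and \<open>gg\<close>.\<close>
  define c where "c = s * \<tau> / (4 * m)"
  have c0: "c \<ge> 0" unfolding c_def s_def using \<tau>0 m1 n0 by simp
  have "2 * c * (s * (n * \<tau>)) - c\<^sup>2 * (4 * m * n) = \<tau>\<^sup>2 / (4 * m) * (s\<^sup>2 * n)"
    unfolding c_def using m1 by (simp add: power2_eq_square divide_simps)
  also have "s\<^sup>2 * n = 1" using n0 by (simp add: s_def power_divide)
  finally have "\<tau>\<^sup>2 / (4 * m) = 2 * c * (s * (n * \<tau>)) - c\<^sup>2 * (4 * m * n)" by simp
  also have "\<dots> \<le> 2 * c * mean 1 h (\<lambda>x. dot I (\<lambda>_. s) x * g x) - c\<^sup>2 * mean 1 h (\<lambda>x. g x * g x)"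
    using cov gg c0 by (intro diff_mono mult_left_mono) auto
  also have "\<dots> \<le> cum2 1 h (dot I (\<lambda>_. s)) (dot I (\<lambda>_. s))" by (rule cum2_quadratic_lower_bound[OF g0])
  finally show ?thesis by (simp add: \<tau>_def s_def n_def)
qed

end

section \<open>Estimates uniform in the volume and the field\<close>

text \<open>The unit vector whose linear form is the normalised magnetisation \<open>W\<^sub>n\<close>.\<close>

definition unif :: "'i set \<Rightarrow> 'i \<Rightarrow> real" where
  "unif I = (\<lambda>i. if i \<in> I then 1 / sqrt (card I) else 0)"

lemma L2_set_unif: "finite I \<Longrightarrow> I \<noteq> {} \<Longrightarrow> L2_set (unif I) I = 1"
  by (simp add: L2_set_def unif_def power_divide)

lemma dot_unif: "dot I (unif I) x = 1 / sqrt (card I) * (\<Sum>i\<in>I. x i)"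
  by (simp add: dot_def unif_def sum_distrib_left)

context ising_flow begin

lemma row_sum_bound:
  assumes decay: "\<And>i j. i \<in> I \<Longrightarrow> j \<in> I \<Longrightarrow> \<bar>cum2 t h (\<lambda>x. x i) (\<lambda>x. x j)\<bar> \<le> K * e i j"
    and e: "\<And>i. i \<in> I \<Longrightarrow> (\<Sum>j\<in>I. e i j) \<le> S" and K: "K \<ge> 0" "S \<ge> 0"
    and entries: "\<And>i j. i \<in> I \<Longrightarrow> j \<in> I \<Longrightarrow> \<bar>coup i j\<bar> \<le> 1"
    and m: "\<And>i. i \<in> I \<Longrightarrow> real (card {j\<in>I. coup i j \<noteq> 0}) \<le> m"
    and v: "\<And>i. \<bar>v i\<bar> \<le> 1" and j: "j \<in> I"
  shows "\<bar>\<Sum>i\<in>I. coup j i * cum2 t h (dot I v) (\<lambda>x. x i)\<bar> \<le> m * (K * S)"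
proof -
  have row: "\<bar>cum2 t h (dot I v) (\<lambda>x. x i)\<bar> \<le> K * S" if i: "i \<in> I" for i
  proof -
    have "\<bar>cum2 t h (dot I v) (\<lambda>x. x i)\<bar> = \<bar>\<Sum>l\<in>I. v l * cum2 t h (\<lambda>x. x i) (\<lambda>x. x l)\<bar>"
      unfolding cum2_sym[of t h "dot I v"] cum2_dot_right ..
    also have "\<dots> \<le> (\<Sum>l\<in>I. 1 * (K * e i l))"
      by (intro order_trans[OF sum_abs] sum_mono, unfold abs_mult, intro mult_mono v decay i) auto
    also have "\<dots> = K * (\<Sum>l\<in>I. e i l)" by (simp add: sum_distrib_left)
    also have "\<dots> \<le> K * S" by (intro mult_left_mono e i K)
    finally show ?thesis .
  qed
  have KS: "0 \<le> K * S" using K by simp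
  have "\<bar>\<Sum>i\<in>I. coup j i * cum2 t h (dot I v) (\<lambda>x. x i)\<bar> \<le> (\<Sum>i\<in>I. if coup j i \<noteq> 0 then K * S else 0)"
  proof (intro order_trans[OF sum_abs] sum_mono)
    fix i assume i: "i \<in> I"
    have "\<bar>coup j i\<bar> * \<bar>cum2 t h (dot I v) (\<lambda>x. x i)\<bar> \<le> 1 * (K * S)"
      by (intro mult_mono entries row i j) auto
    thus "\<bar>coup j i * cum2 t h (dot I v) (\<lambda>x. x i)\<bar> \<le> (if coup j i \<noteq> 0 then K * S else 0)"
      by (simp add: abs_mult)
  qed
  also have "\<dots> = real (card {i\<in>I. coup j i \<noteq> 0}) * (K * S)" by (simp add: sum.If_cases Int_def)
  also have "\<dots> \<le> m * (K * S)" by (intro mult_right_mono m j KS)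
  finally show ?thesis .
qed

text \<open>The factor \<open>1 / sqrt n\<close> comes from the slot measured in the supremum norm, where the unit vector has
size \<open>1 / sqrt n\<close>; in the two Euclidean slots it has size \<open>1\<close>.\<close>

lemma third_cumulant_unif:
  assumes nonempty: "I \<noteq> {}" and c: "c1 > 0" "c2 > 0"
    and row: "\<And>t h v j. t \<in> {0..1} \<Longrightarrow> (\<And>i. \<bar>v i\<bar> \<le> 1) \<Longrightarrow> j \<in> I \<Longrightarrow>
       \<bar>\<Sum>i\<in>I. coup j i * cum2 t h (dot I v) (\<lambda>x. x i)\<bar> \<le> c1"
    and l2: "\<And>t h u. t \<in> {0..1} \<Longrightarrow> L2_set u I \<le> 1 \<Longrightarrow> (\<And>i. i \<notin> I \<Longrightarrow> u i = 0) \<Longrightarrow>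
       L2_set (\<lambda>j. \<Sum>i\<in>I. coup j i * cum2 t h (dot I u) (\<lambda>x. x i)) I \<le> c2"
  shows "\<bar>cum3 1 h (dot I (unif I)) (dot I (unif I)) (dot I (unif I))\<bar> \<le> 8 * exp (c1 + 2 * c2) / sqrt (card I)"
proof -
  let ?f = "dot I (unif I)"
  have main: "s * sqrt (card I) * cum3 1 h ?f ?f ?f \<le> 8 * exp (c1 + 2 * c2)" if s: "\<bar>s\<bar> = 1" for s
  proof -
    have "card I > 0" using nonempty by (simp add: card_gt_0_iff)
    hence V: "\<bar>s * sqrt (card I) * unif I i\<bar> \<le> 1" for i
      using s by (simp add: unif_def abs_mult)
    have Z: "unif I i = 0" if "i \<notin> I" for i using that by (simp add: unif_def)
    have "cum3 1 h (dot I (\<lambda>i. (s * sqrt (card I)) * unif I i)) ?f ?f \<le> 8 * exp ((c1 + 2 * c2) * 1)"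
      by (rule third_cumulant_bound[OF c row l2])
        (use V Z L2_set_unif[OF finite_I nonempty] in auto)
    thus ?thesis unfolding dot_scale cum3_scale by simp
  qed
  have "sqrt (card I) > 0" using nonempty by (simp add: card_gt_0_iff)
  moreover have "sqrt (card I) * \<bar>cum3 1 h ?f ?f ?f\<bar> \<le> 8 * exp (c1 + 2 * c2)"
    using main[of 1] main[of "-1"] by (cases "cum3 1 h ?f ?f ?f \<ge> 0") auto
  ultimately show ?thesis by (subst pos_le_divide_eq) (simp_all add: mult.commute)
qed

end

theorem uniform_cumulant_estimates:
  fixes r :: nat and \<delta> :: real
  assumes \<delta>: "0 < \<delta>" "\<delta> \<le> 1"
  shows "\<exists>C c. C > 0 \<and> (\<forall>H. c H > 0) \<and> (\<forall>(I :: (int ^ 'd) set) a.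
     ising_flow I a \<longrightarrow> I \<noteq> {} \<longrightarrow> op_norm_on I (ising_flow.coup I a) \<le> 1 - \<delta> \<longrightarrow>
     (\<forall>i\<in>I. \<forall>j\<in>I. lattice_dist i j > int r \<longrightarrow> ising_flow.coup I a i j = 0) \<longrightarrow>
     (\<forall>h. ising_flow.cum2 I a 1 h (dot I (unif I)) (dot I (unif I)) \<le> C
        \<and> \<bar>ising_flow.cum3 I a 1 h (dot I (unif I)) (dot I (unif I)) (dot I (unif I))\<bar> \<le> C / sqrt (card I)
        \<and> (\<forall>H. (\<forall>i\<in>I. \<bar>h i\<bar> \<le> H) \<longrightarrow> c H \<le> ising_flow.cum2 I a 1 h (dot I (unif I)) (dot I (unif I)))))"
proof -
  obtain m :: real where m1: "m \<ge> 1" and m: "\<And>(\<Lambda> :: (int ^ 'd) set) i. finite \<Lambda> \<Longrightarrow>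
     real (card {j\<in>\<Lambda>. lattice_dist i j \<le> int r}) \<le> m"
    using lattice_ball_card_bound[of r, where 'd = 'd] by blast
  \<comment> \<open>Small enough for the conjugation error \<open>(exp (\<theta> * r) - 1) * m\<close> to be at most \<open>\<delta> / 2\<close>.\<close>
  define \<theta> where "\<theta> = ln (1 + \<delta> / (2 * m)) / (real r + 1)"
  have ln0: "ln (1 + \<delta> / (2 * m)) > 0" using \<delta> m1 by (intro ln_gt_zero) simp
  have \<theta>: "\<theta> > 0" using ln0 by (simp add: \<theta>_def)
  have "\<theta> * real r \<le> \<theta> * (real r + 1)" using \<theta> by simp
  also have "\<dots> = ln (1 + \<delta> / (2 * m))" by (simp add: \<theta>_def)
  finally have "exp (\<theta> * real r) \<le> 1 + \<delta> / (2 * m)"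
    using \<delta> m1 by (metis add_pos_pos divide_pos_pos exp_le_cancel_iff exp_ln less_le_trans mult_pos_pos zero_less_numeral zero_less_one)
  hence "(exp (\<theta> * real r) - 1) * m \<le> (\<delta> / (2 * m)) * m" using m1 by (intro mult_right_mono) auto
  also have "\<dots> = \<delta> / 2" using m1 by simp
  finally have \<theta>m: "(exp (\<theta> * real r) - 1) * m \<le> \<delta> / 2" .
  obtain S where S0: "S > 0" and S: "\<And>(\<Lambda> :: (int ^ 'd) set) i. finite \<Lambda> \<Longrightarrow>
      (\<Sum>j\<in>\<Lambda>. exp (- \<theta> * real_of_int (lattice_dist i j))) \<le> S"
    using lattice_sum_bound[OF \<theta>, where 'd = 'd] by blast
  define c1 where "c1 = m * (2 / \<delta> * S)"
  define C where "C = max (1 / \<delta>) (8 * exp (c1 + 2 * (1 / \<delta>)))"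
  define c where "c H = (1 - (tanh (H + m))\<^sup>2)\<^sup>2 / (4 * m)" for H
  show ?thesis
  proof (intro exI[of _ C] exI[of _ c] conjI allI impI)
    show "C > 0" using \<delta> by (simp add: C_def less_max_iff_disj)
    show "c H > 0" for H
    proof -
      have "(tanh (H + m))\<^sup>2 < 1"
        using tanh_real_lt_1[of "H + m"] tanh_real_gt_neg1[of "H + m"] by (simp add: abs_square_less_1)
      thus ?thesis using m1 by (simp add: c_def)
    qed
    fix I :: "(int ^ 'd) set" and a :: "int ^ 'd \<Rightarrow> int ^ 'd \<Rightarrow> real" and h :: "int ^ 'd \<Rightarrow> real"
    assume "ising_flow I a" and ne: "I \<noteq> {}"
    then interpret ising_flow I a by simp
    assume op: "op_norm_on I coup \<le> 1 - \<delta>"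
      and range: "\<forall>i\<in>I. \<forall>j\<in>I. lattice_dist i j > int r \<longrightarrow> coup i j = 0"
    have unif0: "unif I i = 0" if "i \<notin> I" for i using that by (simp add: unif_def)
    have entries: "\<bar>coup i j\<bar> \<le> 1" if "i \<in> I" "j \<in> I" for i j
      using op_norm_on_entry[OF finite_I that, of coup] op \<delta> by linarith
    have nbrs: "real (card {j\<in>I. j = i \<or> coup i j \<noteq> 0}) \<le> m" if i: "i \<in> I" for i
    proof -
      have "card {j\<in>I. j = i \<or> coup i j \<noteq> 0} \<le> card {j\<in>I. lattice_dist i j \<le> int r}"
        using range i by (intro card_mono) (auto simp: not_less[symmetric])
      thus ?thesis using m[OF finite_I, of i] by linarith
    qed
    have nbrs': "real (card {j\<in>I. coup i j \<noteq> 0}) \<le> m" if i: "i \<in> I" for i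
    proof -
      have "card {j\<in>I. coup i j \<noteq> 0} \<le> card {j\<in>I. j = i \<or> coup i j \<noteq> 0}" by (intro card_mono) auto
      thus ?thesis using nbrs[OF i] by linarith
    qed
    have decay: "\<bar>cum2 t h (\<lambda>x. x i) (\<lambda>x. x j)\<bar> \<le> 2 / \<delta> * exp (- \<theta> * real_of_int (lattice_dist i j))"
      if "t \<in> {0..1}" "i \<in> I" "j \<in> I" for t h i j
    proof (rule covariance_decay[where r = "real r" and m = m, OF \<delta> op that(1)])
      show "real (card {j\<in>I. real_of_int (lattice_dist i j) \<le> real r}) \<le> m" for i
        using m[OF finite_I, of i] by (simp add: of_int_le_iff[symmetric, where 'a = real] del: of_int_le_iff)
      show "coup i j = 0" if "i \<in> I" "j \<in> I" "real r < real_of_int (lattice_dist i j)" for i j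
        using range that by (simp add: of_int_less_iff[symmetric, where 'a = real] del: of_int_less_iff)
      show "real_of_int (lattice_dist i l) \<le> real_of_int (lattice_dist i j) + real_of_int (lattice_dist j l)" for i j l
        using lattice_dist_triangle[of i l j] by linarith
    qed (use \<theta> \<theta>m that in \<open>auto simp: lattice_dist_commute\<close>)
    show "cum2 1 h (dot I (unif I)) (dot I (unif I)) \<le> C"
      using covariance_bound[OF \<delta> op, of 1 "unif I" "unif I" h] ne unif0 by (simp add: L2_set_unif C_def)
    have "\<bar>cum3 1 h (dot I (unif I)) (dot I (unif I)) (dot I (unif I))\<bar>
        \<le> 8 * exp (c1 + 2 * (1 / \<delta>)) / sqrt (card I)"
    proof (rule third_cumulant_unif[OF ne])
      show "c1 > 0" "1 / \<delta> > 0" using m1 \<delta> S0 by (auto simp: c1_def)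
      show "\<bar>\<Sum>i\<in>I. coup j i * cum2 t h (dot I v) (\<lambda>x. x i)\<bar> \<le> c1"
        if "t \<in> {0..1}" "\<And>i. \<bar>v i\<bar> \<le> 1" "j \<in> I" for t h v j
        unfolding c1_def
        by (rule row_sum_bound[OF decay[OF that(1)] S[OF finite_I] _ _ entries nbrs' that(2,3)]) (use \<delta> S0 in auto)
      show "L2_set (\<lambda>j. \<Sum>i\<in>I. coup j i * cum2 t h (dot I u) (\<lambda>x. x i)) I \<le> 1 / \<delta>"
        if "t \<in> {0..1}" "L2_set u I \<le> 1" "\<And>i. i \<notin> I \<Longrightarrow> u i = 0" for t h u
        by (rule transported_L2_bound[OF \<delta> op that])
    qed
    also have "\<dots> \<le> C / sqrt (card I)" by (intro divide_right_mono) (auto simp: C_def)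
    finally show "\<bar>cum3 1 h (dot I (unif I)) (dot I (unif I)) (dot I (unif I))\<bar> \<le> C / sqrt (card I)" .
    fix H assume H: "\<forall>i\<in>I. \<bar>h i\<bar> \<le> H"
    have "dot I (\<lambda>_. 1 / sqrt (card I)) = dot I (unif I)" by (simp add: dot_def unif_def fun_eq_iff)
    thus "c H \<le> cum2 1 h (dot I (unif I)) (dot I (unif I))"
      using variance_lower_bound[OF ne entries nbrs, of h H] H by (simp add: c_def)
  qed
qed

section \<open>From moment generating functions to characteristic functions\<close>

lemma not_tendsto_imp_subseq:
  fixes X :: "nat \<Rightarrow> 'a :: metric_space"
  assumes "\<not> X \<longlonglongrightarrow> L"
  obtains e r where "e > 0" "strict_mono (r :: nat \<Rightarrow> nat)" "\<And>k. dist (X (r k)) L \<ge> e"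
proof -
  obtain e where e: "e > 0" "\<not> (\<forall>\<^sub>F n in sequentially. dist (X n) L < e)"
    using assms unfolding tendsto_iff by blast
  hence "infinite {n. dist (X n) L \<ge> e}"
    by (simp add: not_eventually cofinite_eq_sequentially[symmetric] frequently_cofinite not_less)
  from infinite_enumerate[OF this] e(1) that show ?thesis by auto
qed

text \<open>On a strip \<open>\<bar>Re z\<bar> \<le> R\<close> the transform at \<open>z\<close> is bounded by its values at \<open>R\<close> and \<open>- R\<close>, which converge.
So the transforms form a normal family of entire functions, and every limit function agrees with
\<open>exp (z\<^sup>2 / 2)\<close> on the real axis, hence everywhere, in particular on the imaginary axis.\<close>

lemma finite_mgf_tendsto_imp_char_tendsto:
  fixes p y :: "nat \<Rightarrow> 'a \<Rightarrow> real"
  assumes fin: "\<And>n. finite (S n)" and p: "\<And>n x. x \<in> S n \<Longrightarrow> p n x \<ge> 0"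
    and mgf: "\<And>s. (\<lambda>n. \<Sum>x\<in>S n. p n x * exp (s * y n x)) \<longlonglongrightarrow> exp (s\<^sup>2 / 2)"
  shows "(\<lambda>n. \<Sum>x\<in>S n. complex_of_real (p n x) * exp (\<i> * complex_of_real (t * y n x)))
    \<longlonglongrightarrow> complex_of_real (exp (- t\<^sup>2 / 2))"
proof -
  define \<phi> where "\<phi> n z = (\<Sum>x\<in>S n. complex_of_real (p n x) * exp (z * complex_of_real (y n x)))" for n z
  define \<psi> where "\<psi> n s = (\<Sum>x\<in>S n. p n x * exp (s * y n x))" for n s
  have real: "\<phi> n (of_real s) = of_real (\<psi> n s)" for n s
    unfolding \<phi>_def \<psi>_def by (simp only: of_real_mult[symmetric] exp_of_real of_real_sum[symmetric])
  have hol: "\<phi> n holomorphic_on UNIV" for n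
    unfolding \<phi>_def by (intro holomorphic_intros)
  have bound: "norm (\<phi> n z) \<le> \<psi> n R + \<psi> n (- R)" if "norm z \<le> R" for n z R
  proof -
    have "norm (\<phi> n z) \<le> (\<Sum>x\<in>S n. norm (complex_of_real (p n x) * exp (z * complex_of_real (y n x))))"
      unfolding \<phi>_def by (rule norm_sum)
    also have "\<dots> \<le> (\<Sum>x\<in>S n. p n x * exp (R * y n x) + p n x * exp (- R * y n x))"
    proof (rule sum_mono)
      fix x assume x: "x \<in> S n"
      have "\<bar>Re z\<bar> \<le> R" using that abs_Re_le_cmod[of z] by linarith
      hence "\<bar>Re z * y n x\<bar> \<le> R * \<bar>y n x\<bar>" by (simp add: abs_mult mult_right_mono)
      hence "Re z * y n x \<le> R * \<bar>y n x\<bar>" by linarith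
      hence "Re z * y n x \<le> R * y n x \<or> Re z * y n x \<le> - R * y n x" by (cases "y n x \<ge> 0") auto
      hence "exp (Re z * y n x) \<le> exp (R * y n x) + exp (- R * y n x)"
        by (smt (verit) exp_le_cancel_iff exp_gt_zero)
      hence "p n x * exp (Re z * y n x) \<le> p n x * (exp (R * y n x) + exp (- R * y n x))"
        by (rule mult_left_mono) (rule p[OF x])
      thus "norm (complex_of_real (p n x) * exp (z * complex_of_real (y n x)))
          \<le> p n x * exp (R * y n x) + p n x * exp (- R * y n x)"
        using p[OF x] by (simp add: norm_mult norm_exp_eq_Re distrib_left)
    qed
    finally show ?thesis by (simp add: \<psi>_def sum.distrib)
  qed
  have bdd: "\<exists>B. \<forall>n z. norm z \<le> R \<longrightarrow> norm (\<phi> n z) \<le> B" for R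
  proof -
    have "(\<lambda>n. \<psi> n R + \<psi> n (- R)) \<longlonglongrightarrow> exp (R\<^sup>2 / 2) + exp ((- R)\<^sup>2 / 2)"
      unfolding \<psi>_def by (intro tendsto_add mgf)
    hence "Bseq (\<lambda>n. \<psi> n R + \<psi> n (- R))"
      by (rule convergent_imp_Bseq[OF convergentI])
    then obtain B where "\<And>n. norm (\<psi> n R + \<psi> n (- R)) \<le> B" unfolding Bseq_def by blast
    hence "norm (\<phi> n z) \<le> B" if "norm z \<le> R" for n z
      using bound[OF that, of n] by (smt (verit) real_norm_def)
    thus ?thesis by blast
  qed
  have "(\<lambda>n. \<phi> n (\<i> * of_real t)) \<longlonglongrightarrow> exp ((\<i> * of_real t)\<^sup>2 / 2)"
  proof (rule ccontr)
    assume "\<not> ?thesis"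
    then obtain e r where e: "e > 0" and r: "strict_mono (r :: nat \<Rightarrow> nat)"
      and far: "\<And>k. dist (\<phi> (r k) (\<i> * of_real t)) (exp ((\<i> * of_real t)\<^sup>2 / 2)) \<ge> e"
      using not_tendsto_imp_subseq by blast
    obtain g r' where g: "g holomorphic_on UNIV" and r': "strict_mono (r' :: nat \<Rightarrow> nat)"
      and lim: "\<And>z. z \<in> UNIV \<Longrightarrow> (\<lambda>k. \<phi> (r (r' k)) z) \<longlonglongrightarrow> g z"
    proof (rule Montel[of UNIV "range (\<lambda>k. \<phi> (r k))" "\<lambda>k. \<phi> (r k)"])
      fix K :: "complex set" assume "compact K"
      then obtain R where R: "\<And>z. z \<in> K \<Longrightarrow> norm z \<le> R"
        using compact_imp_bounded bounded_iff by metis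
      obtain B where "\<And>n z. norm z \<le> R \<Longrightarrow> norm (\<phi> n z) \<le> B" using bdd[of R] by blast
      thus "\<exists>B. \<forall>h\<in>range (\<lambda>k. \<phi> (r k)). \<forall>z\<in>K. norm (h z) \<le> B" using R by blast
    qed (use hol in auto)
    have on_reals: "g z - exp (z\<^sup>2 / 2) = 0" if zR: "z \<in> \<real>" for z
    proof -
      obtain s where z: "z = of_real s" using zR by (auto elim: Reals_cases)
      have "(\<lambda>k. \<psi> (r (r' k)) s) \<longlonglongrightarrow> exp (s\<^sup>2 / 2)"
        using LIMSEQ_subseq_LIMSEQ[OF LIMSEQ_subseq_LIMSEQ[OF mgf[of s] r] r'] by (simp add: o_def \<psi>_def)
      hence "(\<lambda>k. \<phi> (r (r' k)) z) \<longlonglongrightarrow> of_real (exp (s\<^sup>2 / 2))"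
        unfolding z real by (rule tendsto_of_real)
      hence "g z = of_real (exp (s\<^sup>2 / 2))" using lim[of z] LIMSEQ_unique by blast
      moreover have "exp (z\<^sup>2 / 2) = of_real (exp (s\<^sup>2 / 2))"
        unfolding z by (simp flip: exp_of_real)
      ultimately show ?thesis by simp
    qed
    have "g (\<i> * of_real t) - exp ((\<i> * of_real t)\<^sup>2 / 2) = 0"
    proof (rule analytic_continuation[of "\<lambda>z. g z - exp (z\<^sup>2 / 2)" UNIV \<real> 0])
      show "(0::complex) islimpt \<real>"
        unfolding islimpt_approachable
      proof (intro allI impI)
        fix e :: real assume "e > 0"
        thus "\<exists>x'\<in>\<real>. x' \<noteq> 0 \<and> dist x' (0::complex) < e"
          by (intro bexI[of _ "of_real (e / 2)"]) auto
      qed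
    qed (use g on_reals in \<open>auto intro!: holomorphic_intros\<close>)
    hence "(\<lambda>k. \<phi> (r (r' k)) (\<i> * of_real t)) \<longlonglongrightarrow> exp ((\<i> * of_real t)\<^sup>2 / 2)"
      using lim[of "\<i> * of_real t"] by simp
    from tendstoD[OF this e] show False
      using far by (auto simp: eventually_sequentially not_less[symmetric])
  qed
  moreover have "exp ((\<i> * of_real t)\<^sup>2 / 2) = complex_of_real (exp (- t\<^sup>2 / 2))"
    by (simp add: power_mult_distrib flip: exp_of_real)
  ultimately show ?thesis unfolding \<phi>_def by (simp add: mult.assoc)
qed

section \<open>Bounds for the Wasserstein distance\<close>

lemma ennreal_sqrt_mono: "x \<le> y \<Longrightarrow> ennreal_sqrt x \<le> ennreal_sqrt y"
  by (cases x; cases y) (auto simp: ennreal_sqrt_def top_unique enn2real_mono)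

lemma ennreal_sqrt_ennreal: "x \<ge> 0 \<Longrightarrow> ennreal_sqrt (ennreal x) = ennreal (sqrt x)"
  by (simp add: ennreal_sqrt_def)

lemma wasserstein2_le:
  assumes "\<gamma> \<in> couplings \<mu> \<nu>" "(\<integral>\<^sup>+ p. ennreal (\<bar>fst p - snd p\<bar>\<^sup>2) \<partial>\<gamma>) \<le> ennreal c" "c \<ge> 0"
  shows "wasserstein2 \<mu> \<nu> \<le> ennreal (sqrt c)"
proof -
  have "(INF \<gamma>\<in>couplings \<mu> \<nu>. \<integral>\<^sup>+ p. ennreal (\<bar>fst p - snd p\<bar>\<^sup>2) \<partial>\<gamma>) \<le> ennreal c"
    by (rule INF_lower2[OF assms(1)]) (rule assms(2))
  from ennreal_sqrt_mono[OF this] show ?thesis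
    unfolding wasserstein2_def by (simp add: ennreal_sqrt_ennreal assms(3))
qed

lemma distr_pair_snd_prob:
  assumes "prob_space M" "prob_space N"
  shows "distr (M \<Otimes>\<^sub>M N) N snd = N"
proof (rule measure_eqI)
  interpret M: prob_space M by fact
  interpret N: prob_space N by fact
  fix A assume "A \<in> sets (distr (M \<Otimes>\<^sub>M N) N snd)"
  hence A: "A \<in> sets N" by simp
  have "snd -` A \<inter> space (M \<Otimes>\<^sub>M N) = space M \<times> A"
    using sets.sets_into_space[OF A] by (auto simp: space_pair_measure)
  thus "emeasure (distr (M \<Otimes>\<^sub>M N) N snd) A = emeasure N A"
    using A by (simp add: emeasure_distr N.emeasure_pair_measure_Times M.emeasure_space_1)
qed simp

text \<open>Any coupling will do, as both variables are close to \<open>m\<close>; the independent one always exists.\<close>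

lemma wasserstein2_le_second_moments:
  assumes \<mu>: "prob_space \<mu>" "sets \<mu> = sets borel" and \<nu>: "prob_space \<nu>" "sets \<nu> = sets borel"
    and v: "v \<ge> 0" "(\<integral>\<^sup>+ x. ennreal ((x - m)\<^sup>2) \<partial>\<mu>) \<le> ennreal v" "(\<integral>\<^sup>+ x. ennreal ((x - m)\<^sup>2) \<partial>\<nu>) \<le> ennreal v"
  shows "wasserstein2 \<mu> \<nu> \<le> ennreal (2 * sqrt v)"
proof -
  interpret \<mu>: prob_space \<mu> by (rule \<mu>(1))
  interpret \<nu>: prob_space \<nu> by (rule \<nu>(1))
  interpret P: pair_prob_space \<mu> \<nu> ..
  let ?\<gamma> = "\<mu> \<Otimes>\<^sub>M \<nu>"
  have sets: "sets ?\<gamma> = sets (borel \<Otimes>\<^sub>M borel)"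
    by (rule sets_pair_measure_cong[OF \<mu>(2) \<nu>(2)])
  have m1: "distr ?\<gamma> borel fst = \<mu>"
    using \<nu>.distr_pair_fst[of \<mu>] distr_cong[OF refl \<mu>(2), of ?\<gamma> fst fst] by simp
  have m2: "distr ?\<gamma> borel snd = \<nu>"
    using distr_pair_snd_prob[OF \<mu>(1) \<nu>(1)] distr_cong[OF refl \<nu>(2), of ?\<gamma> snd snd] by simp
  have mem: "?\<gamma> \<in> couplings \<mu> \<nu>"
    unfolding couplings_def using sets m1 m2 P.prob_space_axioms by simp
  have f: "fst \<in> measurable ?\<gamma> borel" "snd \<in> measurable ?\<gamma> borel"
    by (simp_all add: measurable_cong_sets[OF sets refl])
  have "(\<integral>\<^sup>+ p. ennreal (\<bar>fst p - snd p\<bar>\<^sup>2) \<partial>?\<gamma>)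
      \<le> (\<integral>\<^sup>+ p. 2 * ennreal ((fst p - m)\<^sup>2) + 2 * ennreal ((snd p - m)\<^sup>2) \<partial>?\<gamma>)"
  proof (rule nn_integral_mono)
    fix p :: "real \<times> real"
    have "0 \<le> ((fst p - m) + (snd p - m))\<^sup>2" by simp
    hence "\<bar>fst p - snd p\<bar>\<^sup>2 \<le> 2 * (fst p - m)\<^sup>2 + 2 * (snd p - m)\<^sup>2"
      by (simp add: power2_eq_square algebra_simps)
    hence "ennreal (\<bar>fst p - snd p\<bar>\<^sup>2) \<le> ennreal (2 * (fst p - m)\<^sup>2 + 2 * (snd p - m)\<^sup>2)"
      by (rule ennreal_leI)
    thus "ennreal (\<bar>fst p - snd p\<bar>\<^sup>2) \<le> 2 * ennreal ((fst p - m)\<^sup>2) + 2 * ennreal ((snd p - m)\<^sup>2)"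
      by (simp add: ennreal_mult' ennreal_plus)
  qed
  also have "\<dots> = 2 * (\<integral>\<^sup>+ p. ennreal ((fst p - m)\<^sup>2) \<partial>?\<gamma>) + 2 * (\<integral>\<^sup>+ p. ennreal ((snd p - m)\<^sup>2) \<partial>?\<gamma>)"
    using f by (simp add: nn_integral_add nn_integral_cmult)
  also have "(\<integral>\<^sup>+ p. ennreal ((fst p - m)\<^sup>2) \<partial>?\<gamma>) = (\<integral>\<^sup>+ x. ennreal ((x - m)\<^sup>2) \<partial>\<mu>)"
    by (subst (2) m1[symmetric]) (rule nn_integral_distr[symmetric, OF f(1)], measurable)
  also have "(\<integral>\<^sup>+ p. ennreal ((snd p - m)\<^sup>2) \<partial>?\<gamma>) = (\<integral>\<^sup>+ x. ennreal ((x - m)\<^sup>2) \<partial>\<nu>)"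
    by (subst (2) m2[symmetric]) (rule nn_integral_distr[symmetric, OF f(2)], measurable)
  also have "2 * (\<integral>\<^sup>+ x. ennreal ((x - m)\<^sup>2) \<partial>\<mu>) + 2 * (\<integral>\<^sup>+ x. ennreal ((x - m)\<^sup>2) \<partial>\<nu>)
      \<le> 2 * ennreal v + 2 * ennreal v"
    by (intro add_mono mult_left_mono v) auto
  also have "\<dots> = ennreal (4 * v)"
    using v(1) by (simp add: ennreal_mult' flip: distrib_right)
  finally have "wasserstein2 \<mu> \<nu> \<le> ennreal (sqrt (4 * v))"
    by (rule wasserstein2_le[OF mem]) (use v in simp)
  thus ?thesis by (simp add: real_sqrt_mult)
qed

lemma distr_affine_std_normal:
  assumes "s > 0"
  shows "distr std_normal_distribution borel (\<lambda>x. m + s * x) = normal_law m (s\<^sup>2)"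
proof -
  interpret N: prob_space std_normal_distribution
    by (rule prob_space_normal_density) simp
  have "distributed std_normal_distribution lborel (\<lambda>x. x) (normal_density 0 1)"
    unfolding distributed_def by (auto simp: distr_id2 cong: distr_cong)
  from N.normal_density_affine[OF this, of s m] assms
  have "distributed std_normal_distribution lborel (\<lambda>x. m + s * x) (normal_density m s)" by simp
  from distributed_distr_eq_density[OF this]
  have "distr std_normal_distribution lborel (\<lambda>x. m + s * x) = density lborel (normal_density m s)" .
  moreover have "distr std_normal_distribution lborel (\<lambda>x. m + s * x) = distr std_normal_distribution borel (\<lambda>x. m + s * x)"
    by (rule distr_cong) auto
  ultimately show ?thesis using assms by (simp add: normal_law_def)
qed

lemma prob_space_normal_law: "v \<ge> 0 \<Longrightarrow> prob_space (normal_law m v)"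
  by (cases "v = 0") (auto simp: normal_law_def prob_space_return prob_space_normal_density)

lemma sets_normal_law: "sets (normal_law m v) = sets borel"
  by (simp add: normal_law_def)

lemma std_normal_second_moment:
  "integrable std_normal_distribution (\<lambda>x. x\<^sup>2)" "(\<integral>x. x\<^sup>2 \<partial>std_normal_distribution) = 1"
  using integrable_std_normal_distribution_moment[of 2] std_normal_distribution_even_moments(1)[of 1]
  by (simp_all add: power2_eq_square eval_nat_numeral)

lemma normal_law_second_moment:
  assumes "v \<ge> 0"
  shows "(\<integral>\<^sup>+ x. ennreal ((x - m)\<^sup>2) \<partial>normal_law m v) = ennreal v"
proof (cases "v = 0")
  case True
  have "(\<integral>\<^sup>+ x. ennreal ((x - m)\<^sup>2) \<partial>return borel m) = ennreal ((m - m)\<^sup>2)"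
    by (rule nn_integral_return) auto
  thus ?thesis using True by (simp add: normal_law_def)
next
  case False
  define s where "s = sqrt v"
  have s: "s > 0" "v = s\<^sup>2" using False assms by (auto simp: s_def)
  have "(\<integral>\<^sup>+ x. ennreal ((x - m)\<^sup>2) \<partial>normal_law m v)
      = (\<integral>\<^sup>+ x. ennreal ((m + s * x - m)\<^sup>2) \<partial>std_normal_distribution)"
    unfolding s(2) distr_affine_std_normal[OF s(1), symmetric] by (rule nn_integral_distr) auto
  also have "\<dots> = (\<integral>\<^sup>+ x. ennreal (s\<^sup>2 * x\<^sup>2) \<partial>std_normal_distribution)"
    by (simp add: power_mult_distrib)
  also have "\<dots> = ennreal (\<integral>x. s\<^sup>2 * x\<^sup>2 \<partial>std_normal_distribution)"
    by (rule nn_integral_eq_integral) (use std_normal_second_moment in auto)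
  finally show ?thesis using s by (simp add: std_normal_second_moment)
qed

text \<open>For Skorohod representatives \<open>Y\<^sub>k\<close> converging pointwise to \<open>Y\<close>, all of second moment \<open>1\<close>, Fatou's lemma
for \<open>2 * Y\<^sub>k\<^sup>2 + 2 * Y\<^sup>2 - (Y\<^sub>k - Y)\<^sup>2 \<ge> 0\<close> shows that the mean square of \<open>Y\<^sub>k - Y\<close> tends to \<open>0\<close>.
Rescaling both variables couples the two given laws.\<close>

lemma wasserstein2_affine_tendsto_0:
  assumes \<nu>: "\<And>k. real_distribution (\<nu> k)" and weak: "weak_conv_m \<nu> std_normal_distribution"
    and second: "\<And>k. integrable (\<nu> k) (\<lambda>x. x\<^sup>2)" "\<And>k. (\<integral>x. x\<^sup>2 \<partial>\<nu> k) = 1"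
    and s: "\<And>k. 0 < s k" "\<And>k. s k \<le> B"
  shows "(\<lambda>k. wasserstein2 (distr (\<nu> k) borel (\<lambda>x. m k + s k * x)) (normal_law (m k) ((s k)\<^sup>2))) \<longlonglongrightarrow> 0"
proof -
  obtain \<Omega> :: "real measure" and Y' :: "nat \<Rightarrow> real \<Rightarrow> real" and Y :: "real \<Rightarrow> real"
    where \<Omega>: "prob_space \<Omega>" and Y'm: "\<And>k. Y' k \<in> borel_measurable \<Omega>"
      and Y'd: "\<And>k. distr \<Omega> borel (Y' k) = \<nu> k"
      and Ym0: "Y \<in> measurable \<Omega> lborel" and Yd: "distr \<Omega> borel Y = std_normal_distribution"
      and lim: "\<And>\<omega>. \<omega> \<in> space \<Omega> \<Longrightarrow> (\<lambda>k. Y' k \<omega>) \<longlonglongrightarrow> Y \<omega>"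
    using Skorohod[OF \<nu> real_dist_normal_dist weak] by blast
  interpret prob_space \<Omega> by (rule \<Omega>)
  have Ym: "Y \<in> borel_measurable \<Omega>" using Ym0 by simp
  note [measurable] = Y'm Ym
  have Y'2: "integrable \<Omega> (\<lambda>\<omega>. (Y' k \<omega>)\<^sup>2)" "(\<integral>\<omega>. (Y' k \<omega>)\<^sup>2 \<partial>\<Omega>) = 1" for k
    using second[of k] unfolding Y'd[symmetric] by (simp_all add: integrable_distr_eq integral_distr)
  have Y2: "integrable \<Omega> (\<lambda>\<omega>. (Y \<omega>)\<^sup>2)" "(\<integral>\<omega>. (Y \<omega>)\<^sup>2 \<partial>\<Omega>) = 1"
    using std_normal_second_moment unfolding Yd[symmetric] by (simp_all add: integrable_distr_eq integral_distr)
  define a where "a k = (\<integral>\<omega>. (Y' k \<omega> - Y \<omega>)\<^sup>2 \<partial>\<Omega>)" for k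
  define u where "u k \<omega> = 2 * (Y' k \<omega>)\<^sup>2 + 2 * (Y \<omega>)\<^sup>2 - (Y' k \<omega> - Y \<omega>)\<^sup>2" for k \<omega>
  have u_nonneg: "u k \<omega> \<ge> 0" for k \<omega>
  proof -
    have "u k \<omega> = (Y' k \<omega> + Y \<omega>)\<^sup>2" by (simp add: u_def power2_eq_square algebra_simps)
    thus ?thesis by simp
  qed
  have dint: "integrable \<Omega> (\<lambda>\<omega>. (Y' k \<omega> - Y \<omega>)\<^sup>2)" for k
  proof (rule Bochner_Integration.integrable_bound)
    show "integrable \<Omega> (\<lambda>\<omega>. 2 * (Y' k \<omega>)\<^sup>2 + 2 * (Y \<omega>)\<^sup>2)" using Y'2 Y2 by auto
    show "AE \<omega> in \<Omega>. norm ((Y' k \<omega> - Y \<omega>)\<^sup>2) \<le> norm (2 * (Y' k \<omega>)\<^sup>2 + 2 * (Y \<omega>)\<^sup>2)"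
    proof (rule AE_I2)
      fix \<omega>
      have "(Y' k \<omega> - Y \<omega>)\<^sup>2 \<le> 2 * (Y' k \<omega>)\<^sup>2 + 2 * (Y \<omega>)\<^sup>2" using u_nonneg[of k \<omega>] by (simp add: u_def)
      thus "norm ((Y' k \<omega> - Y \<omega>)\<^sup>2) \<le> norm (2 * (Y' k \<omega>)\<^sup>2 + 2 * (Y \<omega>)\<^sup>2)" by simp
    qed
  qed simp
  have a_nonneg: "a k \<ge> 0" for k unfolding a_def by simp
  have uint: "(\<integral>\<^sup>+ \<omega>. ennreal (u k \<omega>) \<partial>\<Omega>) = ennreal (4 - a k)" for k
  proof -
    have "(\<integral>\<^sup>+ \<omega>. ennreal (u k \<omega>) \<partial>\<Omega>) = ennreal (\<integral>\<omega>. u k \<omega> \<partial>\<Omega>)"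
      by (rule nn_integral_eq_integral) (use Y'2 Y2 dint u_nonneg in \<open>auto simp: u_def\<close>)
    also have "(\<integral>\<omega>. u k \<omega> \<partial>\<Omega>) = 4 - a k"
      unfolding u_def using Y'2[of k] Y2 dint[of k] by (simp add: a_def)
    finally show ?thesis .
  qed
  have "(\<integral>\<^sup>+ \<omega>. liminf (\<lambda>k. ennreal (u k \<omega>)) \<partial>\<Omega>) \<le> liminf (\<lambda>k. \<integral>\<^sup>+ \<omega>. ennreal (u k \<omega>) \<partial>\<Omega>)"
    by (rule nn_integral_liminf) (simp add: u_def)
  also have "(\<integral>\<^sup>+ \<omega>. liminf (\<lambda>k. ennreal (u k \<omega>)) \<partial>\<Omega>) = (\<integral>\<^sup>+ \<omega>. ennreal (4 * (Y \<omega>)\<^sup>2) \<partial>\<Omega>)"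
  proof (rule nn_integral_cong)
    fix \<omega> assume "\<omega> \<in> space \<Omega>"
    hence "(\<lambda>k. u k \<omega>) \<longlonglongrightarrow> 2 * (Y \<omega>)\<^sup>2 + 2 * (Y \<omega>)\<^sup>2 - (Y \<omega> - Y \<omega>)\<^sup>2"
      unfolding u_def by (intro tendsto_intros lim)
    hence "(\<lambda>k. ennreal (u k \<omega>)) \<longlonglongrightarrow> ennreal (4 * (Y \<omega>)\<^sup>2)" by (intro tendsto_ennrealI) simp
    thus "liminf (\<lambda>k. ennreal (u k \<omega>)) = ennreal (4 * (Y \<omega>)\<^sup>2)" by (intro lim_imp_Liminf) auto
  qed
  also have "\<dots> = ennreal 4"
    using nn_integral_eq_integral[of \<Omega> "\<lambda>\<omega>. 4 * (Y \<omega>)\<^sup>2"] Y2 by simp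
  finally have fatou: "ennreal 4 \<le> liminf (\<lambda>k. ennreal (4 - a k))" unfolding uint .
  have a_lim: "a \<longlonglongrightarrow> 0"
  proof (rule order_tendstoI)
    fix e :: real assume e: "0 < e"
    \<comment> \<open>The minimum keeps \<open>4 - e'\<close> nonnegative, where the embedding into \<open>ennreal\<close> is faithful.\<close>
    define e' where "e' = min e 1"
    have "ennreal (4 - e') < ennreal 4" using e by (simp add: e'_def ennreal_less_iff)
    also note fatou
    finally have "\<forall>\<^sub>F k in sequentially. ennreal (4 - e') < ennreal (4 - a k)" by (rule less_LiminfD)
    thus "\<forall>\<^sub>F k in sequentially. a k < e"
    proof eventually_elim
      case (elim k)
      hence "4 - e' < 4 - a k" using e by (subst (asm) ennreal_less_iff) (auto simp: e'_def)
      thus ?case by (simp add: e'_def)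
    qed
  next
    fix e :: real assume "e < 0"
    hence "e < a k" for k using a_nonneg[of k] by linarith
    thus "\<forall>\<^sub>F k in sequentially. e < a k" by simp
  qed
  have W: "wasserstein2 (distr (\<nu> k) borel (\<lambda>x. m k + s k * x)) (normal_law (m k) ((s k)\<^sup>2))
      \<le> ennreal (sqrt (B\<^sup>2 * a k))" for k
  proof (rule wasserstein2_le)
    let ?f = "\<lambda>\<omega>. (m k + s k * Y' k \<omega>, m k + s k * Y \<omega>)"
    let ?\<gamma> = "distr \<Omega> (borel \<Otimes>\<^sub>M borel) ?f"
    have fm: "?f \<in> measurable \<Omega> (borel \<Otimes>\<^sub>M borel)" by measurable
    have 1: "distr ?\<gamma> borel fst = distr (\<nu> k) borel (\<lambda>x. m k + s k * x)"
      unfolding Y'd[symmetric] by (subst (1 2) distr_distr) (auto simp: o_def)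
    have 2: "distr ?\<gamma> borel snd = normal_law (m k) ((s k)\<^sup>2)"
      unfolding distr_affine_std_normal[OF s(1), symmetric] Yd[symmetric]
      by (subst (1 2) distr_distr) (auto simp: o_def)
    show "?\<gamma> \<in> couplings (distr (\<nu> k) borel (\<lambda>x. m k + s k * x)) (normal_law (m k) ((s k)\<^sup>2))"
      unfolding couplings_def using 1 2 prob_space_distr[OF fm] by simp
    have "(\<integral>\<^sup>+ p. ennreal (\<bar>fst p - snd p\<bar>\<^sup>2) \<partial>?\<gamma>) = (\<integral>\<^sup>+ \<omega>. ennreal ((s k)\<^sup>2 * (Y' k \<omega> - Y \<omega>)\<^sup>2) \<partial>\<Omega>)"
      by (subst nn_integral_distr[OF fm]) (auto intro!: nn_integral_cong simp: algebra_simps power2_eq_square)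
    also have "\<dots> = ennreal (\<integral>\<omega>. (s k)\<^sup>2 * (Y' k \<omega> - Y \<omega>)\<^sup>2 \<partial>\<Omega>)"
      by (rule nn_integral_eq_integral) (use dint in auto)
    also have "\<dots> = ennreal ((s k)\<^sup>2 * a k)" by (simp add: a_def)
    also have "\<dots> \<le> ennreal (B\<^sup>2 * a k)"
      using s[of k] a_nonneg[of k] by (intro ennreal_leI mult_right_mono power_mono) auto
    finally show "(\<integral>\<^sup>+ p. ennreal (\<bar>fst p - snd p\<bar>\<^sup>2) \<partial>?\<gamma>) \<le> ennreal (B\<^sup>2 * a k)" .
    show "0 \<le> B\<^sup>2 * a k" using a_nonneg by simp
  qed
  have "(\<lambda>k. ennreal (sqrt (B\<^sup>2 * a k))) \<longlonglongrightarrow> ennreal (sqrt (B\<^sup>2 * 0))"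
    by (intro tendsto_ennrealI tendsto_intros a_lim)
  hence "(\<lambda>k. ennreal (sqrt (B\<^sup>2 * a k))) \<longlonglongrightarrow> 0" by simp
  thus ?thesis
    by (rule tendsto_sandwich[of "\<lambda>_. 0", rotated 3]) (use W in auto)
qed

section \<open>The Ising magnetisation\<close>

context ising_flow begin

lemma mean_exp_dot: "mean t h (\<lambda>x. exp (s * dot I d x)) = part t (tilt h s d) / part t h"
  unfolding mean_def part_def weight_def dot_tilt
  by (intro arg_cong2[of _ _ _ _ "(/)"] sum.cong refl) (simp flip: exp_add add: algebra_simps)

lemma ln_part_deriv_field:
  "((\<lambda>s. ln (part t (tilt h s d))) has_real_derivative mean t (tilt h s d) (dot I d)) (at s)"
proof -
  have "((\<lambda>s. part t (tilt h s d)) has_real_derivative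
      (\<Sum>x\<in>spin_configs I. dot I d x * weight t (tilt h s d) x)) (at s)"
    unfolding part_def by (rule DERIV_sum) (rule weight_deriv_field)
  from DERIV_chain2[OF DERIV_ln[OF part_pos] this] show ?thesis
    by (rule DERIV_cong) (simp add: mean_def divide_inverse mult.commute)
qed

lemma mean_deriv_field_dot:
  "((\<lambda>s. mean t (tilt h s d) (dot I d)) has_real_derivative
     cum2 t (tilt h s d) (dot I d) (dot I d)) (at s)"
  using mean_deriv_field[of t h d "dot I d" s] unfolding cum2_def .

text \<open>Along the line of fields \<open>h + s * d\<close>, the logarithm of the partition sum has as derivatives the mean,
variance and third cumulant of the linear form of \<open>d\<close>, so the third-order Taylor remainder is
controlled by the third cumulant at other fields. This is why the cumulant bounds are needed
uniformly in \<open>h\<close>.\<close>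

lemma centered_mgf_taylor:
  assumes K: "\<And>h. \<bar>cum3 t h (dot I d) (dot I d) (dot I d)\<bar> \<le> K"
  shows "\<exists>e. \<bar>e\<bar> \<le> K * \<bar>s\<bar> ^ 3 / 6 \<and>
    mean t h (\<lambda>x. exp (s * (dot I d x - mean t h (dot I d)))) = exp (s\<^sup>2 / 2 * cum2 t h (dot I d) (dot I d) + e)"
proof -
  let ?D = "dot I d"
  define diff where "diff m s = (if m = 0 then ln (part t (tilt h s d)) else if m = 1 then mean t (tilt h s d) ?D
    else if m = 2 then cum2 t (tilt h s d) ?D ?D else cum3 t (tilt h s d) ?D ?D ?D)" for m :: nat and s
  have "\<exists>u. \<bar>u\<bar> \<le> \<bar>s\<bar> \<and> diff 0 s = (\<Sum>m<3. diff m 0 / fact m * s ^ m) + diff 3 u / fact 3 * s ^ 3"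
  proof (rule Maclaurin_bi_le; (intro allI impI)?)
    fix m u assume "m < (3::nat) \<and> \<bar>u\<bar> \<le> \<bar>s\<bar>"
    then consider "m = 0" | "m = 1" | "m = 2" by linarith
    thus "(diff m has_real_derivative diff (Suc m) u) (at u)"
    proof cases
      case 1 thus ?thesis using ln_part_deriv_field[of t h d u] by (simp add: diff_def[abs_def])
    next
      case 2 thus ?thesis using mean_deriv_field_dot[of t h d u] by (simp add: diff_def[abs_def])
    next
      case 3 thus ?thesis using cum2_deriv_field[of t h d ?D ?D u] by (simp add: diff_def[abs_def])
    qed
  qed (simp add: diff_def[abs_def])
  then obtain u where u: "diff 0 s = (\<Sum>m<3. diff m 0 / fact m * s ^ m) + diff 3 u / fact 3 * s ^ 3" by blast
  define e where "e = cum3 t (tilt h u d) ?D ?D ?D / 6 * s ^ 3"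
  have "(\<Sum>m<3. diff m 0 / fact m * s ^ m) = ln (part t h) + mean t h ?D * s + cum2 t h ?D ?D / 2 * s\<^sup>2"
    by (simp add: diff_def eval_nat_numeral)
  moreover have "diff 3 u / fact 3 * s ^ 3 = e" by (simp add: diff_def e_def eval_nat_numeral)
  ultimately have ln: "ln (part t (tilt h s d)) = ln (part t h) + mean t h ?D * s + cum2 t h ?D ?D / 2 * s\<^sup>2 + e"
    using u by (simp add: diff_def)
  have "mean t h (\<lambda>x. exp (s * (?D x - mean t h ?D))) = exp (- s * mean t h ?D) * mean t h (\<lambda>x. exp (s * ?D x))"
  proof -
    have "exp (s * (?D x - mean t h ?D)) = exp (- s * mean t h ?D) * exp (s * ?D x)" for x
      by (simp add: algebra_simps flip: exp_add)
    thus ?thesis by (simp only: mean_cmult)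
  qed
  also have "mean t h (\<lambda>x. exp (s * ?D x)) = exp (ln (part t (tilt h s d)) - ln (part t h))"
    unfolding mean_exp_dot exp_diff using part_pos[of t h] part_pos[of t "tilt h s d"] by simp
  also have "exp (- s * mean t h ?D) * \<dots> = exp (s\<^sup>2 / 2 * cum2 t h ?D ?D + e)"
    unfolding ln by (simp add: algebra_simps flip: exp_add)
  finally have "mean t h (\<lambda>x. exp (s * (?D x - mean t h ?D))) = exp (s\<^sup>2 / 2 * cum2 t h ?D ?D + e)" .
  moreover have "\<bar>e\<bar> \<le> K * \<bar>s\<bar> ^ 3 / 6"
    using mult_right_mono[OF K[of "tilt h u d"], of "\<bar>s\<bar> ^ 3"] by (simp add: e_def abs_mult power_abs)
  ultimately show ?thesis by blast
qed

end

lemma ising_flow_exists: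
  assumes fin: "finite I" and psd: "sym_psd_on I A"
  obtains a where "ising_flow I a" "\<And>i j. i \<in> I \<Longrightarrow> j \<in> I \<Longrightarrow> ising_flow.coup I a i j = A i j"
    "op_norm_on I (ising_flow.coup I a) = op_norm_on I A"
    "\<And>h f. (\<Sum>x\<in>spin_configs I. ising_prob I A h x * f x) = ising_flow.mean I a 1 h f"
proof -
  obtain a where a: "\<forall>i\<in>I. \<forall>j\<in>I. A i j = (\<Sum>k\<in>I. a k i * a k j)" "\<forall>k i. i \<notin> I \<longrightarrow> a k i = (0::real)"
    using psd_factorization[OF fin psd] by blast
  interpret ising_flow I a by standard (use fin a in auto)
  have coup: "coup i j = A i j" if "i \<in> I" "j \<in> I" for i j using a that by (simp add: coup_def)
  have op: "op_norm_on I coup = op_norm_on I A"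
    unfolding op_norm_on_def using coup by (intro SUP_cong refl L2_set_cong sum.cong) auto
  have w: "ising_weight I A h x = weight 1 h x" for h x
  proof -
    have "quad_form I A x = (\<Sum>i\<in>I. \<Sum>j\<in>I. x i * coup i j * x j)"
      unfolding quad_form_def by (intro sum.cong refl) (simp add: coup)
    also have "\<dots> = (\<Sum>k\<in>I. (dot I (a k) x)\<^sup>2)"
      unfolding coup_bilinear[symmetric] by (simp add: dot_def power2_eq_square)
    finally show ?thesis by (simp add: ising_weight_def weight_def dot_def)
  qed
  have "(\<Sum>x\<in>spin_configs I. ising_prob I A h x * f x) = mean 1 h f" for h f
    unfolding ising_prob_def w mean_def part_def by (simp add: sum_divide_distrib mult.commute)
  from that[OF ising_flow_axioms coup op this] show thesis .
qed

lemma ising_prob_nonneg: "finite I \<Longrightarrow> ising_prob I A h x \<ge> 0"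
  unfolding ising_prob_def ising_weight_def by (intro divide_nonneg_nonneg sum_nonneg) auto

lemma ising_integral:
  fixes f :: "real \<Rightarrow> 'b :: {banach, second_countable_topology}"
  assumes fin: "finite I" and X: "follows_ising M I A h X" and f: "f \<in> borel_measurable borel"
    and W: "W = (\<lambda>\<omega>. 1 / sqrt (card I) * (\<Sum>i\<in>I. X i \<omega>))"
  shows "W \<in> borel_measurable M" "integrable M (\<lambda>\<omega>. f (W \<omega>))"
    "(\<integral>\<omega>. f (W \<omega>) \<partial>M) = (\<Sum>x\<in>spin_configs I. ising_prob I A h x *\<^sub>R f (dot I (unif I) x))"
proof -
  let ?C = "spin_configs I" and ?X = "\<lambda>\<omega>. \<lambda>i\<in>I. X i \<omega>" and ?p = "ising_prob I A h"
  have d: "distributed M (count_space ?C) ?X (\<lambda>x. ennreal (?p x))"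
    using X by (simp add: follows_ising_def)
  have meas: "?X \<in> measurable M (count_space ?C)" by (rule distributed_measurable[OF d])
  have eq: "distr M (count_space ?C) ?X = point_measure ?C ?p"
    using distributed_distr_eq_density[OF d] by (simp add: point_measure_def)
  have W': "W = (\<lambda>\<omega>. dot I (unif I) (?X \<omega>))" unfolding W dot_unif by simp
  have g: "(\<lambda>x. f (dot I (unif I) x)) \<in> borel_measurable (count_space ?C)" by simp
  have dm: "dot I (unif I) \<in> borel_measurable (count_space ?C)" by simp
  show "W \<in> borel_measurable M"
    unfolding W' by (rule measurable_compose[OF meas dm])
  have pos: "0 \<le> ?p x" for x using fin by (rule ising_prob_nonneg)
  have finC: "finite ?C" using fin by (rule finite_spin_configs)
  have "integrable (distr M (count_space ?C) ?X) (\<lambda>x. f (dot I (unif I) x))"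
    unfolding eq by (rule integrable_point_measure_finite[OF finC])
  thus "integrable M (\<lambda>\<omega>. f (W \<omega>))"
    unfolding W' by (subst (asm) integrable_distr_eq[OF meas g])
  have "(\<integral>\<omega>. f (W \<omega>) \<partial>M) = (\<integral>x. f (dot I (unif I) x) \<partial>distr M (count_space ?C) ?X)"
    unfolding W' by (rule integral_distr[symmetric, OF meas g])
  also have "\<dots> = (\<Sum>x\<in>?C. ?p x *\<^sub>R f (dot I (unif I) x))"
    unfolding eq by (rule lebesgue_integral_point_measure_finite[OF finC]) (rule pos)
  finally show "(\<integral>\<omega>. f (W \<omega>) \<partial>M) = (\<Sum>x\<in>?C. ?p x *\<^sub>R f (dot I (unif I) x))" .
qed

theorem uniform_magnetization_estimates:
  fixes r :: nat and \<delta> :: real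
  assumes \<delta>: "0 < \<delta>" "\<delta> \<le> 1"
  shows "\<exists>C c. C > 0 \<and> (\<forall>H. c H > 0) \<and>
    (\<forall>(I :: (int ^ 'd) set) A h (M :: 'w measure) X W \<mu> v.
      finite I \<longrightarrow> I \<noteq> {} \<longrightarrow> sym_psd_on I A \<longrightarrow>
      (\<forall>i\<in>I. \<forall>j\<in>I. lattice_dist i j > int r \<longrightarrow> A i j = 0) \<longrightarrow> op_norm_on I A \<le> 1 - \<delta> \<longrightarrow>
      follows_ising M I A h X \<longrightarrow> W = (\<lambda>\<omega>. 1 / sqrt (card I) * (\<Sum>i\<in>I. X i \<omega>)) \<longrightarrow>
      \<mu> = (\<integral>\<omega>. W \<omega> \<partial>M) \<longrightarrow> v = (\<integral>\<omega>. (W \<omega> - \<mu>)\<^sup>2 \<partial>M) \<longrightarrow>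
      v \<le> C \<and> (\<forall>H. (\<forall>i\<in>I. \<bar>h i\<bar> \<le> H) \<longrightarrow> c H \<le> v) \<and>
      (\<forall>s. \<exists>e. \<bar>e\<bar> \<le> C / sqrt (card I) * \<bar>s\<bar> ^ 3 / 6 \<and>
         (\<integral>\<omega>. exp (s * (W \<omega> - \<mu>)) \<partial>M) = exp (s\<^sup>2 / 2 * v + e)))"
proof -
  obtain C c where C: "C > 0" and c: "\<forall>H. c H > 0" and est: "\<forall>(I :: (int ^ 'd) set) a.
     ising_flow I a \<longrightarrow> I \<noteq> {} \<longrightarrow> op_norm_on I (ising_flow.coup I a) \<le> 1 - \<delta> \<longrightarrow>
     (\<forall>i\<in>I. \<forall>j\<in>I. lattice_dist i j > int r \<longrightarrow> ising_flow.coup I a i j = 0) \<longrightarrow>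
     (\<forall>h. ising_flow.cum2 I a 1 h (dot I (unif I)) (dot I (unif I)) \<le> C
        \<and> \<bar>ising_flow.cum3 I a 1 h (dot I (unif I)) (dot I (unif I)) (dot I (unif I))\<bar> \<le> C / sqrt (card I)
        \<and> (\<forall>H. (\<forall>i\<in>I. \<bar>h i\<bar> \<le> H) \<longrightarrow> c H \<le> ising_flow.cum2 I a 1 h (dot I (unif I)) (dot I (unif I))))"
    using uniform_cumulant_estimates[OF \<delta>, of r, where 'd = 'd] by blast
  show ?thesis
  proof (intro exI[of _ C] exI[of _ c] conjI C c; (intro allI impI)?)
    fix I :: "(int ^ 'd) set" and A h and M :: "'w measure" and X W \<mu> v
    assume fin: "finite I" and ne: "I \<noteq> {}" and psd: "sym_psd_on I A"
      and range: "\<forall>i\<in>I. \<forall>j\<in>I. lattice_dist i j > int r \<longrightarrow> A i j = 0" and op: "op_norm_on I A \<le> 1 - \<delta>"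
      and X: "follows_ising M I A h X" and W: "W = (\<lambda>\<omega>. 1 / sqrt (card I) * (\<Sum>i\<in>I. X i \<omega>))"
      and \<mu>: "\<mu> = (\<integral>\<omega>. W \<omega> \<partial>M)" and v: "v = (\<integral>\<omega>. (W \<omega> - \<mu>)\<^sup>2 \<partial>M)"
    obtain a where a: "ising_flow I a" and coup: "\<And>i j. i \<in> I \<Longrightarrow> j \<in> I \<Longrightarrow> ising_flow.coup I a i j = A i j"
      and opa: "op_norm_on I (ising_flow.coup I a) = op_norm_on I A"
      and mean: "\<And>h f. (\<Sum>x\<in>spin_configs I. ising_prob I A h x * f x) = ising_flow.mean I a 1 h f"
      using ising_flow_exists[OF fin psd] by blast
    interpret ising_flow I a by (rule a)
    let ?D = "dot I (unif I)"
    have E: "(\<integral>\<omega>. f (W \<omega>) \<partial>M) = mean 1 h (\<lambda>x. f (?D x))" if "f \<in> borel_measurable borel" for f :: "real \<Rightarrow> real"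
      using ising_integral(3)[OF fin X that W] by (simp add: mean)
    have \<mu>': "\<mu> = mean 1 h ?D" unfolding \<mu> using E[of "\<lambda>x. x"] by simp
    have v': "v = cum2 1 h ?D ?D"
    proof -
      have "v = mean 1 h (\<lambda>x. (?D x - \<mu>)\<^sup>2)" unfolding v by (rule E) measurable
      also have "(\<lambda>x. (?D x - \<mu>)\<^sup>2) = (\<lambda>x. ?D x * ?D x - 2 * \<mu> * ?D x + \<mu> * \<mu>)"
        by (simp add: fun_eq_iff power2_eq_square algebra_simps)
      also have "mean 1 h \<dots> = cum2 1 h ?D ?D"
        unfolding mean_add mean_diff mean_cmult mean_const cum2_def \<mu>' by simp
      finally show ?thesis .
    qed
    have b: "cum2 1 h ?D ?D \<le> C \<and> \<bar>cum3 1 h ?D ?D ?D\<bar> \<le> C / sqrt (card I)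
        \<and> (\<forall>H. (\<forall>i\<in>I. \<bar>h i\<bar> \<le> H) \<longrightarrow> c H \<le> cum2 1 h ?D ?D)" for h
      using est a ne op opa range coup by simp
    show "v \<le> C \<and> (\<forall>H. (\<forall>i\<in>I. \<bar>h i\<bar> \<le> H) \<longrightarrow> c H \<le> v) \<and>
      (\<forall>s. \<exists>e. \<bar>e\<bar> \<le> C / sqrt (card I) * \<bar>s\<bar> ^ 3 / 6 \<and>
         (\<integral>\<omega>. exp (s * (W \<omega> - \<mu>)) \<partial>M) = exp (s\<^sup>2 / 2 * v + e))"
    proof (intro conjI allI)
      show "v \<le> C" using b[of h] by (simp add: v')
      show "(\<forall>i\<in>I. \<bar>h i\<bar> \<le> H) \<longrightarrow> c H \<le> v" for H using b[of h] by (simp add: v')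
      fix s
      have 1: "(\<integral>\<omega>. exp (s * (W \<omega> - \<mu>)) \<partial>M) = mean 1 h (\<lambda>x. exp (s * (?D x - \<mu>)))"
        by (rule E) measurable
      have 2: "\<bar>cum3 1 h ?D ?D ?D\<bar> \<le> C / sqrt (card I)" for h using b by blast
      show "\<exists>e. \<bar>e\<bar> \<le> C / sqrt (card I) * \<bar>s\<bar> ^ 3 / 6 \<and>
         (\<integral>\<omega>. exp (s * (W \<omega> - \<mu>)) \<partial>M) = exp (s\<^sup>2 / 2 * v + e)"
        unfolding 1 v' using centered_mgf_taylor[OF 2, of s h] unfolding \<mu>'[symmetric] .
    qed
  qed
qed

theorem corollary1p1:
  fixes r :: nat
    and \<Lambda> :: "nat \<Rightarrow> (int ^ 'd) set"
    and A :: "nat \<Rightarrow> int ^ 'd \<Rightarrow> int ^ 'd \<Rightarrow> real"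
    and h :: "nat \<Rightarrow> int ^ 'd \<Rightarrow> real"
    and M :: "nat \<Rightarrow> 'w measure"
    and X :: "nat \<Rightarrow> int ^ 'd \<Rightarrow> 'w \<Rightarrow> real"
    and W :: "nat \<Rightarrow> 'w \<Rightarrow> real"
    and \<mu> \<sigma> :: "nat \<Rightarrow> real"
  assumes "r \<ge> 1"
    and "\<And>n. n \<ge> 1 \<Longrightarrow> finite (\<Lambda> n) \<and> card (\<Lambda> n) = n"
    and "\<And>n. n \<ge> 1 \<Longrightarrow> sym_psd_on (\<Lambda> n) (A n)"
    and "\<And>n i j. n \<ge> 1 \<Longrightarrow> i \<in> \<Lambda> n \<Longrightarrow> j \<in> \<Lambda> n \<Longrightarrow> lattice_dist i j > int r \<Longrightarrow> A n i j = 0"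
    and "\<And>n. n \<ge> 1 \<Longrightarrow> follows_ising (M n) (\<Lambda> n) (A n) (h n) (X n)"
    and "(INF n\<in>{1..}. ereal (1 - op_norm_on (\<Lambda> n) (A n))) > 0"
    and "\<And>n. n \<ge> 1 \<Longrightarrow> W n = (\<lambda>\<omega>. 1 / sqrt (real n) * (\<Sum>i\<in>\<Lambda> n. X n i \<omega>))"
    and "\<And>n. n \<ge> 1 \<Longrightarrow> \<mu> n = prob_space.expectation (M n) (W n)"
    and "\<And>n. n \<ge> 1 \<Longrightarrow> \<sigma> n = sqrt (prob_space.variance (M n) (W n))"
  shows "(\<lambda>n. wasserstein2 (distr (M n) borel (W n)) (normal_law (\<mu> n) ((\<sigma> n)\<^sup>2))) \<longlonglongrightarrow> 0
    \<and> ((\<exists>C. \<forall>n\<ge>1. (MAX i\<in>\<Lambda> n. \<bar>h n i\<bar>) \<le> C) \<longrightarrow>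
      weak_conv_m (\<lambda>n. distr (M n) borel (\<lambda>\<omega>. (W n \<omega> - \<mu> n) / \<sigma> n)) std_normal_distribution)"
proof -
  note fin_card = assms(2) and psd = assms(3) and range = assms(4) and ising = assms(5)
    and \<mu> = assms(8) and \<sigma> = assms(9)
  obtain z where z: "0 < ereal z" "ereal z < (INF n\<in>{1..}. ereal (1 - op_norm_on (\<Lambda> n) (A n)))"
    using ereal_dense2[OF assms(6)] by auto
  define \<delta> where "\<delta> = min z 1"
  have \<delta>: "0 < \<delta>" "\<delta> \<le> 1" using z(1) by (auto simp: \<delta>_def)
  have op: "op_norm_on (\<Lambda> n) (A n) \<le> 1 - \<delta>" if "n \<ge> 1" for n
  proof -
    have "ereal z < ereal (1 - op_norm_on (\<Lambda> n) (A n))"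
      by (rule less_le_trans[OF z(2)], rule INF_lower) (use that in simp)
    thus ?thesis by (simp add: \<delta>_def)
  qed
  obtain C c where C: "C > 0" and c0: "\<forall>H. c H > 0" and
    est: "\<forall>(I :: (int ^ 'd) set) A h (M :: 'w measure) X W \<mu> v.
      finite I \<longrightarrow> I \<noteq> {} \<longrightarrow> sym_psd_on I A \<longrightarrow>
      (\<forall>i\<in>I. \<forall>j\<in>I. lattice_dist i j > int r \<longrightarrow> A i j = 0) \<longrightarrow> op_norm_on I A \<le> 1 - \<delta> \<longrightarrow>
      follows_ising M I A h X \<longrightarrow> W = (\<lambda>\<omega>. 1 / sqrt (card I) * (\<Sum>i\<in>I. X i \<omega>)) \<longrightarrow>
      \<mu> = (\<integral>\<omega>. W \<omega> \<partial>M) \<longrightarrow> v = (\<integral>\<omega>. (W \<omega> - \<mu>)\<^sup>2 \<partial>M) \<longrightarrow>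
      v \<le> C \<and> (\<forall>H. (\<forall>i\<in>I. \<bar>h i\<bar> \<le> H) \<longrightarrow> c H \<le> v) \<and>
      (\<forall>s. \<exists>e. \<bar>e\<bar> \<le> C / sqrt (card I) * \<bar>s\<bar> ^ 3 / 6 \<and>
         (\<integral>\<omega>. exp (s * (W \<omega> - \<mu>)) \<partial>M) = exp (s\<^sup>2 / 2 * v + e))"
    using uniform_magnetization_estimates[OF \<delta>, of r, where 'd = 'd and 'w = 'w]
    by (elim exE conjE) (rule that)
  have c: "c H > 0" for H using c0 by blast
  have fin: "finite (\<Lambda> n)" and card: "card (\<Lambda> n) = n" if "n \<ge> 1" for n using fin_card[OF that] by auto
  have W: "W n = (\<lambda>\<omega>. 1 / sqrt (card (\<Lambda> n)) * (\<Sum>i\<in>\<Lambda> n. X n i \<omega>))" if "n \<ge> 1" for n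
    using assms(7)[OF that] card[OF that] by simp
  have \<mu>': "\<mu> n = (\<integral>\<omega>. W n \<omega> \<partial>M n)" if "n \<ge> 1" for n using \<mu>[OF that] .
  have \<sigma>2: "(\<sigma> n)\<^sup>2 = (\<integral>\<omega>. (W n \<omega> - \<mu> n)\<^sup>2 \<partial>M n)" if "n \<ge> 1" for n
    unfolding \<sigma>[OF that] \<mu>[OF that] by simp
  have \<sigma>0: "\<sigma> n \<ge> 0" if "n \<ge> 1" for n using \<sigma>[OF that] by simp
  have bounds: "(\<sigma> n)\<^sup>2 \<le> C" "(\<forall>i\<in>\<Lambda> n. \<bar>h n i\<bar> \<le> H) \<Longrightarrow> c H \<le> (\<sigma> n)\<^sup>2"
    "\<exists>e. \<bar>e\<bar> \<le> C / sqrt n * \<bar>s\<bar> ^ 3 / 6 \<and>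
         (\<integral>\<omega>. exp (s * (W n \<omega> - \<mu> n)) \<partial>M n) = exp (s\<^sup>2 / 2 * (\<sigma> n)\<^sup>2 + e)" if n: "n \<ge> 1" for n H s
  proof -
    have ne: "\<Lambda> n \<noteq> {}" using card[OF n] n by auto
    from est[rule_format, OF fin[OF n] ne psd[OF n] _ op[OF n] ising[OF n] W[OF n] \<mu>'[OF n] \<sigma>2[OF n]] range[OF n]
    have main: "(\<sigma> n)\<^sup>2 \<le> C \<and> (\<forall>H. (\<forall>i\<in>\<Lambda> n. \<bar>h n i\<bar> \<le> H) \<longrightarrow> c H \<le> (\<sigma> n)\<^sup>2) \<and>
      (\<forall>s. \<exists>e. \<bar>e\<bar> \<le> C / sqrt (card (\<Lambda> n)) * \<bar>s\<bar> ^ 3 / 6 \<and>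
         (\<integral>\<omega>. exp (s * (W n \<omega> - \<mu> n)) \<partial>M n) = exp (s\<^sup>2 / 2 * (\<sigma> n)\<^sup>2 + e))" by blast
    then    show "(\<sigma> n)\<^sup>2 \<le> C" "(\<forall>i\<in>\<Lambda> n. \<bar>h n i\<bar> \<le> H) \<Longrightarrow> c H \<le> (\<sigma> n)\<^sup>2"
      "\<exists>e. \<bar>e\<bar> \<le> C / sqrt n * \<bar>s\<bar> ^ 3 / 6 \<and>
         (\<integral>\<omega>. exp (s * (W n \<omega> - \<mu> n)) \<partial>M n) = exp (s\<^sup>2 / 2 * (\<sigma> n)\<^sup>2 + e)"
      unfolding card[OF n] by blast+
  qed
  note ising_W = ising_integral[OF fin ising _ W]
  have prob: "prob_space (M n)" if "n \<ge> 1" for n using ising[OF that] by (simp add: follows_ising_def)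
  have Wm: "W n \<in> borel_measurable (M n)" if "n \<ge> 1" for n
    using ising_W(1)[OF that that _ that, of "\<lambda>x::real. x"] by simp

  define Z where "Z n \<omega> = (W n \<omega> - \<mu> n) / \<sigma> n" for n \<omega>
  have Zm: "Z n \<in> borel_measurable (M n)" if "n \<ge> 1" for n
    using Wm[OF that] unfolding Z_def[abs_def] by measurable
  have Z_distribution: "real_distribution (distr (M n) borel (Z n))" if "n \<ge> 1" for n
    using prob_space.real_distribution_distr[OF prob[OF that] Zm[OF that]] .

  have clt: "weak_conv_m (\<lambda>k. distr (M (q k)) borel (Z (q k))) std_normal_distribution"
    if q: "strict_mono q" "\<And>k. q k \<ge> 1" and \<eta>: "\<eta> > 0" "\<And>k. \<sigma> (q k) \<ge> \<eta>" for q \<eta>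
  proof (rule levy_continuity)
    show "real_distribution (distr (M (q k)) borel (Z (q k)))" for k by (rule Z_distribution[OF q(2)])
    show "real_distribution std_normal_distribution" by (rule real_dist_normal_dist)
    fix t
    define S where "S k = spin_configs (\<Lambda> (q k))" for k
    define p where "p k = ising_prob (\<Lambda> (q k)) (A (q k)) (h (q k))" for k
    define y where "y k x = (dot (\<Lambda> (q k)) (unif (\<Lambda> (q k))) x - \<mu> (q k)) / \<sigma> (q k)" for k x
    have mgf: "(\<lambda>k. \<Sum>x\<in>S k. p k x * exp (s * y k x)) \<longlonglongrightarrow> exp (s\<^sup>2 / 2)" for s
    proof -
      have "\<exists>e. \<bar>e\<bar> \<le> C / sqrt (q k) * \<bar>s / \<sigma> (q k)\<bar> ^ 3 / 6 \<and>
          (\<Sum>x\<in>S k. p k x * exp (s * y k x)) = exp (s\<^sup>2 / 2 + e)" for k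
      proof -
        have pos: "\<sigma> (q k) > 0" using \<eta> by (meson less_le_trans)
        obtain e where e: "\<bar>e\<bar> \<le> C / sqrt (q k) * \<bar>s / \<sigma> (q k)\<bar> ^ 3 / 6"
          "(\<integral>\<omega>. exp (s / \<sigma> (q k) * (W (q k) \<omega> - \<mu> (q k))) \<partial>M (q k)) = exp ((s / \<sigma> (q k))\<^sup>2 / 2 * (\<sigma> (q k))\<^sup>2 + e)"
          using bounds(3)[OF q(2)] by blast
        have "(\<Sum>x\<in>S k. p k x * exp (s * y k x)) = (\<integral>\<omega>. exp (s / \<sigma> (q k) * (W (q k) \<omega> - \<mu> (q k))) \<partial>M (q k))"
          using ising_W(3)[OF q(2) q(2) _ q(2), of "\<lambda>u. exp (s / \<sigma> (q k) * (u - \<mu> (q k)))" k]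
          by (simp add: S_def p_def y_def)
        also have "\<dots> = exp (s\<^sup>2 / 2 + e)" unfolding e(2) using pos by (simp add: power_divide)
        finally show ?thesis using e(1) by blast
      qed
      then obtain e where e: "\<And>k. \<bar>e k\<bar> \<le> C / sqrt (q k) * \<bar>s / \<sigma> (q k)\<bar> ^ 3 / 6"
        "\<And>k. (\<Sum>x\<in>S k. p k x * exp (s * y k x)) = exp (s\<^sup>2 / 2 + e k)" by metis
      have e_le: "\<bar>e k\<bar> \<le> C * (\<bar>s\<bar> / \<eta>) ^ 3 / 6 * (1 / sqrt (q k))" for k
      proof -
        have "\<bar>s / \<sigma> (q k)\<bar> \<le> \<bar>s\<bar> / \<eta>"
          using \<eta>(1) \<eta>(2)[of k] by (simp add: abs_divide frac_le)
        hence "\<bar>s / \<sigma> (q k)\<bar> ^ 3 \<le> (\<bar>s\<bar> / \<eta>) ^ 3" by (intro power_mono) auto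
        hence "C / sqrt (q k) * \<bar>s / \<sigma> (q k)\<bar> ^ 3 / 6 \<le> C / sqrt (q k) * (\<bar>s\<bar> / \<eta>) ^ 3 / 6"
          using C by (intro divide_right_mono mult_left_mono) auto
        thus ?thesis using e(1)[of k] by (simp add: mult_ac)
      qed
      have "filterlim (\<lambda>k. real (q k)) at_top sequentially"
        using filterlim_compose[OF filterlim_real_sequentially filterlim_subseq[OF q(1)]] .
      hence "filterlim (\<lambda>k. sqrt (q k)) at_top sequentially"
        by (rule filterlim_compose[OF sqrt_at_top])
      hence "(\<lambda>k. C * (\<bar>s\<bar> / \<eta>) ^ 3 / 6 * (1 / sqrt (q k))) \<longlonglongrightarrow> C * (\<bar>s\<bar> / \<eta>) ^ 3 / 6 * 0"
        by (intro tendsto_mult tendsto_const tendsto_divide_0[OF tendsto_const] filterlim_at_top_imp_at_infinity)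
      hence "e \<longlonglongrightarrow> 0"
        by (intro Lim_null_comparison[of e]) (use e_le in auto)
      hence "(\<lambda>k. exp (s\<^sup>2 / 2 + e k)) \<longlonglongrightarrow> exp (s\<^sup>2 / 2 + 0)" by (intro tendsto_intros)
      thus ?thesis unfolding e(2) by simp
    qed
    have "char (distr (M (q k)) borel (Z (q k))) t
        = (\<Sum>x\<in>S k. complex_of_real (p k x) * exp (\<i> * complex_of_real (t * y k x)))" for k
    proof -
      have "char (distr (M (q k)) borel (Z (q k))) t = (\<integral>\<omega>. iexp (t * Z (q k) \<omega>) \<partial>M (q k))"
        unfolding char_def by (rule integral_distr) (use Zm[OF q(2)] in auto)
      also have "\<dots> = (\<Sum>x\<in>S k. p k x *\<^sub>R iexp (t * y k x))"
        unfolding Z_def S_def p_def y_def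
        by (rule ising_W(3)[OF q(2) q(2) _ q(2), of "\<lambda>u. iexp (t * ((u - \<mu> (q k)) / \<sigma> (q k)))"]) measurable
      finally show ?thesis by (simp add: scaleR_conv_of_real)
    qed
    moreover have "(\<lambda>k. \<Sum>x\<in>S k. complex_of_real (p k x) * exp (\<i> * complex_of_real (t * y k x)))
        \<longlonglongrightarrow> complex_of_real (exp (- t\<^sup>2 / 2))"
      by (rule finite_mgf_tendsto_imp_char_tendsto[OF _ _ mgf])
        (auto simp: S_def p_def finite_spin_configs fin[OF q(2)] ising_prob_nonneg)
    ultimately show "(\<lambda>k. char (distr (M (q k)) borel (Z (q k))) t) \<longlonglongrightarrow> char std_normal_distribution t"
      by (simp add: char_std_normal_distribution)
  qed

  let ?w = "\<lambda>n. wasserstein2 (distr (M n) borel (W n)) (normal_law (\<mu> n) ((\<sigma> n)\<^sup>2))"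
  have W2_small: "?w n \<le> ennreal (2 * \<sigma> n)"
    if n: "n \<ge> 1" for n
  proof -
    have "?w n \<le> ennreal (2 * sqrt ((\<sigma> n)\<^sup>2))"
    proof (rule wasserstein2_le_second_moments)
      show "prob_space (distr (M n) borel (W n))" by (rule prob_space.prob_space_distr[OF prob[OF n] Wm[OF n]])
      have "(\<integral>\<^sup>+ x. ennreal ((x - \<mu> n)\<^sup>2) \<partial>distr (M n) borel (W n)) = (\<integral>\<^sup>+ \<omega>. ennreal ((W n \<omega> - \<mu> n)\<^sup>2) \<partial>M n)"
        by (rule nn_integral_distr[OF Wm[OF n]]) simp
      also have "\<dots> = ennreal (\<integral>\<omega>. (W n \<omega> - \<mu> n)\<^sup>2 \<partial>M n)"
        by (rule nn_integral_eq_integral) (use ising_W(2)[OF n n _ n, of "\<lambda>u. (u - \<mu> n)\<^sup>2"] in auto)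
      finally show "(\<integral>\<^sup>+ x. ennreal ((x - \<mu> n)\<^sup>2) \<partial>distr (M n) borel (W n)) \<le> ennreal ((\<sigma> n)\<^sup>2)"
        by (simp add: \<sigma>2[OF n])
    qed (simp_all add: prob_space_normal_law sets_normal_law normal_law_second_moment)
    thus ?thesis using \<sigma>0[OF n] by simp
  qed

  have W2_subseq: "(\<lambda>k. ?w (q k)) \<longlonglongrightarrow> 0"
    if q: "strict_mono q" "\<And>k. q k \<ge> 1" and \<eta>: "\<eta> > 0" "\<And>k. \<sigma> (q k) \<ge> \<eta>" for q \<eta>
  proof -
    let ?\<nu> = "\<lambda>k. distr (M (q k)) borel (Z (q k))"
    have pos: "\<sigma> (q k) > 0" for k using \<eta> by (meson less_le_trans)
    have Z2: "integrable (?\<nu> k) (\<lambda>x. x\<^sup>2)" "(\<integral>x. x\<^sup>2 \<partial>?\<nu> k) = 1" for k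
    proof -
      have "integrable (M (q k)) (\<lambda>\<omega>. (Z (q k) \<omega>)\<^sup>2)"
        using ising_W(2)[OF q(2) q(2) _ q(2), of "\<lambda>u. ((u - \<mu> (q k)) / \<sigma> (q k))\<^sup>2"] by (simp add: Z_def)
      thus "integrable (?\<nu> k) (\<lambda>x. x\<^sup>2)" by (subst integrable_distr_eq[OF Zm[OF q(2)]]) auto
      have "(\<integral>x. x\<^sup>2 \<partial>?\<nu> k) = (\<integral>\<omega>. (Z (q k) \<omega>)\<^sup>2 \<partial>M (q k))"
        by (rule integral_distr[OF Zm[OF q(2)]]) simp
      also have "\<dots> = (\<sigma> (q k))\<^sup>2 / (\<sigma> (q k))\<^sup>2"
        unfolding Z_def power_divide by (simp add: \<sigma>2[OF q(2)])
      finally show "(\<integral>x. x\<^sup>2 \<partial>?\<nu> k) = 1" using pos[of k] by simp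
    qed
    have "distr (?\<nu> k) borel (\<lambda>x. \<mu> (q k) + \<sigma> (q k) * x) = distr (M (q k)) borel (W (q k))" for k
    proof -
      have "distr (?\<nu> k) borel (\<lambda>x. \<mu> (q k) + \<sigma> (q k) * x)
          = distr (M (q k)) borel ((\<lambda>x. \<mu> (q k) + \<sigma> (q k) * x) \<circ> Z (q k))"
        by (rule distr_distr) (use Zm[OF q(2)] in auto)
      also have "(\<lambda>x. \<mu> (q k) + \<sigma> (q k) * x) \<circ> Z (q k) = W (q k)"
        using pos[of k] by (simp add: fun_eq_iff Z_def)
      finally show ?thesis .
    qed
    moreover have "(\<lambda>k. wasserstein2 (distr (?\<nu> k) borel (\<lambda>x. \<mu> (q k) + \<sigma> (q k) * x))
        (normal_law (\<mu> (q k)) ((\<sigma> (q k))\<^sup>2))) \<longlonglongrightarrow> 0"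
    proof (rule wasserstein2_affine_tendsto_0[OF Z_distribution[OF q(2)] clt[OF q \<eta>] Z2 pos])
      show "\<sigma> (q k) \<le> sqrt C" for k using bounds(1)[OF q(2)] by (rule real_le_rsqrt)
    qed
    ultimately show ?thesis by simp
  qed

  show ?thesis
  proof (intro conjI impI)
    show "?w \<longlonglongrightarrow> 0"
    proof (rule ccontr)
      \<comment> \<open>A subsequence along which the distance stays away from zero has variances bounded below, so the
        limit theorem applies to it.\<close>
      assume "\<not> ?w \<longlonglongrightarrow> 0"
      hence "\<exists>b>0. \<not> (\<forall>\<^sub>F n in sequentially. ?w n < b)"
        using order_tendstoI[of "0::ennreal" ?w sequentially] not_less_zero by blast
      then obtain b :: ennreal where b: "b > 0" "\<not> (\<forall>\<^sub>F n in sequentially. ?w n < b)" by blast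
      obtain e where e: "e > 0" "ennreal e \<le> b"
      proof (cases "b = top")
        case False
        thus ?thesis using b(1) that[of "enn2real b"] by (simp add: enn2real_positive_iff less_top)
      qed (use that[of 1] in simp)
      have "infinite ({n. b \<le> ?w n})"
        using b(2) by (simp add: not_eventually cofinite_eq_sequentially[symmetric] frequently_cofinite not_less)
      hence "infinite ({n. b \<le> ?w n} - {0})" by simp
      from infinite_enumerate[OF this] obtain q where q: "strict_mono (q :: nat \<Rightarrow> nat)"
        and q': "\<And>k. q k \<in> {n. b \<le> ?w n} - {0}" by blast
      have q1: "q k \<ge> 1" for k using q'[of k] by auto
      have "\<sigma> (q k) \<ge> e / 2" for k
      proof -
        have "ennreal e \<le> ennreal (2 * \<sigma> (q k))"
          using e(2) q'[of k] W2_small[OF q1[of k]] by auto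
        thus ?thesis using \<sigma>0[OF q1] by (simp add: ennreal_le_iff)
      qed
      from W2_subseq[OF q q1 _ this] e(1) have "(\<lambda>k. ?w (q k)) \<longlonglongrightarrow> 0" by simp
      from order_tendstoD(2)[OF this b(1)] show False
        using q' by (auto simp: eventually_sequentially not_less[symmetric])
    qed
  next
    assume "\<exists>C. \<forall>n\<ge>1. (MAX i\<in>\<Lambda> n. \<bar>h n i\<bar>) \<le> C"
    then obtain H where H: "\<And>n. n \<ge> 1 \<Longrightarrow> (MAX i\<in>\<Lambda> n. \<bar>h n i\<bar>) \<le> H" by blast
    have "\<sigma> (Suc k) \<ge> sqrt (c H)" for k
    proof -
      have "\<bar>h (Suc k) i\<bar> \<le> H" if "i \<in> \<Lambda> (Suc k)" for i
        by (rule order_trans[OF Max_ge H[of "Suc k"]]) (use that fin[of "Suc k"] in auto)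
      hence "c H \<le> (\<sigma> (Suc k))\<^sup>2" by (intro bounds(2)) auto
      thus ?thesis using \<sigma>0[of "Suc k"] by (intro real_le_lsqrt) (auto intro: less_imp_le[OF c])
    qed
    \<comment> \<open>The shift by one avoids the index \<open>0\<close>, about which nothing is assumed.\<close>
    hence "weak_conv_m (\<lambda>k. distr (M (Suc k)) borel (Z (Suc k))) std_normal_distribution"
      using c[of H] by (intro clt[of Suc "sqrt (c H)"]) (auto simp: strict_mono_Suc_iff)
    hence "weak_conv_m (\<lambda>n. distr (M n) borel (Z n)) std_normal_distribution"
      unfolding weak_conv_m_def weak_conv_def by (auto intro: LIMSEQ_imp_Suc)
    thus "weak_conv_m (\<lambda>n. distr (M n) borel (\<lambda>\<omega>. (W n \<omega> - \<mu> n) / \<sigma> n)) std_normal_distribution"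
      by (simp add: Z_def[abs_def])
  qed
qed

end
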